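(* Let $\pi: V\to W$ be a linear projection (surjective linear map) of finite-dimensional real vector spaces, $P\subset V$ a polytope of full dimension and $Q=\pi(P)$. With the posets $\mathcal T,\mathcal T_{coh},\Gamma^*,\Gamma^*_{vir},\mathcal T^*,\mathcal T^*_{coh},\Gamma,\Gamma_{vir}$ of the pair $(P,Q)$ defined in the context: (1) $\mathcal T(P,Q)$ is canonically anti-isomorphic to $\Gamma^*_{vir}(P,Q)$, and this extends the anti-isomorphism between $\mathcal T_{coh}(P,Q)$ and $\Gamma^*(P,Q)$; (2) $\mathcal T^*(P,Q)$ is canonically anti-isomorphic to $\Gamma_{vir}(P,Q)$, and this extends the anti-isomorphism between $\mathcal T^*_{coh}(P,Q)$ and $\Gamma(P,Q)$.
   Context: Two posets are anti-isomorphic if one is isomorphic to the opposite of the other. The canonical correspondence in (1) is $\mathcal F\mapsto\{N(P,F)\mid F\in\mathcal F\}$, and in (2) it is $\mathcal C\mapsto\{F\mid N(P,F)\in\mathcal C\}$. The anti-isomorphism between $\mathcal T_{coh}$ and $\Gamma^*$ is $\mathcal F(\psi)\leftrightarrow\sigma(\psi)$, and that between $\mathcal T^*_{coh}$ and $\Gamma$ is $\Delta(\mathbf c)\leftrightarrow\mathbf c$. Elements of $\Gamma^*$ and of $\Gamma$ are regarded as the elements of $\Gamma^*_{vir}$ and $\Gamma_{vir}$ given by constant maps. Basic notation. $L(P)$ is the face lattice of $P$ (only nonempty faces are used below). $\pi^\vee:V^*\to(\ker\pi)^*$ is the map dual to the inclusion $\ker\pi\subset V$. For $\varphi\in V^*$,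 $P^\varphi$ is the face of $P$ on which $\varphi$ is maximal. For a nonempty face $F$, $N(P,F)=\{\varphi\in V^*: F\subseteq P^\varphi\}$ is the normal cone of $F$, and $\Delta(P)$, the set of all these normal cones, is the normal fan of $P$. relint denotes relative interior. Cells. For $q\in Q$ the cell of $q$ is $\mathbf c(q)=\bigcap\{\pi(F)\mid F\in L(P),\ q\in\pi(F)\}$. $\Gamma=\Gamma(P,Q)$ is the set of all cells, ordered by inclusion. Cones. For $\psi\in(\ker\pi)^*$ put $\sigma(\psi)=\bigcap\{\pi^\vee(N(P,F))\mid F\in L(P),\ \psi\in\pi^\vee(N(P,F))\}$. $\Gamma^*=\Gamma^*(P,Q)$ is the set of all these cones, ordered by inclusion. The faces $F_{\mathbf c,\psi}$. For $q\in Q$ let $P_q=P\cap\pi^{-1}(q)$, which lies in a translate of $\ker\pi$; for $\psi\in(\ker\pi)^*$ let $P_q^\psi$ be the face of $P_q$ on which $\psi$ is maximal, and $F_{q,\psi}$ the smallest face of $P$ containing $P_q^\psi$. $F_{q,\psi}$ depends only on the cell $\mathbf c$ with $q\in\operatorname{relint}\mathbf c$ and on the cone $\sigma\in\Gamma^*$ with $\psi\in\operatorname{relint}\sigma$; accordingly one writes $F_{\mathbf c,\psi}$, $F_{q,\sigma}$. For $q\in\operatorname{relint}\mathbf c$, the normal fan of $P_q$ in $(\ker\pi)^*$ depends only on $\mathbf c$, and $[\psi]_{\mathbf c}$ denotes its smallest cone containing $\psi$. Strings. For $\psi\in(\ker\pi)^*$ the coherent string of $\psi$ is $\mathcal F(\psi)=\{F_{\mathbf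 c,\psi}\mid\mathbf c\in\Gamma\}$; it depends only on $\sigma=\sigma(\psi)$ and is also written $\mathcal F(\sigma)$. $\mathcal T_{coh}$ is the set of coherent strings. A locally coherent string is a collection $\mathcal F(\widetilde\Psi)=\{F_{\mathbf c,\widetilde\Psi(\mathbf c)}\mid\mathbf c\in\Gamma\}$, where $\widetilde\Psi:\Gamma\to(\ker\pi)^*$ is a map satisfying the locally coherent condition: $\operatorname{relint}[\widetilde\Psi(\mathbf c)]_{\mathbf c}\subset\operatorname{relint}[\widetilde\Psi(\mathbf c')]_{\mathbf c'}$ whenever $\mathbf c\ge\mathbf c'$. $\mathcal T$ is the set of locally coherent strings. Both $\mathcal T_{coh}$ and $\mathcal T$ are ordered by $\mathcal F\le\mathcal F'$ iff $\bigcup\mathcal F\subset\bigcup\mathcal F'$. Virtual cones. A virtual cone is a collection $\mathcal C(\widetilde\sigma)=\{N(P,F_{\mathbf c,\widetilde\sigma(\mathbf c)})\mid\mathbf c\in\Gamma\}$ where $\widetilde\sigma:\Gamma\to(\ker\pi)^*$ satisfies the same locally coherent condition. $\Gamma^*_{vir}$ is the set of virtual cones, partially ordered by inclusion (of the unions of their members). Costrings. For $\mathbf c\in\Gamma$ the coherent costring is $\Delta(\mathbf c)=\{N(P,F_{\mathbf c,\psi})\mid\psi\in(\ker\pi)^*\}$; $\mathcal T^*_{coh}$ is the set of these, ordered by $\Delta(\mathbf c)\le\Delta(\mathbf c')$ iff $\bigcup\Delta(\mathbf c)\subset\bigcup\Delta(\mathbf c')$. A locally coherent costring is a subcollection $\mathcal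 C\subset\Delta(P)$ such that (i) the cones $\pi^\vee(\tau)$, $\tau\in\mathcal C$, form a cone subdivision of $(\ker\pi)^*$ without repetition (they form a fan, with cones not required to be strongly convex, whose union is $(\ker\pi)^*$, and distinct members of $\mathcal C$ have distinct images); (ii) for $\tau,\tau'\in\mathcal C$: $\pi^\vee(\tau)\subset\pi^\vee(\tau')$ iff $\tau=(\pi^\vee)^{-1}(\pi^\vee(\tau))\cap\tau'$. $\mathcal T^*$ is the set of locally coherent costrings, partially ordered by inclusion (of the unions of their members). Virtual cells. For $q\in Q$ and $\sigma\in\Gamma^*$ let $[q]_\sigma$ be the smallest face in $\mathcal F(\sigma)$ whose image under $\pi$ contains $q$. A virtual cell is a collection $\mathcal F(\widetilde{\mathbf c})=\{F_{\widetilde{\mathbf c}(\sigma),\sigma}\mid\sigma\in\Gamma^*\}$ where $\widetilde{\mathbf c}:\Gamma^*\to Q$ satisfies the locally coherent condition: $\operatorname{relint}\pi([\widetilde{\mathbf c}(\sigma)]_\sigma)\subset\operatorname{relint}\pi([\widetilde{\mathbf c}(\sigma')]_{\sigma'})$ whenever $\sigma\ge\sigma'$. $\Gamma_{vir}$ is the set of virtual cells, partially ordered by inclusion: $\widetilde{\mathbf c}\le\widetilde{\mathbf c}'$ iff $\bigcup\mathcal F(\widetilde{\mathbf c})\subset\bigcup\mathcal F(\widetilde{\mathbf c}')$.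
   Formalization: Virtual cones and virtual cells are ordered by inclusion of corresponding members (for each cell, resp. each cone in Γ* ) instead of inclusion of unions, since inclusion of unions is not antisymmetric on them and the claim fails with it. *)

theory Defs
  imports "HOL-Analysis.Analysis" "HOL-Library.Function_Algebras"
begin

text \<open>
  Linear functionals on a subspace are represented as functions on the ambient type, so that
  convexity, faces and relative interiors of sets of functionals are the library notions. The vector
  space structure on functions is pointwise; the topology is the library's product topology, which on
  a finite-dimensional space of functionals is the usual one.
\<close>

instantiation "fun" :: (type, real_vector) real_vector
begin

definition scaleR_fun :: "real \<Rightarrow> ('a \<Rightarrow> 'b) \<Rightarrow> 'a \<Rightarrow> 'b"
  where "scaleR_fun r f = (\<lambda>x. r *\<^sub>R f x)"

instance
  by standard (auto simp: scaleR_fun_def fun_eq_iff algebra_simps)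

end

lemma scaleR_fun_apply [simp]: "(r *\<^sub>R f) x = r *\<^sub>R f x"
  by (simp add: scaleR_fun_def)


section \<open>Dual spaces, faces and normal fans\<close>

text \<open>The dual of a subspace \<open>S\<close>. Values outside \<open>S\<close> carry no information and are normalised to 0, so
  that equality of functions is equality of functionals on \<open>S\<close>.\<close>

definition dual_space :: "'v::real_vector set \<Rightarrow> ('v \<Rightarrow> real) set" where
  "dual_space S = {f. (\<forall>x\<in>S. \<forall>y\<in>S. f (x + y) = f x + f y) \<and>
                      (\<forall>r. \<forall>x\<in>S. f (r *\<^sub>R x) = r * f x) \<and>
                      (\<forall>x. x \<notin> S \<longrightarrow> f x = 0)}"

text \<open>The map of dual spaces that is dual to the inclusion of \<open>S\<close>.\<close>

definition dual_restrict :: "'v set \<Rightarrow> ('v \<Rightarrow> real) \<Rightarrow> ('v \<Rightarrow> real)" where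
  "dual_restrict S f = (\<lambda>x. if x \<in> S then f x else 0)"

text \<open>The points of \<open>X\<close> where \<open>f\<close> is maximal. Only differences of points of \<open>X\<close> are evaluated: for a
  functional \<open>f\<close> on \<open>S\<close> this makes sense whenever \<open>X\<close> lies in a translate of \<open>S\<close>.\<close>

definition max_face :: "('v::real_vector \<Rightarrow> real) \<Rightarrow> 'v set \<Rightarrow> 'v set" where
  "max_face f X = {x\<in>X. \<forall>y\<in>X. f (y - x) \<le> 0}"

definition faces :: "'v::real_vector set \<Rightarrow> 'v set set" where
  "faces X = {F. F face_of X \<and> F \<noteq> {}}"

definition normal_cone :: "'v::real_vector set \<Rightarrow> 'v set \<Rightarrow> 'v set \<Rightarrow> ('v \<Rightarrow> real) set" where
  "normal_cone S X F = {f \<in> dual_space S. F \<subseteq> max_face f X}"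

definition normal_fan :: "'v::real_vector set \<Rightarrow> 'v set \<Rightarrow> ('v \<Rightarrow> real) set set" where
  "normal_fan S X = normal_cone S X ` faces X"

text \<open>A chosen point in the relative interior, used for notions that do not depend on the choice.\<close>

definition rel_point :: "'a::{real_vector,topological_space} set \<Rightarrow> 'a" where
  "rel_point X = (SOME x. x \<in> rel_interior X)"


section \<open>Cells, cones and the faces attached to them\<close>

text \<open>Throughout, \<open>p\<close> is the projection, \<open>V\<close> its domain and \<open>P\<close> the polytope; \<open>Q\<close> is \<open>p ` P\<close>.\<close>

definition ker :: "('v::real_vector \<Rightarrow> 'w::real_vector) \<Rightarrow> 'v set \<Rightarrow> 'v set" where
  "ker p V = {x\<in>V. p x = 0}"

definition ker_dual :: "('v::real_vector \<Rightarrow> 'w::real_vector) \<Rightarrow> 'v set \<Rightarrow> ('v \<Rightarrow> real) set" where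
  "ker_dual p V = dual_space (ker p V)"

definition proj_dual ::
  "('v::real_vector \<Rightarrow> 'w::real_vector) \<Rightarrow> 'v set \<Rightarrow> ('v \<Rightarrow> real) \<Rightarrow> ('v \<Rightarrow> real)" where
  "proj_dual p V = dual_restrict (ker p V)"

definition cell :: "('v::real_vector \<Rightarrow> 'w::real_vector) \<Rightarrow> 'v set \<Rightarrow> 'w \<Rightarrow> 'w set" where
  "cell p P q = \<Inter> {p ` F |F. F \<in> faces P \<and> q \<in> p ` F}"

definition cells :: "('v::real_vector \<Rightarrow> 'w::real_vector) \<Rightarrow> 'v set \<Rightarrow> 'w set set" where
  "cells p P = cell p P ` (p ` P)"

definition cone_at :: "('v::real_vector \<Rightarrow> 'w::real_vector) \<Rightarrow> 'v set \<Rightarrow> 'v set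
    \<Rightarrow> ('v \<Rightarrow> real) \<Rightarrow> ('v \<Rightarrow> real) set" where
  "cone_at p V P \<psi> = \<Inter> {proj_dual p V ` normal_cone V P F |F.
                          F \<in> faces P \<and> \<psi> \<in> proj_dual p V ` normal_cone V P F}"

definition cones :: "('v::real_vector \<Rightarrow> 'w::real_vector) \<Rightarrow> 'v set \<Rightarrow> 'v set
    \<Rightarrow> ('v \<Rightarrow> real) set set" where
  "cones p V P = cone_at p V P ` ker_dual p V"

definition fiber :: "('v::real_vector \<Rightarrow> 'w::real_vector) \<Rightarrow> 'v set \<Rightarrow> 'w \<Rightarrow> 'v set" where
  "fiber p P q = P \<inter> p -` {q}"

text \<open>The smallest face of \<open>P\<close> containing the part of the fiber over \<open>q\<close> where \<open>\<psi>\<close> is maximal. It only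
  depends on the cell with \<open>q\<close> in its relative interior and the cone with \<open>\<psi>\<close> in its relative
  interior, hence the variants indexed by cells and cones.\<close>

definition face_pt :: "('v::real_vector \<Rightarrow> 'w::real_vector) \<Rightarrow> 'v set
    \<Rightarrow> 'w \<Rightarrow> ('v \<Rightarrow> real) \<Rightarrow> 'v set" where
  "face_pt p P q \<psi> = \<Inter> {F. F face_of P \<and> max_face \<psi> (fiber p P q) \<subseteq> F}"

definition face_cell :: "('v::real_vector \<Rightarrow> 'w::euclidean_space) \<Rightarrow> 'v set
    \<Rightarrow> 'w set \<Rightarrow> ('v \<Rightarrow> real) \<Rightarrow> 'v set" where
  "face_cell p P c \<psi> = face_pt p P (rel_point c) \<psi>"

definition face_cone :: "('v::real_vector \<Rightarrow> 'w::real_vector) \<Rightarrow> 'v set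
    \<Rightarrow> 'w \<Rightarrow> ('v \<Rightarrow> real) set \<Rightarrow> 'v set" where
  "face_cone p P q \<sigma> = face_pt p P q (rel_point \<sigma>)"


section \<open>Strings and virtual cones\<close>

text \<open>The smallest cone containing \<open>\<psi>\<close> of the normal fan of the fibers over the relative interior
  of \<open>c\<close>.\<close>

definition fiber_cone :: "('v::real_vector \<Rightarrow> 'w::euclidean_space) \<Rightarrow> 'v set \<Rightarrow> 'v set
    \<Rightarrow> 'w set \<Rightarrow> ('v \<Rightarrow> real) \<Rightarrow> ('v \<Rightarrow> real) set" where
  "fiber_cone p V P c \<psi> = \<Inter> {C \<in> normal_fan (ker p V) (fiber p P (rel_point c)). \<psi> \<in> C}"

definition coherent_on_cells :: "('v::real_vector \<Rightarrow> 'w::euclidean_space) \<Rightarrow> 'v set \<Rightarrow> 'v set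
    \<Rightarrow> ('w set \<Rightarrow> ('v \<Rightarrow> real)) \<Rightarrow> bool" where
  "coherent_on_cells p V P \<Psi> \<longleftrightarrow>
     (\<forall>c\<in>cells p P. \<Psi> c \<in> ker_dual p V) \<and>
     (\<forall>c\<in>cells p P. \<forall>c'\<in>cells p P. c' \<subseteq> c \<longrightarrow>
        rel_interior (fiber_cone p V P c (\<Psi> c)) \<subseteq> rel_interior (fiber_cone p V P c' (\<Psi> c')))"

definition string_of :: "('v::real_vector \<Rightarrow> 'w::euclidean_space) \<Rightarrow> 'v set
    \<Rightarrow> ('w set \<Rightarrow> ('v \<Rightarrow> real)) \<Rightarrow> 'v set set" where
  "string_of p P \<Psi> = (\<lambda>c. face_cell p P c (\<Psi> c)) ` cells p P"

definition coherent_string :: "('v::real_vector \<Rightarrow> 'w::euclidean_space) \<Rightarrow> 'v set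
    \<Rightarrow> ('v \<Rightarrow> real) \<Rightarrow> 'v set set" where
  "coherent_string p P \<psi> = {face_cell p P c \<psi> |c. c \<in> cells p P}"

definition coherent_strings :: "('v::real_vector \<Rightarrow> 'w::euclidean_space) \<Rightarrow> 'v set \<Rightarrow> 'v set
    \<Rightarrow> 'v set set set" where
  "coherent_strings p V P = coherent_string p P ` ker_dual p V"

definition strings :: "('v::real_vector \<Rightarrow> 'w::euclidean_space) \<Rightarrow> 'v set \<Rightarrow> 'v set
    \<Rightarrow> 'v set set set" where
  "strings p V P = {string_of p P \<Psi> |\<Psi>. coherent_on_cells p V P \<Psi>}"

definition virtual_cone :: "('v::real_vector \<Rightarrow> 'w::euclidean_space) \<Rightarrow> 'v set \<Rightarrow> 'v set
    \<Rightarrow> ('w set \<Rightarrow> ('v \<Rightarrow> real)) \<Rightarrow> ('v \<Rightarrow> real) set set" where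
  "virtual_cone p V P s = (\<lambda>c. normal_cone V P (face_cell p P c (s c))) ` cells p P"

definition virtual_cones :: "('v::real_vector \<Rightarrow> 'w::euclidean_space) \<Rightarrow> 'v set \<Rightarrow> 'v set
    \<Rightarrow> ('v \<Rightarrow> real) set set set" where
  "virtual_cones p V P = {virtual_cone p V P s |s. coherent_on_cells p V P s}"

definition const_virtual_cone :: "('v::real_vector \<Rightarrow> 'w::euclidean_space) \<Rightarrow> 'v set \<Rightarrow> 'v set
    \<Rightarrow> ('v \<Rightarrow> real) set \<Rightarrow> ('v \<Rightarrow> real) set set" where
  "const_virtual_cone p V P \<sigma> = virtual_cone p V P (\<lambda>_. rel_point \<sigma>)"


section \<open>Costrings and virtual cells\<close>

text \<open>Polyhedral cones in the dual of \<open>S\<close>: finite intersections of closed half-spaces through the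
  origin, the functionals on the dual of \<open>S\<close> being the evaluations at points of \<open>S\<close>.\<close>

definition polyhedral_cone :: "'v::real_vector set \<Rightarrow> ('v \<Rightarrow> real) set \<Rightarrow> bool" where
  "polyhedral_cone S C \<longleftrightarrow> (\<exists>X. finite X \<and> X \<subseteq> S \<and> C = {f \<in> dual_space S. \<forall>x\<in>X. f x \<le> 0})"

text \<open>Complete fans in the dual of \<open>S\<close>; the cones may contain lines.\<close>

definition cone_subdivision :: "'v::real_vector set \<Rightarrow> ('v \<Rightarrow> real) set set \<Rightarrow> bool" where
  "cone_subdivision S D \<longleftrightarrow>
     finite D \<and>
     (\<forall>C\<in>D. polyhedral_cone S C) \<and>
     (\<forall>C\<in>D. faces C \<subseteq> D) \<and>
     (\<forall>C\<in>D. \<forall>C'\<in>D. (C \<inter> C') face_of C \<and> (C \<inter> C') face_of C') \<and>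
     \<Union>D = dual_space S"

definition coherent_costring :: "('v::real_vector \<Rightarrow> 'w::euclidean_space) \<Rightarrow> 'v set \<Rightarrow> 'v set
    \<Rightarrow> 'w set \<Rightarrow> ('v \<Rightarrow> real) set set" where
  "coherent_costring p V P c = {normal_cone V P (face_cell p P c \<psi>) |\<psi>. \<psi> \<in> ker_dual p V}"

definition coherent_costrings :: "('v::real_vector \<Rightarrow> 'w::euclidean_space) \<Rightarrow> 'v set \<Rightarrow> 'v set
    \<Rightarrow> ('v \<Rightarrow> real) set set set" where
  "coherent_costrings p V P = coherent_costring p V P ` cells p P"

definition costrings :: "('v::real_vector \<Rightarrow> 'w::real_vector) \<Rightarrow> 'v set \<Rightarrow> 'v set
    \<Rightarrow> ('v \<Rightarrow> real) set set set" where
  "costrings p V P = {C. C \<subseteq> normal_fan V P \<and>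
     cone_subdivision (ker p V) ((\<lambda>\<tau>. proj_dual p V ` \<tau>) ` C) \<and>
     inj_on (\<lambda>\<tau>. proj_dual p V ` \<tau>) C \<and>
     (\<forall>\<tau>\<in>C. \<forall>\<tau>'\<in>C. proj_dual p V ` \<tau> \<subseteq> proj_dual p V ` \<tau>' \<longleftrightarrow>
        \<tau> = (proj_dual p V -` (proj_dual p V ` \<tau>)) \<inter> \<tau>')}"

definition smallest_face :: "('v::real_vector \<Rightarrow> 'w::euclidean_space) \<Rightarrow> 'v set
    \<Rightarrow> 'w \<Rightarrow> ('v \<Rightarrow> real) set \<Rightarrow> 'v set" where
  "smallest_face p P q \<sigma> = \<Inter> {F \<in> coherent_string p P (rel_point \<sigma>). q \<in> p ` F}"

definition coherent_on_cones :: "('v::real_vector \<Rightarrow> 'w::euclidean_space) \<Rightarrow> 'v set \<Rightarrow> 'v set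
    \<Rightarrow> (('v \<Rightarrow> real) set \<Rightarrow> 'w) \<Rightarrow> bool" where
  "coherent_on_cones p V P b \<longleftrightarrow>
     (\<forall>\<sigma>\<in>cones p V P. b \<sigma> \<in> p ` P) \<and>
     (\<forall>\<sigma>\<in>cones p V P. \<forall>\<sigma>'\<in>cones p V P. \<sigma>' \<subseteq> \<sigma> \<longrightarrow>
        rel_interior (p ` smallest_face p P (b \<sigma>) \<sigma>)
          \<subseteq> rel_interior (p ` smallest_face p P (b \<sigma>') \<sigma>'))"

definition virtual_cell :: "('v::real_vector \<Rightarrow> 'w::euclidean_space) \<Rightarrow> 'v set \<Rightarrow> 'v set
    \<Rightarrow> (('v \<Rightarrow> real) set \<Rightarrow> 'w) \<Rightarrow> 'v set set" where
  "virtual_cell p V P b = (\<lambda>\<sigma>. face_cone p P (b \<sigma>) \<sigma>) ` cones p V P"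

definition virtual_cells :: "('v::real_vector \<Rightarrow> 'w::euclidean_space) \<Rightarrow> 'v set \<Rightarrow> 'v set
    \<Rightarrow> 'v set set set" where
  "virtual_cells p V P = {virtual_cell p V P b |b. coherent_on_cones p V P b}"

definition const_virtual_cell :: "('v::real_vector \<Rightarrow> 'w::euclidean_space) \<Rightarrow> 'v set \<Rightarrow> 'v set
    \<Rightarrow> 'w set \<Rightarrow> 'v set set" where
  "const_virtual_cell p V P c = virtual_cell p V P (\<lambda>_. rel_point c)"


section \<open>Orders and anti-isomorphisms\<close>

text \<open>The order on strings and costrings, coherent or not.\<close>

definition union_le :: "'a set set \<Rightarrow> 'a set set \<Rightarrow> bool" where
  "union_le A B \<longleftrightarrow> \<Union>A \<subseteq> \<Union>B"

text \<open>
  Virtual cones and virtual cells are families indexed by the cells and by the cones. They are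
  ordered by inclusion of corresponding members. Inclusion of the unions of the members, without
  regard to the indices, is weaker (see the two lemmas below) and is not antisymmetric. For the unit
  square and the projection \<open>(x,y) \<mapsto> x + 2y\<close>, the virtual cells of the constant maps at \<open>1\<close> and \<open>2\<close>,
  which represent the incomparable cells \<open>{1}\<close> and \<open>{2}\<close>, both contain the square itself, so their
  unions are equal. For the triangle with vertices \<open>(0,0)\<close>, \<open>(2,0)\<close>, \<open>(1,-1)\<close> and the projection to
  \<open>x\<close>, the virtual cones of the constant maps at the functionals \<open>0\<close> and \<open>y\<close> are different, but each
  has as its union that of the normal cones of \<open>(0,0)\<close> and \<open>(2,0)\<close>.
\<close>

definition virtual_cone_le :: "('v::real_vector \<Rightarrow> 'w::euclidean_space) \<Rightarrow> 'v set \<Rightarrow> 'v set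
    \<Rightarrow> ('v \<Rightarrow> real) set set \<Rightarrow> ('v \<Rightarrow> real) set set \<Rightarrow> bool" where
  "virtual_cone_le p V P C C' \<longleftrightarrow>
     (\<exists>s s'. coherent_on_cells p V P s \<and> coherent_on_cells p V P s' \<and>
        C = virtual_cone p V P s \<and> C' = virtual_cone p V P s' \<and>
        (\<forall>c\<in>cells p P. normal_cone V P (face_cell p P c (s c))
                        \<subseteq> normal_cone V P (face_cell p P c (s' c))))"

definition virtual_cell_le :: "('v::real_vector \<Rightarrow> 'w::euclidean_space) \<Rightarrow> 'v set \<Rightarrow> 'v set
    \<Rightarrow> 'v set set \<Rightarrow> 'v set set \<Rightarrow> bool" where
  "virtual_cell_le p V P B B' \<longleftrightarrow>
     (\<exists>b b'. coherent_on_cones p V P b \<and> coherent_on_cones p V P b' \<and>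
        B = virtual_cell p V P b \<and> B' = virtual_cell p V P b' \<and>
        (\<forall>\<sigma>\<in>cones p V P. face_cone p P (b \<sigma>) \<sigma> \<subseteq> face_cone p P (b' \<sigma>) \<sigma>))"

lemma virtual_cone_le_imp_union_le: "virtual_cone_le p V P C C' \<Longrightarrow> union_le C C'"
  unfolding virtual_cone_le_def union_le_def virtual_cone_def by blast

lemma virtual_cell_le_imp_union_le: "virtual_cell_le p V P B B' \<Longrightarrow> union_le B B'"
  unfolding virtual_cell_le_def union_le_def virtual_cell_def by blast

definition poset_on :: "'a set \<Rightarrow> ('a \<Rightarrow> 'a \<Rightarrow> bool) \<Rightarrow> bool" where
  "poset_on A le \<longleftrightarrow> reflp_on A le \<and> transp_on A le \<and> antisymp_on A le"

definition anti_isomorphism ::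
  "'a set \<Rightarrow> ('a \<Rightarrow> 'a \<Rightarrow> bool) \<Rightarrow> 'b set \<Rightarrow> ('b \<Rightarrow> 'b \<Rightarrow> bool) \<Rightarrow> ('a \<Rightarrow> 'b) \<Rightarrow> bool" where
  "anti_isomorphism A leA B leB f \<longleftrightarrow>
     poset_on A leA \<and> poset_on B leB \<and> bij_betw f A B \<and>
     (\<forall>x\<in>A. \<forall>y\<in>A. leA x y \<longleftrightarrow> leB (f y) (f x))"

definition to_virtual_cone :: "'v::real_vector set \<Rightarrow> 'v set \<Rightarrow> 'v set set \<Rightarrow> ('v \<Rightarrow> real) set set" where
  "to_virtual_cone V P \<F> = {normal_cone V P F |F. F \<in> \<F>}"

definition to_virtual_cell :: "'v::real_vector set \<Rightarrow> 'v set \<Rightarrow> ('v \<Rightarrow> real) set set \<Rightarrow> 'v set set" where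
  "to_virtual_cell V P C = {F \<in> faces P. normal_cone V P F \<in> C}"

end

theory Submission
  imports Defs
begin

text \<open>
  Everything rests on one incidence relation: \<open>I x \<phi>\<close> says that the functional \<open>\<phi>\<close> is maximal on \<open>P\<close>
  at \<open>x\<close>. Call \<open>(x, \<phi>)\<close> strict if \<open>x\<close> lies in the relative interior of the face cut out by \<open>\<phi>\<close>.
  Strict complementarity of linear programming says that every \<open>(q, \<psi>)\<close> with \<open>q \<in> p ` P\<close> and \<open>\<psi>\<close> a
  functional on the kernel is \<open>(p x, \<phi> restricted to the kernel)\<close> for a strict pair \<open>(x, \<phi>)\<close>
  (\<open>strict_complementarity\<close>), and two strict pairs over the same \<open>(q, \<psi>)\<close> belong to the same face, namely
  \<open>F\<^bsub>q,\<psi>\<^esub>\<close> (\<open>strict_unique\<close>). So for every face \<open>F\<close> the set of \<open>(q, \<psi>)\<close> with \<open>F\<^bsub>q,\<psi>\<^esub> = F\<close> is the product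
  of the relative interiors of \<open>p ` F\<close> and of the restricted normal cone of \<open>F\<close>, and these products
  partition \<open>p ` P\<close> times the dual of the kernel. Two points have the same cell if they lie in the same
  sets of the first kind, two functionals have the same cone if they lie in the same sets of the second
  kind.

  This picture does not change when points and functionals are exchanged. Faces become normal cones,
  cells become cones, strings become costrings, and virtual cones become virtual cells. The theory is
  therefore developed for an abstract self-dual pairing and then applied in both directions.

  The core is \<open>coherent_choice_fill\<close>. Coherence compares the faces chosen at a point and at the points
  of its cell. A connectedness argument along segments extends this to all points of the projection of
  the chosen face: the face chosen at such a point is the one that the old choice would give there.
  Two consequences carry the theorem. First, the part of the union of a coherent family that lies over
  \<open>q\<close> is the corresponding part of the single face chosen at \<open>q\<close>, so inclusion of unions is inclusion
  of corresponding members (\<open>coherent_union_le_iff\<close>). Since passing to normal cones is injective on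
  faces and reverses inclusion, this gives the anti-isomorphisms. Second, the coherent families are
  exactly the collections whose projections subdivide the base without repetition and tightly
  (\<open>tight_subdivision_iff\<close>); in the dual direction this identifies the costrings with the virtual cells.

  Constant choices are coherent. They give the coherent strings and costrings, and on them the order
  is that of the cones and of the cells (\<open>below_iff_faces_subset\<close>).
\<close>


section \<open>Convex sets and their intrinsic cores\<close>

text \<open>The algebraic description of the relative interior of a finite-dimensional convex set. It makes
  sense in any vector space, so that points and functionals can be treated alike.\<close>

definition intrinsic_core :: "'a::real_vector set \<Rightarrow> 'a set" where
  "intrinsic_core C = {x \<in> C. \<forall>y\<in>C. \<exists>e>0. x + e *\<^sub>R (x - y) \<in> C}"

lemma intrinsic_core_subset: "intrinsic_core C \<subseteq> C"
  by (auto simp: intrinsic_core_def)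

text \<open>A core point of \<open>C\<close> lies strictly inside a segment of \<open>C\<close> with a prescribed end \<open>y\<close>.\<close>

lemma intrinsic_core_between:
  assumes "x \<in> intrinsic_core C" "y \<in> C"
  obtains z t where "z \<in> C" "0 < t" "t < 1" "x = (1 - t) *\<^sub>R y + t *\<^sub>R z"
proof -
  obtain e where e: "e > 0" "x + e *\<^sub>R (x - y) \<in> C"
    using assms by (auto simp: intrinsic_core_def)
  define t where "t = 1 / (1 + e)"
  have t: "0 < t" "t < 1" "t * (1 + e) = 1"
    using e by (auto simp: t_def)
  have "(1 - t) *\<^sub>R y + t *\<^sub>R (x + e *\<^sub>R (x - y)) = (t * (1 + e)) *\<^sub>R x + (1 - t * (1 + e)) *\<^sub>R y"
    by (simp add: algebra_simps)
  then have "x = (1 - t) *\<^sub>R y + t *\<^sub>R (x + e *\<^sub>R (x - y))"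
    using t by simp
  then show ?thesis using that e t by blast
qed

lemma face_of_absorbs:
  assumes G: "G face_of C" and T: "T \<subseteq> C" and q: "q \<in> G" "q \<in> intrinsic_core T"
  shows "T \<subseteq> G"
proof
  fix y assume y: "y \<in> T"
  obtain z t where z: "z \<in> T" "0 < t" "t < 1" "q = (1 - t) *\<^sub>R y + t *\<^sub>R z"
    using intrinsic_core_between[OF q(2) y] .
  show "y \<in> G"
  proof (cases "y = z")
    case True
    then have "q = y" using z by (simp add: algebra_simps)
    then show ?thesis using q by simp
  next
    case False
    then have "q \<in> open_segment y z" using z by (auto simp: in_segment)
    then show ?thesis using face_ofD[OF G] y z T q by blast
  qed
qed


section \<open>Complementary pairs\<close>

text \<open>In applications \<open>I x \<phi>\<close> says that the functional \<open>\<phi>\<close> is maximal on the polytope at \<open>x\<close>. Then the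
  sets \<open>{x. I x \<phi>}\<close> are the nonempty faces, the sets \<open>{\<phi>. I x \<phi>}\<close> are the normal cones, and the pair is
  strict if \<open>x\<close> lies in the relative interior of the face of \<open>\<phi>\<close>: this is strict complementarity in
  the sense of linear programming. The condition is symmetric in \<open>x\<close> and \<open>\<phi>\<close>.\<close>

definition strict_pair :: "('a \<Rightarrow> 'b \<Rightarrow> bool) \<Rightarrow> 'a \<Rightarrow> 'b \<Rightarrow> bool" where
  "strict_pair I x \<phi> \<longleftrightarrow> I x \<phi> \<and> (\<forall>x' \<phi>'. I x \<phi>' \<longrightarrow> I x' \<phi> \<longrightarrow> I x' \<phi>')"

definition shadow :: "('a \<Rightarrow> 'b \<Rightarrow> bool) \<Rightarrow> ('a \<Rightarrow> 'c) \<Rightarrow> 'c set" where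
  "shadow I p = p ` {x. \<exists>\<phi>. I x \<phi>}"

text \<open>The order of the cells of two points, expressed without cells.\<close>

definition cell_le :: "('a \<Rightarrow> 'b \<Rightarrow> bool) \<Rightarrow> ('a \<Rightarrow> 'c) \<Rightarrow> 'c \<Rightarrow> 'c \<Rightarrow> bool" where
  "cell_le I p q' q \<longleftrightarrow> (\<forall>\<phi>. q \<in> p ` {x. I x \<phi>} \<longrightarrow> q' \<in> p ` {x. I x \<phi>})"

text \<open>The face \<open>F\<^bsub>q,\<psi>\<^esub>\<close>. All strict pairs over \<open>(q, \<psi>)\<close> have the same face, and for a polytope it is the
  smallest face containing the part of the fiber over \<open>q\<close> where \<open>\<psi>\<close> is maximal.\<close>

definition face_over ::
  "('a \<Rightarrow> 'b \<Rightarrow> bool) \<Rightarrow> ('a \<Rightarrow> 'c) \<Rightarrow> ('b \<Rightarrow> 'd) \<Rightarrow> 'c \<Rightarrow> 'd \<Rightarrow> 'a set" where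
  "face_over I p r q \<psi> = {z. \<exists>x \<phi>. strict_pair I x \<phi> \<and> p x = q \<and> r \<phi> = \<psi> \<and> I z \<phi>}"

text \<open>In terms of the faces \<open>F\<^bsub>q,\<psi>\<^esub>\<close>, local coherence of a choice of functionals says that on a smaller
  cell the choice made on the larger cell would give the same face.\<close>

definition coherent_choice ::
  "('a \<Rightarrow> 'b \<Rightarrow> bool) \<Rightarrow> ('a \<Rightarrow> 'c) \<Rightarrow> ('b \<Rightarrow> 'd) \<Rightarrow> ('c \<Rightarrow> 'd) \<Rightarrow> bool" where
  "coherent_choice I p r s \<longleftrightarrow>
     (\<forall>q\<in>shadow I p. s q \<in> shadow (\<lambda>\<phi> x. I x \<phi>) r) \<and>
     (\<forall>q\<in>shadow I p. \<forall>q'\<in>shadow I p. cell_le I p q' q \<longrightarrow>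
        face_over I p r q' (s q') = face_over I p r q' (s q))"

definition family_of ::
  "('a \<Rightarrow> 'b \<Rightarrow> bool) \<Rightarrow> ('a \<Rightarrow> 'c) \<Rightarrow> ('b \<Rightarrow> 'd) \<Rightarrow> ('c \<Rightarrow> 'd) \<Rightarrow> 'a set set" where
  "family_of I p r s = (\<lambda>q. face_over I p r q (s q)) ` shadow I p"

text \<open>The conditions defining locally coherent costrings, in a form that applies to faces as well.\<close>

definition tight_subdivision ::
  "('a \<Rightarrow> 'b \<Rightarrow> bool) \<Rightarrow> ('a \<Rightarrow> 'c::real_vector) \<Rightarrow> 'a set set \<Rightarrow> bool" where
  "tight_subdivision I p \<F> \<longleftrightarrow>
     (\<forall>F\<in>\<F>. \<exists>x \<phi>. I x \<phi> \<and> F = {z. I z \<phi>}) \<and>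
     (\<forall>F\<in>\<F>. faces (p ` F) \<subseteq> (`) p ` \<F>) \<and>
     (\<forall>F\<in>\<F>. \<forall>G\<in>\<F>. (p ` F \<inter> p ` G) face_of p ` F) \<and>
     (\<Union>F\<in>\<F>. p ` F) = shadow I p \<and>
     inj_on ((`) p) \<F> \<and>
     (\<forall>F\<in>\<F>. \<forall>G\<in>\<F>. p ` F \<subseteq> p ` G \<longleftrightarrow> F = (p -` (p ` F)) \<inter> G)"

text \<open>The hypotheses on one of the two sides of an incidence relation. Assumption \<open>extremal\<close> says that
  the sets \<open>{x. I x \<phi>'} \<inter> {x. I x \<phi>}\<close> are faces of \<open>{x. I x \<phi>}\<close>.\<close>

locale pairing_side =
  fixes I :: "'a::real_vector \<Rightarrow> 'b \<Rightarrow> bool" and p :: "'a \<Rightarrow> 'c::real_vector"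
  assumes lin: "linear p"
    and segment: "\<lbrakk>I x \<phi>; I y \<phi>; 0 \<le> t; t \<le> 1\<rbrakk> \<Longrightarrow> I ((1 - t) *\<^sub>R x + t *\<^sub>R y) \<phi>"
    and extremal: "\<lbrakk>I x \<phi>; I y \<phi>; 0 \<le> t; t < 1; I ((1 - t) *\<^sub>R x + t *\<^sub>R y) \<phi>'\<rbrakk> \<Longrightarrow> I x \<phi>'"
    and partner: "I x \<phi> \<Longrightarrow> \<exists>\<phi>'. strict_pair I x \<phi>'"
    and stretch: "\<lbrakk>strict_pair I x \<phi>; I y \<phi>\<rbrakk> \<Longrightarrow> \<exists>e>0. I (x + e *\<^sub>R (x - y)) \<phi>"
    and finite_faces: "finite (range (\<lambda>\<phi>. {x. I x \<phi>}))"
    and closed_trace: "\<lbrakk>I x \<phi>; q \<in> shadow I p; q' \<in> shadow I p\<rbrakk> \<Longrightarrow>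
           closed {t \<in> {0..1}. (1 - t) *\<^sub>R q + t *\<^sub>R q' \<in> p ` {x. I x \<phi>}}"
    and core_nonempty: "\<lbrakk>T \<subseteq> shadow I p; convex T; T \<noteq> {}\<rbrakk> \<Longrightarrow> intrinsic_core T \<noteq> {}"

lemma (in pairing_side) convex_projection: "convex (p ` {z. I z \<phi>})"
  by (intro convex_linear_image[OF lin]) (simp add: convex_alt segment)

text \<open>Assumption \<open>exchange\<close> holds in applications because two functionals with the same restriction to
  the kernel differ by a constant on a fiber; assumption \<open>strict_exists\<close> is strict complementarity for
  the linear program of maximising \<open>\<psi>\<close> on the fiber over \<open>q\<close>.\<close>

locale pairing = pairing_side I p + dual: pairing_side "\<lambda>\<phi> x. I x \<phi>" r
  for I :: "'a::real_vector \<Rightarrow> 'b::real_vector \<Rightarrow> bool"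
    and p :: "'a \<Rightarrow> 'c::real_vector" and r :: "'b \<Rightarrow> 'd::real_vector" +
  assumes exchange: "\<lbrakk>I x \<phi>; I x' \<phi>'; p x = p x'; r \<phi> = r \<phi>'\<rbrakk> \<Longrightarrow> I x \<phi>'"
    and strict_exists: "\<lbrakk>q \<in> shadow I p; \<psi> \<in> shadow (\<lambda>\<phi> x. I x \<phi>) r\<rbrakk> \<Longrightarrow>
           \<exists>x \<phi>. strict_pair I x \<phi> \<and> p x = q \<and> r \<phi> = \<psi>"

lemma strict_pair_dual: "strict_pair (\<lambda>\<phi> x. I x \<phi>) \<phi> x \<longleftrightarrow> strict_pair I x \<phi>"
  by (auto simp: strict_pair_def)

text \<open>The hypotheses are self-dual: exchanging the two sides turns faces into normal cones, cells into
  cones and strings into costrings. Everything below is therefore proved once and used twice.\<close>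

lemma pairing_dual:
  assumes "pairing I p r"
  shows "pairing (\<lambda>\<phi> x. I x \<phi>) r p"
proof -
  interpret pairing I p r by fact
  show ?thesis
  proof (intro pairing.intro pairing_axioms.intro)
    show "pairing_side (\<lambda>\<phi> x. I x \<phi>) r" "pairing_side I p" by unfold_locales
    show "I x \<phi>'" if "I x' \<phi>'" "I x \<phi>" "r \<phi>' = r \<phi>" "p x' = p x" for x \<phi> x' \<phi>'
      using exchange[of x \<phi> x' \<phi>'] that by simp
    show "\<exists>\<phi> x. strict_pair (\<lambda>\<phi> x. I x \<phi>) \<phi> x \<and> r \<phi> = \<psi> \<and> p x = q"
      if "\<psi> \<in> shadow (\<lambda>\<phi> x. I x \<phi>) r" "q \<in> shadow I p" for q \<psi>
      using strict_exists[OF that(2,1)] strict_pair_dual[of I] by metis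
  qed
qed


subsection \<open>The faces over pairs of base points\<close>

lemma strict_pair_incident: "strict_pair I x \<phi> \<Longrightarrow> I x \<phi>"
  by (simp add: strict_pair_def)

lemma strict_pairD: "\<lbrakk>strict_pair I x \<phi>; I x \<phi>'; I x' \<phi>\<rbrakk> \<Longrightarrow> I x' \<phi>'"
  by (auto simp: strict_pair_def)

lemma strict_pair_subset: "\<lbrakk>strict_pair I x \<phi>; I x \<phi>'\<rbrakk> \<Longrightarrow> {z. I z \<phi>} \<subseteq> {z. I z \<phi>'}"
  by (auto simp: strict_pair_def)

lemma strict_pair_cong: "\<lbrakk>strict_pair I x \<phi>; {z. I z \<phi>} = {z. I z \<phi>'}\<rbrakk> \<Longrightarrow> strict_pair I x \<phi>'"
  unfolding strict_pair_def by blast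

context pairing
begin

abbreviation (input) X where "X \<equiv> shadow I p"
abbreviation (input) Y where "Y \<equiv> shadow (\<lambda>\<phi> x. I x \<phi>) r"
abbreviation "fc \<equiv> face_over I p r"
abbreviation "below \<equiv> cell_le I p"

lemma p_segment: "p ((1 - t) *\<^sub>R x + t *\<^sub>R y) = (1 - t) *\<^sub>R p x + t *\<^sub>R p y"
  using lin by (simp add: linear_add linear_scale)

lemma shadowI: "I x \<phi> \<Longrightarrow> p x \<in> X" "I x \<phi> \<Longrightarrow> r \<phi> \<in> Y"
  by (auto simp: shadow_def)

lemma strict_unique:
  assumes "strict_pair I x \<phi>" "strict_pair I x' \<phi>'" "p x = p x'" "r \<phi> = r \<phi>'"
  shows "{z. I z \<phi>} = {z. I z \<phi>'}"
proof -
  have "I x \<phi>'" "I x' \<phi>"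
    using assms exchange[of x \<phi> x' \<phi>'] exchange[of x' \<phi>' x \<phi>] by (auto dest: strict_pair_incident)
  then show ?thesis using assms strict_pairD by fast
qed

lemma face_over_strict: "strict_pair I x \<phi> \<Longrightarrow> fc (p x) (r \<phi>) = {z. I z \<phi>}"
  using strict_unique unfolding face_over_def by blast

lemma face_over_dual:
  assumes "q \<in> X" "\<psi> \<in> Y"
  shows "face_over (\<lambda>\<phi> x. I x \<phi>) r p \<psi> q = {\<phi>. \<forall>x\<in>fc q \<psi>. I x \<phi>}"
proof -
  obtain x \<phi> where s: "strict_pair I x \<phi>" "p x = q" "r \<phi> = \<psi>"
    using strict_exists[OF assms] by blast
  have "strict_pair (\<lambda>\<phi> x. I x \<phi>) \<phi> x" using s by (simp add: strict_pair_dual[of I])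
  then have "face_over (\<lambda>\<phi> x. I x \<phi>) r p \<psi> q = {\<phi>'. I x \<phi>'}"
    using pairing.face_over_strict[OF pairing_dual[OF pairing_axioms], of \<phi> x] s by simp
  moreover have "fc q \<psi> = {z. I z \<phi>}"
    using face_over_strict s by blast
  moreover have "I x \<phi>' \<longleftrightarrow> (\<forall>z. I z \<phi> \<longrightarrow> I z \<phi>')" for \<phi>'
    using s(1) unfolding strict_pair_def by metis
  ultimately show ?thesis by simp
qed

lemma face_over_dual_subset_iff:
  assumes "q \<in> X" "\<psi> \<in> Y" "q' \<in> X" "\<psi>' \<in> Y"
  shows "face_over (\<lambda>\<phi> x. I x \<phi>) r p \<psi> q \<subseteq> face_over (\<lambda>\<phi> x. I x \<phi>) r p \<psi>' q' \<longleftrightarrow>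
         fc q' \<psi>' \<subseteq> fc q \<psi>"
proof -
  obtain x \<phi> where s: "strict_pair I x \<phi>" "p x = q" "r \<phi> = \<psi>"
    using strict_exists assms by blast
  have *: "fc q \<psi> = {z. I z \<phi>}"
    using face_over_strict s by blast
  show ?thesis
    unfolding face_over_dual[OF assms(1,2)] face_over_dual[OF assms(3,4)] * by auto
qed

lemma face_over_dual_eq_iff:
  assumes "q \<in> X" "\<psi> \<in> Y" "q' \<in> X" "\<psi>' \<in> Y"
  shows "face_over (\<lambda>\<phi> x. I x \<phi>) r p \<psi> q = face_over (\<lambda>\<phi> x. I x \<phi>) r p \<psi>' q' \<longleftrightarrow>
         fc q' \<psi>' = fc q \<psi>"
  using face_over_dual_subset_iff assms by (metis subset_antisym order_refl)

text \<open>The set of \<open>(q, \<psi>)\<close> with a given face is a product.\<close>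

lemma face_over_product:
  assumes "q \<in> X" "q' \<in> X" "\<psi> \<in> Y" "\<psi>' \<in> Y" and eq: "fc q \<psi> = fc q' \<psi>'"
  shows "fc q \<psi>' = fc q' \<psi>'"
proof -
  obtain x \<phi> where s: "strict_pair I x \<phi>" "p x = q" "r \<phi> = \<psi>"
    using strict_exists assms by blast
  obtain x' \<phi>' where s': "strict_pair I x' \<phi>'" "p x' = q'" "r \<phi>' = \<psi>'"
    using strict_exists assms by blast
  have e: "{z. I z \<phi>} = {z. I z \<phi>'}"
    using eq face_over_strict s s' by metis
  have "strict_pair I x \<phi>'"
    using s(1) e unfolding strict_pair_def by blast
  then show ?thesis
    using face_over_strict s s' by metis
qed

lemma incident_fiber:
  assumes "z \<in> fc q \<psi>" "\<psi> \<in> Y"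
  shows "z \<in> fc (p z) \<psi>"
proof -
  obtain x \<phi> where s: "strict_pair I x \<phi>" "p x = q" "r \<phi> = \<psi>" "I z \<phi>"
    using assms(1) by (auto simp: face_over_def)
  obtain y \<eta> where y: "strict_pair I y \<eta>" "p y = p z" "r \<eta> = \<psi>"
    using strict_exists[of "p z" \<psi>] shadowI s assms by blast
  have "I z \<eta>" using exchange[of z \<phi> y \<eta>] s y strict_pair_incident by metis
  then show ?thesis using y(2,3) face_over_strict[OF y(1)] by simp
qed

lemma face_over_ex:
  assumes "q \<in> X" "\<psi> \<in> Y"
  obtains x \<phi> where "strict_pair I x \<phi>" "p x = q" "r \<phi> = \<psi>" "fc q \<psi> = {z. I z \<phi>}"
  using strict_exists[OF assms] face_over_strict by metis

lemma in_face_projection: "\<lbrakk>q \<in> X; \<psi> \<in> Y\<rbrakk> \<Longrightarrow> q \<in> p ` fc q \<psi>"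
  by (metis face_over_ex image_eqI mem_Collect_eq strict_pair_incident)


subsection \<open>Comparing cells\<close>

text \<open>If \<open>q'\<close> lies in the projection of \<open>F\<^bsub>q,\<psi>\<^esub>\<close>, then the face over \<open>(q', \<psi>)\<close> is the smallest face of
  \<open>F\<^bsub>q,\<psi>\<^esub>\<close> containing its fiber over \<open>q'\<close>; so it depends on \<open>\<psi>\<close> only through \<open>F\<^bsub>q,\<psi>\<^esub>\<close>.\<close>

lemma face_over_restrict:
  assumes q: "q \<in> X" "q' \<in> X" and Y: "\<psi> \<in> Y" "\<psi>' \<in> Y"
    and mem: "q' \<in> p ` fc q \<psi>" and eq: "fc q \<psi> = fc q \<psi>'"
  shows "fc q' \<psi> = fc q' \<psi>'"
proof -
  have *: "fc q' \<psi> \<subseteq> fc q' \<psi>'" if Y: "\<psi> \<in> Y" "\<psi>' \<in> Y" "q' \<in> p ` fc q \<psi>" "fc q \<psi> = fc q \<psi>'"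
    for \<psi> \<psi>'
  proof -
    obtain x \<phi> where s: "strict_pair I x \<phi>" "p x = q" "r \<phi> = \<psi>" "fc q \<psi> = {z. I z \<phi>}"
      using face_over_ex[OF q(1) Y(1)] .
    obtain x1 \<phi>1 where s1: "strict_pair I x1 \<phi>1" "p x1 = q" "r \<phi>1 = \<psi>'" "fc q \<psi>' = {z. I z \<phi>1}"
      using face_over_ex[OF q(1) Y(2)] .
    obtain y \<eta> where y: "strict_pair I y \<eta>" "p y = q'" "r \<eta> = \<psi>" "fc q' \<psi> = {z. I z \<eta>}"
      using face_over_ex[OF q(2) Y(1)] .
    obtain y1 \<eta>1 where y1: "strict_pair I y1 \<eta>1" "p y1 = q'" "r \<eta>1 = \<psi>'" "fc q' \<psi>' = {z. I z \<eta>1}"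
      using face_over_ex[OF q(2) Y(2)] .
    obtain x' where x': "I x' \<phi>" "p x' = q'" using Y(3) s(4) by auto
    have "I y \<phi>" using exchange[of y \<eta> x' \<phi>] x' y s strict_pair_incident by metis
    then have "I y \<phi>1" using Y(4) s s1 by auto
    then have "I y \<eta>1" using exchange[of y \<phi>1 y1 \<eta>1] y y1 s1 strict_pair_incident by metis
    then show ?thesis unfolding y(4) y1(4) using strict_pair_subset[OF y(1)] by simp
  qed
  show ?thesis
    using *[OF Y mem eq] *[OF Y(2,1) mem[unfolded eq] eq[symmetric]] by (rule subset_antisym)
qed

lemma below_projection:
  assumes "q \<in> X" "\<psi> \<in> Y" "below q' q"
  shows "q' \<in> p ` fc q \<psi>"
proof -
  obtain x \<phi> where s: "strict_pair I x \<phi>" "p x = q" "fc q \<psi> = {z. I z \<phi>}"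
    using face_over_ex[OF assms(1,2)] by metis
  then have "q \<in> p ` {z. I z \<phi>}"
    using strict_pair_incident by (metis image_eqI mem_Collect_eq)
  then show ?thesis using assms(3) s unfolding cell_le_def by auto
qed

lemma below_face_cong:
  "\<lbrakk>q \<in> X; q' \<in> X; \<psi> \<in> Y; \<psi>' \<in> Y; below q' q; fc q \<psi> = fc q \<psi>'\<rbrakk> \<Longrightarrow> fc q' \<psi> = fc q' \<psi>'"
  by (rule face_over_restrict[of q]) (simp_all add: below_projection)

lemma below_face_subset:
  assumes "q \<in> X" "q' \<in> X" "\<psi> \<in> Y" "q' \<in> p ` fc q \<psi>"
  shows "fc q' \<psi> \<subseteq> fc q \<psi>"
proof -
  obtain x \<phi> where s: "strict_pair I x \<phi>" "p x = q" "r \<phi> = \<psi>" "fc q \<psi> = {z. I z \<phi>}"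
    using face_over_ex assms by metis
  obtain y \<eta> where y: "strict_pair I y \<eta>" "p y = q'" "r \<eta> = \<psi>" "fc q' \<psi> = {z. I z \<eta>}"
    using face_over_ex assms by metis
  obtain x' where x': "I x' \<phi>" "p x' = q'" using assms(4) s(4) by auto
  have "I y \<phi>" using exchange[of y \<eta> x' \<phi>] x' y s strict_pair_incident by metis
  then show ?thesis unfolding y(4) s(4) using strict_pair_subset[OF y(1)] by simp
qed

lemma same_cell_face:
  assumes "q \<in> X" "q' \<in> X" "\<psi> \<in> Y" "below q' q" "below q q'"
  shows "fc q' \<psi> = fc q \<psi>"
  using below_face_subset below_projection assms by (meson subset_antisym)

text \<open>Strictness passes from one end of a segment to its inner points, as membership in a relative
  interior does. Hence the strict points of a face project onto the core of its projection.\<close>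

lemma strict_segment:
  assumes "strict_pair I x \<phi>" "I y \<phi>" "0 \<le> t" "t < 1"
  shows "strict_pair I ((1 - t) *\<^sub>R x + t *\<^sub>R y) \<phi>"
  unfolding strict_pair_def
proof (intro conjI allI impI)
  have x: "I x \<phi>" using assms strict_pair_incident by metis
  then show "I ((1 - t) *\<^sub>R x + t *\<^sub>R y) \<phi>" using segment assms by simp
  fix x' \<phi>' assume "I ((1 - t) *\<^sub>R x + t *\<^sub>R y) \<phi>'" "I x' \<phi>"
  then show "I x' \<phi>'" using extremal[OF x assms(2-4)] strict_pairD[OF assms(1)] by blast
qed

lemma core_projection:
  assumes "I x \<phi>"
  shows "intrinsic_core (p ` {z. I z \<phi>}) = p ` {z. strict_pair I z \<phi>}"
proof (intro equalityI subsetI)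
  fix q assume q: "q \<in> intrinsic_core (p ` {z. I z \<phi>})"
  obtain x where x: "strict_pair I x \<phi>"
    using dual.partner[of x \<phi>] assms by (auto simp: strict_pair_dual[of I])
  then have "p x \<in> p ` {z. I z \<phi>}" using strict_pair_incident by fastforce
  then obtain z t where z: "z \<in> p ` {z. I z \<phi>}" "0 < t" "t < 1" "q = (1 - t) *\<^sub>R p x + t *\<^sub>R z"
    using intrinsic_core_between[OF q] by metis
  then obtain y where y: "I y \<phi>" "z = p y" by auto
  have "strict_pair I ((1 - t) *\<^sub>R x + t *\<^sub>R y) \<phi>"
    using strict_segment x y z by auto
  then show "q \<in> p ` {z. strict_pair I z \<phi>}"
    using z y by (metis p_segment image_eqI mem_Collect_eq)
next
  fix q assume "q \<in> p ` {z. strict_pair I z \<phi>}"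
  then obtain x where x: "strict_pair I x \<phi>" "q = p x" by auto
  have "\<exists>e>0. q + e *\<^sub>R (q - p y) \<in> p ` {z. I z \<phi>}" if y: "I y \<phi>" for y
  proof -
    obtain e where e: "e > 0" "I (x + e *\<^sub>R (x - y)) \<phi>"
      using stretch[OF x(1) y] by auto
    then show ?thesis
      using x lin by (intro exI[of _ e]) (auto simp: linear_add linear_diff linear_scale
          intro!: image_eqI[of _ _ "x + e *\<^sub>R (x - y)"])
  qed
  then show "q \<in> intrinsic_core (p ` {z. I z \<phi>})"
    using x strict_pair_incident by (fastforce simp: intrinsic_core_def)
qed

lemma core_face_over:
  assumes "q \<in> X" "\<psi> \<in> Y"
  shows "intrinsic_core (p ` fc q \<psi>) = {q' \<in> X. fc q' \<psi> = fc q \<psi>}"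
proof -
  obtain x \<phi> where s: "strict_pair I x \<phi>" "p x = q" "r \<phi> = \<psi>" "fc q \<psi> = {z. I z \<phi>}"
    using face_over_ex[OF assms] .
  have "p ` {z. strict_pair I z \<phi>} = {q' \<in> X. fc q' \<psi> = fc q \<psi>}"
  proof (intro equalityI subsetI)
    fix q' assume "q' \<in> p ` {z. strict_pair I z \<phi>}"
    then obtain z where z: "strict_pair I z \<phi>" "q' = p z" by auto
    then show "q' \<in> {q' \<in> X. fc q' \<psi> = fc q \<psi>}"
      using face_over_strict[OF z(1)] shadowI(1)[OF strict_pair_incident[OF z(1)]] s(3,4) by simp
  next
    fix q' assume "q' \<in> {q' \<in> X. fc q' \<psi> = fc q \<psi>}"
    then have q': "q' \<in> X" "fc q' \<psi> = fc q \<psi>" by auto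
    obtain y \<eta> where y: "strict_pair I y \<eta>" "p y = q'" "r \<eta> = \<psi>" "fc q' \<psi> = {z. I z \<eta>}"
      using face_over_ex[OF q'(1) assms(2)] .
    have "strict_pair I y \<phi>" using strict_pair_cong[OF y(1)] y(4) q'(2) s(4) by simp
    then show "q' \<in> p ` {z. strict_pair I z \<phi>}" using y by auto
  qed
  then show ?thesis using core_projection[of x \<phi>] s strict_pair_incident by metis
qed

text \<open>A point \<open>q0\<close> of the relative interior of the cell of \<open>q\<close> lies strictly between \<open>q\<close> and another point
  \<open>q1\<close> of that cell. For every \<open>\<psi>\<close>, the face over \<open>(q, \<psi>)\<close> projects onto a set containing \<open>q1\<close>, so \<open>q0\<close>
  is in the relative interior of this set and the same face lies over \<open>(q0, \<psi>)\<close>. Thus \<open>q\<close> and \<open>q0\<close>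
  lie in the same projections of faces.\<close>

lemma core_of_cell:
  assumes q: "q \<in> X" and q0: "q0 \<in> X" and core: "q0 \<in> intrinsic_core {q' \<in> X. below q' q}"
  shows "below q q0"
  unfolding cell_le_def
proof (intro allI impI)
  fix \<phi> assume "q0 \<in> p ` {x. I x \<phi>}"
  then obtain x where x: "I x \<phi>" "p x = q0" by auto
  have "q \<in> {q' \<in> X. below q' q}" using q by (simp add: cell_le_def)
  then obtain q1 t where t: "q1 \<in> X" "below q1 q" "0 < t" "t < 1" "q0 = (1 - t) *\<^sub>R q + t *\<^sub>R q1"
    using intrinsic_core_between[OF core] by blast
  obtain \<phi>' where s: "strict_pair I x \<phi>'" using partner x by blast
  have Y: "r \<phi>' \<in> Y" using s strict_pair_incident shadowI by metis
  obtain y \<eta> where y: "strict_pair I y \<eta>" "p y = q" "r \<eta> = r \<phi>'" "fc q (r \<phi>') = {z. I z \<eta>}"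
    using face_over_ex[OF q Y] .
  obtain y1 where y1: "I y1 \<eta>" "p y1 = q1"
    using below_projection[OF q Y t(2)] y(4) by auto
  have "strict_pair I ((1 - t) *\<^sub>R y + t *\<^sub>R y1) \<eta>"
    using strict_segment y y1 t by auto
  moreover have "p ((1 - t) *\<^sub>R y + t *\<^sub>R y1) = q0"
    using p_segment y y1 t by simp
  ultimately have "{z. I z \<eta>} = {z. I z \<phi>'}"
    using strict_unique[of "(1 - t) *\<^sub>R y + t *\<^sub>R y1" \<eta> x \<phi>'] s x y by simp
  then have "I y \<phi>'" using y strict_pair_incident by fastforce
  then have "I y \<phi>" using strict_pairD[OF s x(1)] by simp
  then show "q \<in> p ` {x. I x \<phi>}" using y by auto
qed

lemma below_if_faces_subset:
  assumes q: "q \<in> X" "q' \<in> X" and sub: "\<And>\<psi>. \<psi> \<in> Y \<Longrightarrow> fc q' \<psi> \<subseteq> fc q \<psi>"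
  shows "below q' q"
  unfolding cell_le_def
proof (intro allI impI)
  fix \<phi> assume "q \<in> p ` {x. I x \<phi>}"
  then obtain x where x: "I x \<phi>" "p x = q" by auto
  obtain \<phi>' where s: "strict_pair I x \<phi>'" using partner x by blast
  have "fc q (r \<phi>') = {z. I z \<phi>'}" using face_over_strict s x by blast
  then have "fc q (r \<phi>') \<subseteq> {z. I z \<phi>}" using strict_pairD[OF s x(1)] by auto
  moreover have "r \<phi>' \<in> Y" using s strict_pair_incident shadowI by metis
  ultimately show "q' \<in> p ` {x. I x \<phi>}"
    using sub in_face_projection q by blast
qed

lemma below_iff_faces_subset:
  "\<lbrakk>q \<in> X; q' \<in> X\<rbrakk> \<Longrightarrow> below q' q \<longleftrightarrow> (\<forall>\<psi>\<in>Y. fc q' \<psi> \<subseteq> fc q \<psi>)"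
  using below_if_faces_subset below_face_subset below_projection by meson


subsection \<open>Coherent choices\<close>

lemma coherent_choice_const: "\<psi> \<in> Y \<Longrightarrow> coherent_choice I p r (\<lambda>_. \<psi>)"
  by (simp add: coherent_choice_def)

text \<open>The core of the cone attached to the choice at \<open>q\<close> consists of the functionals that define the same
  face at \<open>q\<close>, so an inclusion of cores says that the two choices define the same face at the smaller
  cell.\<close>

lemma coherent_choice_iff_core:
  assumes sY: "\<And>q. q \<in> X \<Longrightarrow> s q \<in> Y"
  shows "coherent_choice I p r s \<longleftrightarrow>
    (\<forall>q\<in>X. \<forall>q'\<in>X. below q' q \<longrightarrow>
      intrinsic_core (r ` face_over (\<lambda>\<phi> x. I x \<phi>) r p (s q) q) \<subseteq>
      intrinsic_core (r ` face_over (\<lambda>\<phi> x. I x \<phi>) r p (s q') q'))"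
proof -
  have core: "intrinsic_core (r ` face_over (\<lambda>\<phi> x. I x \<phi>) r p (s q) q) = {\<psi> \<in> Y. fc q \<psi> = fc q (s q)}"
    if q: "q \<in> X" for q
  proof -
    have "intrinsic_core (r ` face_over (\<lambda>\<phi> x. I x \<phi>) r p (s q) q) =
        {\<psi> \<in> Y. face_over (\<lambda>\<phi> x. I x \<phi>) r p \<psi> q = face_over (\<lambda>\<phi> x. I x \<phi>) r p (s q) q}"
      using pairing.core_face_over[OF pairing_dual[OF pairing_axioms] sY[OF q] q] .
    also have "\<dots> = {\<psi> \<in> Y. fc q \<psi> = fc q (s q)}"
      using face_over_dual_eq_iff[OF q _ q sY[OF q]] by (intro Collect_cong conj_cong refl) (metis sym)
    finally show ?thesis .
  qed
  have "{\<psi> \<in> Y. fc q \<psi> = fc q (s q)} \<subseteq> {\<psi> \<in> Y. fc q' \<psi> = fc q' (s q')} \<longleftrightarrow> fc q' (s q') = fc q' (s q)"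
    if q: "q \<in> X" "q' \<in> X" and b: "below q' q" for q q'
  proof
    assume "{\<psi> \<in> Y. fc q \<psi> = fc q (s q)} \<subseteq> {\<psi> \<in> Y. fc q' \<psi> = fc q' (s q')}"
    moreover have "s q \<in> {\<psi> \<in> Y. fc q \<psi> = fc q (s q)}" using sY[OF q(1)] by simp
    ultimately have "s q \<in> {\<psi> \<in> Y. fc q' \<psi> = fc q' (s q')}" by (rule subsetD)
    then show "fc q' (s q') = fc q' (s q)" by simp
  next
    assume eq: "fc q' (s q') = fc q' (s q)"
    show "{\<psi> \<in> Y. fc q \<psi> = fc q (s q)} \<subseteq> {\<psi> \<in> Y. fc q' \<psi> = fc q' (s q')}"
    proof (intro subsetI CollectI conjI)
      fix \<psi> assume "\<psi> \<in> {\<psi> \<in> Y. fc q \<psi> = fc q (s q)}"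
      then have \<psi>: "\<psi> \<in> Y" "fc q \<psi> = fc q (s q)" by auto
      show "\<psi> \<in> Y" by fact
      show "fc q' \<psi> = fc q' (s q')"
        unfolding eq by (rule below_face_cong[OF q \<psi>(1) sY[OF q(1)] b \<psi>(2)])
    qed
  qed
  then show ?thesis
    unfolding coherent_choice_def using sY core by (metis (no_types, lifting))
qed

lemma cell_le_trans: "\<lbrakk>below q q'; below q' q''\<rbrakk> \<Longrightarrow> below q q''"
  by (simp add: cell_le_def)

text \<open>Coherence applies in both directions between two points of the same cell, so a choice may be read
  off at representatives of the cells.\<close>

lemma coherent_choice_reindex:
  assumes coh: "coherent_choice I p r s"
    and \<rho>: "\<And>q. q \<in> X \<Longrightarrow> \<rho> q \<in> X \<and> below q (\<rho> q) \<and> below (\<rho> q) q"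
  shows "coherent_choice I p r (\<lambda>q. s (\<rho> q))"
    and "q \<in> X \<Longrightarrow> fc q (s (\<rho> q)) = fc q (s q)"
proof -
  have *: "fc q' (s q') = fc q' (s q)" if "q \<in> X" "q' \<in> X" "below q' q" for q q'
    using coh that by (simp add: coherent_choice_def)
  show **: "fc q (s (\<rho> q)) = fc q (s q)" if "q \<in> X" for q
    using *[of "\<rho> q" q] \<rho>[OF that] that by metis
  have "fc q' (s (\<rho> q')) = fc q' (s (\<rho> q))" if q: "q \<in> X" "q' \<in> X" "below q' q" for q q'
    using **[OF q(2)] *[of "\<rho> q" q'] \<rho>[OF q(1)] q cell_le_trans by metis
  then show "coherent_choice I p r (\<lambda>q. s (\<rho> q))"
    using coh \<rho> by (simp add: coherent_choice_def)
qed

text \<open>Along a segment, cells can only shrink in the limit, because there are finitely many faces and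
  their projections are closed.\<close>

lemma cells_near:
  assumes q: "q \<in> X" "q' \<in> X" and t: "t \<in> {0..1}"
  shows "\<exists>d>0. \<forall>u\<in>{0..1}. \<bar>u - t\<bar> < d \<longrightarrow>
           below ((1 - t) *\<^sub>R q + t *\<^sub>R q') ((1 - u) *\<^sub>R q + u *\<^sub>R q')"
proof -
  define \<gamma> where "\<gamma> u = (1 - u) *\<^sub>R q + u *\<^sub>R q'" for u
  define \<G> where "\<G> = {F \<in> range (\<lambda>\<phi>. {x. I x \<phi>}). F \<noteq> {} \<and> \<gamma> t \<notin> p ` F}"
  have fin: "finite \<G>" unfolding \<G>_def using finite_faces by simp
  have "closed (\<Union>F\<in>\<G>. {u \<in> {0..1}. \<gamma> u \<in> p ` F})"
  proof (rule closed_UN[OF fin], rule ballI)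
    fix F assume "F \<in> \<G>"
    then obtain \<phi> x where "F = {x. I x \<phi>}" "I x \<phi>" by (auto simp: \<G>_def)
    then show "closed {u \<in> {0..1}. \<gamma> u \<in> p ` F}"
      using closed_trace[of x \<phi> q q'] q by (simp add: \<gamma>_def)
  qed
  then have "open (- (\<Union>F\<in>\<G>. {u \<in> {0..1}. \<gamma> u \<in> p ` F}))" by (rule open_Compl)
  moreover have "t \<in> - (\<Union>F\<in>\<G>. {u \<in> {0..1}. \<gamma> u \<in> p ` F})" by (auto simp: \<G>_def)
  ultimately obtain d where d: "d > 0" "\<And>u. \<bar>u - t\<bar> < d \<Longrightarrow> u \<notin> (\<Union>F\<in>\<G>. {u \<in> {0..1}. \<gamma> u \<in> p ` F})"
    unfolding open_dist dist_real_def by (meson ComplD)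
  have "below (\<gamma> t) (\<gamma> u)" if u: "u \<in> {0..1}" "\<bar>u - t\<bar> < d" for u
    unfolding cell_le_def
  proof (intro allI impI)
    fix \<phi> assume m: "\<gamma> u \<in> p ` {x. I x \<phi>}"
    show "\<gamma> t \<in> p ` {x. I x \<phi>}"
    proof (rule ccontr)
      assume "\<gamma> t \<notin> p ` {x. I x \<phi>}"
      then have "{x. I x \<phi>} \<in> \<G>" using m by (auto simp: \<G>_def)
      then show False using d(2)[OF u(2)] u(1) m by auto
    qed
  qed
  then show ?thesis using d(1) unfolding \<gamma>_def by blast
qed

text \<open>The main property of a coherent choice: the face chosen at \<open>q\<close> prescribes the faces chosen at
  all points of its projection, not only at the points of the cell of \<open>q\<close>. Along the segment from \<open>q\<close>
  to \<open>q'\<close> the chosen face is locally constant as long as the segment stays in the relative interior of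
  the projection, and coherence with nearby points settles the end of the segment.\<close>

lemma coherent_choice_fill:
  assumes coh: "coherent_choice I p r s" and q: "q \<in> X" and mem: "q' \<in> p ` fc q (s q)"
  shows "fc q' (s q') = fc q' (s q)"
proof -
  have sY: "\<And>q. q \<in> X \<Longrightarrow> s q \<in> Y" using coh by (simp add: coherent_choice_def)
  have coh': "\<And>q q'. \<lbrakk>q \<in> X; q' \<in> X; below q' q\<rbrakk> \<Longrightarrow> fc q' (s q') = fc q' (s q)"
    using coh by (simp add: coherent_choice_def)
  obtain x \<phi> where x: "strict_pair I x \<phi>" "p x = q" "r \<phi> = s q" "fc q (s q) = {z. I z \<phi>}"
    using face_over_ex[OF q sY[OF q]] .
  obtain x' where x': "I x' \<phi>" "p x' = q'" using mem x by auto
  then have q': "q' \<in> X" using shadowI by blast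
  define \<gamma> where "\<gamma> t = (1 - t) *\<^sub>R q + t *\<^sub>R q'" for t :: real
  have \<gamma>p: "\<gamma> t = p ((1 - t) *\<^sub>R x + t *\<^sub>R x')" for t
    using p_segment x x' by (simp add: \<gamma>_def)
  have \<gamma>X: "\<gamma> t \<in> X" if "t \<in> {0..1}" for t
    using shadowI segment[of x \<phi> x' t] x x' that strict_pair_incident \<gamma>p by (metis atLeastAtMost_iff)
  have near: "\<exists>d>0. \<forall>u\<in>{0..1}. \<bar>u - t\<bar> < d \<longrightarrow> below (\<gamma> t) (\<gamma> u)" if "t \<in> {0..1}" for t
    using cells_near[OF q q' that] by (simp add: \<gamma>_def)
  define F where "F = fc q (s q)"
  have F\<gamma>: "fc (\<gamma> t) (s q) = F" if "t \<in> {0..<1}" for t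
    using face_over_strict[OF strict_segment[OF x(1) x'(1), of t]] that x \<gamma>p by (simp add: F_def)
  have local: "fc (\<gamma> t) (s (\<gamma> t)) = F \<longleftrightarrow> fc (\<gamma> u) (s (\<gamma> u)) = F"
    if tu: "t \<in> {0..<1}" "u \<in> {0..<1}" "below (\<gamma> t) (\<gamma> u)" for t u
  proof -
    have X: "\<gamma> t \<in> X" "\<gamma> u \<in> X" using \<gamma>X tu by auto
    have c: "fc (\<gamma> t) (s (\<gamma> t)) = fc (\<gamma> t) (s (\<gamma> u))"
      using coh'[OF X(2,1) tu(3)] .
    show ?thesis
    proof
      assume "fc (\<gamma> t) (s (\<gamma> t)) = F"
      then have "fc (\<gamma> t) (s (\<gamma> u)) = F" using c by simp
      then show "fc (\<gamma> u) (s (\<gamma> u)) = F"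
        using face_over_product[of "\<gamma> u" "\<gamma> t" "s q" "s (\<gamma> u)"] X F\<gamma> tu sY q by simp
    next
      assume "fc (\<gamma> u) (s (\<gamma> u)) = F"
      then have "fc (\<gamma> t) (s (\<gamma> u)) = fc (\<gamma> t) (s q)"
        using below_face_cong[OF X(2,1) sY[OF X(2)] sY[OF q] tu(3)] F\<gamma>[OF tu(2)] by simp
      then show "fc (\<gamma> t) (s (\<gamma> t)) = F" using c F\<gamma> tu by simp
    qed
  qed
  have const: "fc (\<gamma> b) (s (\<gamma> b)) = F" if b: "b \<in> {0..<1}" for b
  proof (rule connected_induction_simple[where S = "{0..<1}" and a = 0 and P = "\<lambda>t. fc (\<gamma> t) (s (\<gamma> t)) = F"])
    show "connected {0..<1::real}" by simp
    show "fc (\<gamma> 0) (s (\<gamma> 0)) = F" by (simp add: \<gamma>_def F_def)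
    show "b \<in> {0..<1}" "(0::real) \<in> {0..<1}" using b by auto
    fix t :: real assume t: "t \<in> {0..<1}"
    then obtain d where d: "d > 0" "\<And>u. \<lbrakk>u \<in> {0..1}; \<bar>u - t\<bar> < d\<rbrakk> \<Longrightarrow> below (\<gamma> t) (\<gamma> u)"
      using near[of t] by auto
    have "openin (top_of_set {0..<1}) ({0..<1} \<inter> ball t d)"
      by (simp add: openin_open_Int)
    moreover have "t \<in> {0..<1} \<inter> ball t d" using t d by simp
    moreover have "fc (\<gamma> t) (s (\<gamma> t)) = F \<longleftrightarrow> fc (\<gamma> u) (s (\<gamma> u)) = F"
      if "u \<in> {0..<1} \<inter> ball t d" for u
      using that by (intro local t d) (auto simp: dist_real_def)
    ultimately show "\<exists>T. openin (top_of_set {0..<1}) T \<and> t \<in> T \<and>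
        (\<forall>u\<in>T. \<forall>v\<in>T. fc (\<gamma> u) (s (\<gamma> u)) = F \<longrightarrow> fc (\<gamma> v) (s (\<gamma> v)) = F)"
      by blast
  qed
  obtain d where d: "d > 0" "\<And>u. \<lbrakk>u \<in> {0..1}; \<bar>u - 1\<bar> < d\<rbrakk> \<Longrightarrow> below (\<gamma> 1) (\<gamma> u)"
    using near[of 1] by auto
  define u where "u = max 0 (1 - d / 2)"
  have u: "u \<in> {0..<1}" "\<bar>u - 1\<bar> < d" using d(1) by (auto simp: u_def)
  have b: "below q' (\<gamma> u)" using d(2)[of u] u by (simp add: \<gamma>_def)
  have uX: "\<gamma> u \<in> X" using \<gamma>X u by auto
  have "fc q' (s q') = fc q' (s (\<gamma> u))" using coh'[OF uX q' b] .
  also have "\<dots> = fc q' (s q)"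
    using below_face_cong[OF uX q' sY[OF uX] sY[OF q] b] const[OF u(1)] F\<gamma>[OF u(1)] by simp
  finally show ?thesis .
qed

lemma coherent_choice_Y: "\<lbrakk>coherent_choice I p r s; q \<in> X\<rbrakk> \<Longrightarrow> s q \<in> Y"
  by (simp add: coherent_choice_def)

text \<open>The part of the union of the family that lies over \<open>q\<close> belongs to the face chosen at \<open>q\<close>, so the
  union determines the family.\<close>

theorem coherent_union_le_iff:
  assumes s: "coherent_choice I p r s" and s': "coherent_choice I p r s'"
  shows "\<Union>(family_of I p r s) \<subseteq> \<Union>(family_of I p r s') \<longleftrightarrow> (\<forall>q\<in>X. fc q (s q) \<subseteq> fc q (s' q))"
proof
  assume "\<forall>q\<in>X. fc q (s q) \<subseteq> fc q (s' q)"
  then show "\<Union>(family_of I p r s) \<subseteq> \<Union>(family_of I p r s')"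
    by (fastforce simp: family_of_def)
next
  assume sub: "\<Union>(family_of I p r s) \<subseteq> \<Union>(family_of I p r s')"
  show "\<forall>q\<in>X. fc q (s q) \<subseteq> fc q (s' q)"
  proof
    fix q assume q: "q \<in> X"
    obtain x \<phi> where x: "strict_pair I x \<phi>" "p x = q" "r \<phi> = s q" "fc q (s q) = {z. I z \<phi>}"
      using face_over_ex[OF q coherent_choice_Y[OF s q]] .
    have "x \<in> \<Union>(family_of I p r s)"
      using x q strict_pair_incident by (fastforce simp: family_of_def)
    then obtain q1 where q1: "q1 \<in> X" "x \<in> fc q1 (s' q1)"
      using sub by (auto simp: family_of_def)
    have "fc q (s' q) = fc q (s' q1)"
      using coherent_choice_fill[OF s' q1(1), of q] q1 x by auto
    then have "x \<in> fc q (s' q)"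
      using incident_fiber[OF q1(2)] coherent_choice_Y[OF s' q1(1)] x by simp
    moreover obtain y \<eta> where "strict_pair I y \<eta>" "fc q (s' q) = {z. I z \<eta>}"
      using face_over_ex[OF q coherent_choice_Y[OF s' q]] by metis
    ultimately show "fc q (s q) \<subseteq> fc q (s' q)"
      using x(4) strict_pair_subset[OF x(1)] by simp
  qed
qed


subsection \<open>Coherent choices are tight subdivisions\<close>

text \<open>Over a fixed \<open>\<psi>\<close> the faces project to a polyhedral complex: if a segment of the projection of
  \<open>F\<^bsub>q,\<psi>\<^esub>\<close> has an inner point in that of \<open>F\<^bsub>q',\<psi>\<^esub>\<close>, then a segment of \<open>F\<^bsub>q,\<psi>\<^esub>\<close> above it has an inner point
  in \<open>F\<^bsub>q',\<psi>\<^esub>\<close> by exchange, hence lies in this face.\<close>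

lemma projection_face_of:
  assumes q: "q \<in> X" and Y: "\<psi> \<in> Y" and q': "q' \<in> p ` fc q \<psi>"
  shows "p ` fc q' \<psi> face_of p ` fc q \<psi>"
proof -
  obtain x \<phi> where x: "strict_pair I x \<phi>" "p x = q" "r \<phi> = \<psi>" "fc q \<psi> = {z. I z \<phi>}"
    using face_over_ex[OF q Y] .
  obtain x' where x': "I x' \<phi>" "p x' = q'" using q' x by auto
  have q'X: "q' \<in> X" using shadowI x' by blast
  obtain y \<eta> where y: "strict_pair I y \<eta>" "p y = q'" "r \<eta> = \<psi>" "fc q' \<psi> = {z. I z \<eta>}"
    using face_over_ex[OF q'X Y] .
  have "convex (p ` fc q' \<psi>)" using convex_projection y by simp
  moreover have "a \<in> p ` fc q' \<psi> \<and> b \<in> p ` fc q' \<psi>"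
    if ab: "a \<in> p ` fc q \<psi>" "b \<in> p ` fc q \<psi>" "m \<in> p ` fc q' \<psi>" "m \<in> open_segment a b" for a b m
  proof -
    have *: "a \<in> p ` fc q' \<psi>"
      if ab: "a \<in> p ` fc q \<psi>" "b \<in> p ` fc q \<psi>" "m \<in> p ` fc q' \<psi>" "m \<in> open_segment a b" for a b
    proof -
      obtain a' where a': "I a' \<phi>" "p a' = a" using ab x by auto
      obtain b' where b': "I b' \<phi>" "p b' = b" using ab x by auto
      obtain z where z: "I z \<eta>" "p z = m" using ab y by auto
      obtain t where t: "0 < t" "t < 1" "m = (1 - t) *\<^sub>R a + t *\<^sub>R b"
        using ab(4) by (auto simp: in_segment)
      have "I ((1 - t) *\<^sub>R a' + t *\<^sub>R b') \<phi>" using segment a' b' t by simp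
      moreover have "p ((1 - t) *\<^sub>R a' + t *\<^sub>R b') = p z" using p_segment a' b' t z by simp
      ultimately have "I ((1 - t) *\<^sub>R a' + t *\<^sub>R b') \<eta>"
        using exchange[of _ \<phi> z \<eta>] z x y by simp
      then have "I a' \<eta>" using extremal[of a' \<phi> b' t \<eta>] a' b' t by simp
      then show ?thesis using a' y by auto
    qed
    show ?thesis
      using *[OF ab] *[of b a] ab by (simp add: open_segment_commute)
  qed
  ultimately show ?thesis
    using below_face_subset[OF q q'X Y q'] unfolding face_of_def by blast
qed

text \<open>A nonempty face of a projected member, or a nonempty intersection of two projected members, is
  the projection of the face chosen at any of its core points. Here the faces chosen at all points of
  the projection matter, not only those chosen at the points of a cell.\<close>

lemma tight_subdivision_if_coherent:
  assumes coh: "coherent_choice I p r s"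
  shows "tight_subdivision I p (family_of I p r s)"
proof -
  define G where "G q = fc q (s q)" for q
  have sY: "\<And>q. q \<in> X \<Longrightarrow> s q \<in> Y" using coh by (simp add: coherent_choice_def)
  have fill: "G q' = fc q' (s q)" if "q \<in> X" "q' \<in> p ` G q" for q q'
    unfolding G_def by (rule coherent_choice_fill[OF coh that(1) that(2)[unfolded G_def]])
  have mem: "q \<in> p ` G q" if "q \<in> X" for q
    using in_face_projection sY that by (simp add: G_def)
  have GX: "p ` G q \<subseteq> X" if q: "q \<in> X" for q
  proof -
    obtain x \<phi> where "G q = {z. I z \<phi>}" using face_over_ex[OF q sY[OF q]] unfolding G_def by metis
    then show ?thesis using shadowI by auto
  qed
  have face: "p ` G q' face_of p ` G q" if "q \<in> X" "q' \<in> p ` G q" for q q'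
    unfolding fill[OF that] unfolding G_def
    by (rule projection_face_of[OF that(1) sY[OF that(1)] that(2)[unfolded G_def]])
  have sub: "G q' \<subseteq> G q" if "q \<in> X" "q' \<in> p ` G q" for q q'
    unfolding fill[OF that] unfolding G_def
    by (rule below_face_subset[OF that(1) subsetD[OF GX[OF that(1)] that(2)] sY[OF that(1)]
          that(2)[unfolded G_def]])
  have cvx: "convex (p ` G q)" if "q \<in> X" for q
    using face[OF that mem[OF that]] face_of_imp_convex by blast
  have core: "q \<in> intrinsic_core (p ` G q)" if "q \<in> X" for q
    unfolding G_def core_face_over[OF that sY[OF that]] using that by blast
  have faces: "T \<in> (`) p ` G ` X" if q: "q \<in> X" and T: "T face_of p ` G q" "T \<noteq> {}" for q T
  proof -
    have sT: "T \<subseteq> p ` G q" using T(1) face_of_imp_subset by blast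
    then have "T \<subseteq> X" using GX[OF q] by (rule subset_trans)
    then obtain q' where q': "q' \<in> intrinsic_core T"
      using core_nonempty[OF _ face_of_imp_convex[OF T(1)] T(2)] by auto
    then have m: "q' \<in> T" "q' \<in> p ` G q"
      using sT intrinsic_core_subset by blast+
    then have q'X: "q' \<in> X" using GX q by blast
    have "p ` G q' \<subseteq> T"
      by (rule face_of_absorbs[OF T(1) image_mono[OF sub[OF q m(2)]] m(1) core[OF q'X]])
    moreover have "T \<subseteq> p ` G q'"
      using face_of_absorbs[OF face[OF q m(2)] sT mem[OF q'X] q'] .
    ultimately show ?thesis using q'X by blast
  qed
  have inter: "(p ` G q \<inter> p ` G q1) face_of p ` G q" if q: "q \<in> X" "q1 \<in> X" for q q1
  proof (cases "p ` G q \<inter> p ` G q1 = {}")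
    case False
    have "convex (p ` G q \<inter> p ` G q1)" by (intro convex_Int cvx q)
    moreover have "p ` G q \<inter> p ` G q1 \<subseteq> X" using GX[OF q(1)] by (rule le_infI1)
    ultimately obtain q' where q': "q' \<in> intrinsic_core (p ` G q \<inter> p ` G q1)"
      using core_nonempty[OF _ _ False] by auto
    then have m: "q' \<in> p ` G q" "q' \<in> p ` G q1" using intrinsic_core_subset by blast+
    then have q'X: "q' \<in> X" using GX q by blast
    have "p ` G q' \<subseteq> p ` G q \<inter> p ` G q1"
      by (intro Int_greatest image_mono sub q m)
    moreover have "p ` G q \<inter> p ` G q1 \<subseteq> p ` G q'"
      using face_of_absorbs[OF face[OF q(1) m(1)] _ mem[OF q'X] q'] by simp
    ultimately show ?thesis using face[OF q(1) m(1)] by (metis subset_antisym)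
  qed simp
  have inj: "G q = G q1" if q: "q \<in> X" "q1 \<in> X" "p ` G q = p ` G q1" for q q1
    using sub[of q q1] sub[of q1 q] mem that by (metis subset_antisym)
  have tight: "p ` G q \<subseteq> p ` G q1 \<longleftrightarrow> G q = (p -` (p ` G q)) \<inter> G q1"
    if q: "q \<in> X" "q1 \<in> X" for q q1
  proof
    assume le: "p ` G q \<subseteq> p ` G q1"
    then have m: "q \<in> p ` G q1" using mem q by blast
    obtain x \<phi> where x: "strict_pair I x \<phi>" "p x = q" "r \<phi> = s q1" "fc q (s q1) = {z. I z \<phi>}"
      using face_over_ex[OF q(1) sY[OF q(2)]] .
    obtain x1 \<phi>1 where x1: "strict_pair I x1 \<phi>1" "p x1 = q1" "r \<phi>1 = s q1" "fc q1 (s q1) = {z. I z \<phi>1}"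
      using face_over_ex[OF q(2) sY[OF q(2)]] .
    have G: "G q = {z. I z \<phi>}" "G q1 = {z. I z \<phi>1}"
      using fill[OF q(2) m] x x1 by (auto simp: G_def)
    have "z \<in> G q" if "z \<in> (p -` (p ` G q)) \<inter> G q1" for z
    proof -
      have "p z \<in> p ` G q" and z: "I z \<phi>1" using that G by auto
      then obtain w where w: "p z = p w" "w \<in> G q" by (elim imageE)
      then have "I w \<phi>" using G by simp
      then show ?thesis using exchange[of z \<phi>1 w \<phi>] x x1 G z w by simp
    qed
    then show "G q = (p -` (p ` G q)) \<inter> G q1" using sub[OF q(2) m] by blast
  qed blast
  have proper: "\<exists>x \<phi>. I x \<phi> \<and> G q = {z. I z \<phi>}" if q: "q \<in> X" for q
    using face_over_ex[OF q sY[OF q]] unfolding G_def by (metis strict_pair_incident)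
  have fam: "family_of I p r s = G ` X" by (simp add: family_of_def G_def)
  show ?thesis
    unfolding tight_subdivision_def fam
  proof (intro conjI ballI)
    show "\<exists>x \<phi>. I x \<phi> \<and> F = {z. I z \<phi>}" if "F \<in> G ` X" for F
      using that by (elim imageE, simp only:) (rule proper)
    show "faces (p ` F) \<subseteq> (`) p ` G ` X" if "F \<in> G ` X" for F
      using that by (elim imageE, simp only: faces_def) (intro subsetI, elim CollectE conjE, rule faces)
    show "(p ` F \<inter> p ` F') face_of p ` F" if "F \<in> G ` X" "F' \<in> G ` X" for F F'
      using that by (elim imageE, simp only:) (rule inter)
    show "(\<Union>F\<in>G ` X. p ` F) = X"
      by (intro equalityI UN_least subsetI) (use GX in blast, rule UN_I, rule imageI, assumption, rule mem)
    show "inj_on ((`) p) (G ` X)" unfolding inj_on_def using inj by blast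
    show "p ` F \<subseteq> p ` F' \<longleftrightarrow> F = (p -` (p ` F)) \<inter> F'" if "F \<in> G ` X" "F' \<in> G ` X" for F F'
      using that by (elim imageE, simp only:) (rule tight)
  qed
qed

text \<open>Conversely, the relative interiors of the projections partition the base, and the choice attached
  to a tight subdivision takes over \<open>q\<close> the member with \<open>q\<close> in the relative interior of its projection.
  Tightness makes the choice coherent.\<close>

lemma coherent_if_tight_subdivision:
  assumes T: "tight_subdivision I p \<F>"
  obtains s where "coherent_choice I p r s" "\<F> = family_of I p r s"
proof -
  have proper: "\<exists>x \<phi>. I x \<phi> \<and> F = {z. I z \<phi>}" if "F \<in> \<F>" for F
    using T that by (simp add: tight_subdivision_def)
  have faces: "faces (p ` F) \<subseteq> (`) p ` \<F>" if "F \<in> \<F>" for F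
    using T that by (simp add: tight_subdivision_def)
  have inter: "(p ` F \<inter> p ` G) face_of p ` F" if "F \<in> \<F>" "G \<in> \<F>" for F G
    using T that by (simp add: tight_subdivision_def)
  have cover: "(\<Union>F\<in>\<F>. p ` F) = X" and inj: "inj_on ((`) p) \<F>"
    using T by (simp_all add: tight_subdivision_def)
  have tight: "p ` F \<subseteq> p ` G \<longleftrightarrow> F = (p -` (p ` F)) \<inter> G" if "F \<in> \<F>" "G \<in> \<F>" for F G
    by (rule T[unfolded tight_subdivision_def, THEN conjunct2, THEN conjunct2, THEN conjunct2,
          THEN conjunct2, THEN conjunct2, THEN bspec, OF that(1), THEN bspec, OF that(2)])
  have sub: "p ` F' \<subseteq> p ` F" if "F \<in> \<F>" "F' \<in> \<F>" "q \<in> p ` F" "q \<in> intrinsic_core (p ` F')" for q F F'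
    using face_of_absorbs[OF inter[OF that(2,1)] order_refl, of q] that intrinsic_core_subset by blast
  have ex: "\<exists>F\<in>\<F>. q \<in> intrinsic_core (p ` F)" if q: "q \<in> X" for q
  proof -
    obtain F where F: "F \<in> \<F>" "q \<in> p ` F" using cover q by blast
    obtain x0 \<phi>0 where x0: "I x0 \<phi>0" "F = {z. I z \<phi>0}" using proper F by blast
    obtain x where x: "strict_pair I x \<phi>0" using dual.partner[of x0 \<phi>0] x0 by (auto simp: strict_pair_dual[of I])
    have fx: "fc (p x) (r \<phi>0) = F" using face_over_strict x x0 by simp
    have pX: "p x \<in> X" "r \<phi>0 \<in> Y" using shadowI x strict_pair_incident by metis+
    have "p ` fc q (r \<phi>0) face_of p ` F"
      using projection_face_of[OF pX] fx F by simp
    moreover have m: "q \<in> p ` fc q (r \<phi>0)" using in_face_projection q pX by blast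
    ultimately have "p ` fc q (r \<phi>0) \<in> (`) p ` \<F>" using faces[OF F(1)] unfolding faces_def by blast
    moreover have "q \<in> intrinsic_core (p ` fc q (r \<phi>0))"
      using core_face_over[OF q pX(2)] q by simp
    ultimately show ?thesis by auto
  qed
  then obtain G where G: "\<And>q. q \<in> X \<Longrightarrow> G q \<in> \<F> \<and> q \<in> intrinsic_core (p ` G q)" by metis
  have uniq: "F = G q" if "F \<in> \<F>" "q \<in> X" "q \<in> intrinsic_core (p ` F)" for F q
  proof -
    have "p ` F = p ` G q"
      using sub[of F "G q" q] sub[of "G q" F q] G[OF that(2)] that intrinsic_core_subset by blast
    then show ?thesis using inj that G unfolding inj_on_def by blast
  qed
  have "\<exists>x \<phi>. strict_pair I x \<phi> \<and> p x = q \<and> G q = {z. I z \<phi>}" if q: "q \<in> X" for q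
  proof -
    obtain x0 \<phi> where x0: "I x0 \<phi>" "G q = {z. I z \<phi>}" using proper G q by blast
    then show ?thesis using core_projection[OF x0(1)] G[OF q] by auto
  qed
  then obtain \<xi> \<Phi> where \<Phi>: "\<And>q. q \<in> X \<Longrightarrow> strict_pair I (\<xi> q) (\<Phi> q) \<and> p (\<xi> q) = q \<and> G q = {z. I z (\<Phi> q)}"
    by metis
  define s where "s q = r (\<Phi> q)" for q
  have sY: "s q \<in> Y" if "q \<in> X" for q
    using \<Phi>[OF that] strict_pair_incident shadowI unfolding s_def by metis
  have Gs: "fc q (s q) = G q" if "q \<in> X" for q
    using \<Phi>[OF that] face_over_strict unfolding s_def by metis
  have "fc q' (s q') = fc q' (s q)" if q: "q \<in> X" "q' \<in> X" and b: "below q' q" for q q'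
  proof -
    have m: "q' \<in> p ` G q" using below_projection[OF q(1) sY[OF q(1)] b] Gs q by simp
    have "p ` G q' \<subseteq> p ` G q" using sub m G q by blast
    then have tg: "G q' = (p -` (p ` G q')) \<inter> G q" using tight G q by blast
    obtain y \<eta> where y: "strict_pair I y \<eta>" "p y = q'" "r \<eta> = s q" "fc q' (s q) = {z. I z \<eta>}"
      using face_over_ex[OF q(2) sY[OF q(1)]] .
    obtain x' where x': "I x' (\<Phi> q)" "p x' = q'" using m \<Phi> q by auto
    have "I y (\<Phi> q)" using exchange[of y \<eta> x' "\<Phi> q"] x' y strict_pair_incident by (metis s_def)
    then have "y \<in> G q" using \<Phi> q by blast
    moreover have "p y \<in> p ` G q'" using y G[OF q(2)] intrinsic_core_subset by blast
    ultimately have yG: "y \<in> G q'" using tg by blast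
    have "\<xi> q' \<in> G q'" using \<Phi>[OF q(2)] strict_pair_incident by (metis mem_Collect_eq)
    then have "\<xi> q' \<in> G q" using tg by blast
    then have "I (\<xi> q') (\<Phi> q)" using \<Phi>[OF q(1)] by simp
    then have "I (\<xi> q') \<eta>"
      using exchange[of "\<xi> q'" "\<Phi> q" y \<eta>] y \<Phi>[OF q(2)] strict_pair_incident by (metis s_def)
    then have "G q' \<subseteq> fc q' (s q)"
      unfolding y(4) using \<Phi>[OF q(2)] strict_pair_subset[of I "\<xi> q'"] by simp
    moreover have "fc q' (s q) \<subseteq> G q'"
      unfolding y(4) using yG \<Phi>[OF q(2)] strict_pair_subset[OF y(1)] by simp
    ultimately show ?thesis using Gs q by simp
  qed
  then have coh: "coherent_choice I p r s" using sY by (simp add: coherent_choice_def)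
  have "F \<in> G ` X" if F: "F \<in> \<F>" for F
  proof -
    obtain x0 \<phi> where x0: "I x0 \<phi>" "F = {z. I z \<phi>}" using proper F by blast
    obtain x where x: "strict_pair I x \<phi>" using dual.partner[of x0 \<phi>] x0 by (auto simp: strict_pair_dual[of I])
    have "p x \<in> intrinsic_core (p ` F)" using core_projection[OF x0(1)] x x0 by auto
    moreover have "p x \<in> X" using shadowI x strict_pair_incident by metis
    ultimately show ?thesis using uniq F by blast
  qed
  then have "\<F> = G ` X" using G by blast
  also have "\<dots> = family_of I p r s" using Gs by (auto simp: family_of_def)
  finally show ?thesis using that coh by blast
qed

theorem tight_subdivision_iff:
  "tight_subdivision I p \<F> \<longleftrightarrow> (\<exists>s. coherent_choice I p r s \<and> \<F> = family_of I p r s)"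
  using tight_subdivision_if_coherent coherent_if_tight_subdivision by metis

end


section \<open>Functionals on a subspace\<close>

lemma dual_spaceD:
  assumes "f \<in> dual_space S"
  shows "\<lbrakk>x \<in> S; y \<in> S\<rbrakk> \<Longrightarrow> f (x + y) = f x + f y"
    and "x \<in> S \<Longrightarrow> f (c *\<^sub>R x) = c * f x"
    and "x \<notin> S \<Longrightarrow> f x = 0"
  using assms by (auto simp: dual_space_def)

lemma dual_space_diff:
  assumes "f \<in> dual_space S" "subspace S" "x \<in> S" "y \<in> S"
  shows "f (x - y) = f x - f y"
proof -
  have "f (x + (-1) *\<^sub>R y) = f x + (-1) * f y"
    using assms by (simp only: dual_spaceD[OF assms(1)] subspace_scale)
  then show ?thesis by simp
qed

lemma subspace_dual_space: "subspace (dual_space S)"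
  by (auto simp: subspace_def dual_space_def algebra_simps)

lemma linear_dual_restrict: "linear (dual_restrict S)"
  by (intro linearI) (auto simp: dual_restrict_def fun_eq_iff)

lemma dual_restrict_inner: "subspace S \<Longrightarrow> dual_restrict S (inner u) \<in> dual_space S"
  by (auto simp: dual_space_def dual_restrict_def inner_add_right subspace_add subspace_scale)

lemma dual_restrict_dual_space:
  assumes "f \<in> dual_space V" "S \<subseteq> V" "subspace S"
  shows "dual_restrict S f \<in> dual_space S"
  using assms unfolding dual_space_def dual_restrict_def
  by (auto simp: subspace_add subspace_scale subset_iff)

text \<open>The vector representing a functional with respect to an orthonormal basis.\<close>

definition represent :: "'v::real_inner set \<Rightarrow> ('v \<Rightarrow> real) \<Rightarrow> 'v" where
  "represent B f = (\<Sum>b\<in>B. f b *\<^sub>R b)"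

lemma linear_represent: "linear (represent B)"
  by (intro linearI) (auto simp: represent_def scaleR_add_left sum.distrib scaleR_sum_right)

locale orthonormal_basis =
  fixes S B :: "'v::euclidean_space set"
  assumes basis: "finite B" "pairwise orthogonal B" "\<And>b. b \<in> B \<Longrightarrow> norm b = 1" "span B = S"
begin

lemma sub: "subspace S"
  using basis by (metis subspace_span)

lemma basis_inner: "\<lbrakk>b \<in> B; c \<in> B\<rbrakk> \<Longrightarrow> b \<bullet> c = (if b = c then 1 else 0)"
  using basis(2,3) by (auto simp: pairwise_def orthogonal_def norm_eq_1)

lemma represent_in: "represent B f \<in> S"
proof -
  have "B \<subseteq> S" using basis span_superset by blast
  then show ?thesis
    unfolding represent_def by (intro subspace_sum[OF sub] subspace_scale[OF sub]) blast
qed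

lemma represent_inner:
  assumes "f \<in> dual_space S" "x \<in> S"
  shows "represent B f \<bullet> x = f x"
proof -
  have x: "x \<in> span B" using assms basis by simp
  have BS: "B \<subseteq> S" using basis span_superset by blast
  have f0: "f 0 = 0" using dual_spaceD(2)[OF assms(1,2), of 0] by simp
  have "x \<in> S \<and> represent B f \<bullet> x = f x"
  proof (rule span_induct_alt[OF x, of "\<lambda>x. x \<in> S \<and> represent B f \<bullet> x = f x"])
    show "0 \<in> S \<and> represent B f \<bullet> 0 = f 0" using f0 sub subspace_0 by auto
    fix c b y assume b: "b \<in> B" and y: "y \<in> S \<and> represent B f \<bullet> y = f y"
    have "represent B f \<bullet> b = (\<Sum>a\<in>B. f a * (a \<bullet> b))"
      by (simp add: represent_def inner_sum_left)
    also have "\<dots> = (\<Sum>a\<in>B. if a = b then f a else 0)"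
      using b basis_inner by (intro sum.cong) auto
    also have "\<dots> = f b" using b basis by simp
    finally have "represent B f \<bullet> b = f b" .
    moreover have "b \<in> S" using b BS by blast
    ultimately show "c *\<^sub>R b + y \<in> S \<and> represent B f \<bullet> (c *\<^sub>R b + y) = f (c *\<^sub>R b + y)"
      using y sub dual_spaceD[OF assms(1)] by (simp add: inner_add_right subspace_add subspace_scale)
  qed
  then show ?thesis by simp
qed

lemma represent_inverse:
  assumes "f \<in> dual_space S"
  shows "dual_restrict S (inner (represent B f)) = f"
  using represent_inner[OF assms] dual_spaceD(3)[OF assms] by (auto simp: dual_restrict_def)

lemma represent_eqI:
  assumes "x \<in> S"
  shows "represent B (dual_restrict S (inner x)) = x"
proof -
  let ?y = "represent B (dual_restrict S (inner x))"
  have d: "x - ?y \<in> S" using assms represent_in sub subspace_diff by blast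
  have "?y \<bullet> (x - ?y) = x \<bullet> (x - ?y)"
    using represent_inner[OF dual_restrict_inner[OF sub] d, of x] d by (simp add: dual_restrict_def)
  then have "(x - ?y) \<bullet> (x - ?y) = 0" by (simp add: inner_diff_left)
  then show ?thesis by simp
qed

lemma represent_inj: "\<lbrakk>f \<in> dual_space S; g \<in> dual_space S; represent B f = represent B g\<rbrakk> \<Longrightarrow> f = g"
  using represent_inverse by metis

end

lemma orthonormal_basis_ex:
  assumes "subspace (S :: 'v::euclidean_space set)"
  obtains B where "orthonormal_basis S B"
  using orthonormal_basis_subspace[OF assms] independent_imp_finite
  unfolding orthonormal_basis_def by metis

lemma dual_space_riesz:
  assumes "subspace (S :: 'v::euclidean_space set)" "f \<in> dual_space S"
  obtains u where "u \<in> S" "\<And>x. x \<in> S \<Longrightarrow> f x = u \<bullet> x"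
proof -
  obtain B where "orthonormal_basis S B" using orthonormal_basis_ex[OF assms(1)] .
  then interpret orthonormal_basis S B .
  show ?thesis using that[of "represent B f"] represent_in represent_inner[OF assms(2)] by simp
qed


subsection \<open>Relative interiors of sets of functionals\<close>

lemma affine_hull_linear_subset:
  assumes "linear f"
  shows "f ` (affine hull s) \<subseteq> affine hull (f ` s)"
proof -
  have "affine {x. f x \<in> affine hull (f ` s)}"
    using affine_affine_hull[of "f ` s"] assms
    unfolding affine_def by (simp add: linear_add linear_scale)
  then have "affine hull s \<subseteq> {x. f x \<in> affine hull (f ` s)}"
    by (intro hull_minimal) (auto intro: hull_inc)
  then show ?thesis by auto
qed

lemma continuous_represent: "continuous_on UNIV (represent B)"
  unfolding represent_def by (intro continuous_intros) auto

lemma continuous_dual_restrict_inner: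
  "continuous_on UNIV (\<lambda>x. dual_restrict S (inner x) :: 'v::real_inner \<Rightarrow> real)"
proof (rule continuous_on_coordinatewise_then_product)
  fix i
  show "continuous_on UNIV (\<lambda>x. dual_restrict S (inner x) i)"
    by (cases "i \<in> S") (auto simp: dual_restrict_def intro!: continuous_intros)
qed

text \<open>Representing functionals by vectors is a linear homeomorphism, so the relative interior of a set
  of functionals can be computed in Euclidean space.\<close>

lemma (in orthonormal_basis) rel_interior_represent:
  assumes C: "C \<subseteq> dual_space S"
  shows "f \<in> rel_interior C \<longleftrightarrow> f \<in> C \<and> represent B f \<in> rel_interior (represent B ` C)"
proof -
  define E where "E x = dual_restrict S (inner x)" for x :: 'v
  have linE: "linear E"
    by (intro linearI) (auto simp: E_def dual_restrict_def fun_eq_iff inner_add_left)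
  have EC: "E ` represent B ` C = C"
    using C represent_inverse unfolding E_def image_image by (force simp: image_iff)
  have affC: "affine hull C \<subseteq> dual_space S"
    using C subspace_dual_space subspace_imp_affine by (intro hull_minimal) auto
  have affR: "affine hull (represent B ` C) \<subseteq> S"
    using represent_in sub subspace_imp_affine by (intro hull_minimal) auto
  show ?thesis
  proof
    assume "f \<in> rel_interior C"
    then obtain T where T: "f \<in> C" "open T" "f \<in> T" "T \<inter> affine hull C \<subseteq> C"
      unfolding rel_interior by blast
    have "open (E -` T)"
      using continuous_dual_restrict_inner[of S] T(2) open_vimage unfolding E_def by blast
    moreover have "represent B f \<in> E -` T"
      using T represent_inverse C by (auto simp: E_def)
    moreover have "E -` T \<inter> affine hull (represent B ` C) \<subseteq> represent B ` C"
    proof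
      fix y assume y: "y \<in> E -` T \<inter> affine hull (represent B ` C)"
      then have "E y \<in> affine hull C"
        using affine_hull_linear_subset[OF linE, of "represent B ` C"] EC by auto
      then have "E y \<in> C" using y T by blast
      moreover have "represent B (E y) = y"
        using represent_eqI y affR unfolding E_def by blast
      ultimately show "y \<in> represent B ` C" by (metis image_eqI)
    qed
    ultimately show "f \<in> C \<and> represent B f \<in> rel_interior (represent B ` C)"
      using T(1) unfolding rel_interior by blast
  next
    assume "f \<in> C \<and> represent B f \<in> rel_interior (represent B ` C)"
    then obtain T where T: "f \<in> C" "open T" "represent B f \<in> T"
        "T \<inter> affine hull (represent B ` C) \<subseteq> represent B ` C"
      unfolding rel_interior by blast
    have "open (represent B -` T)"
      using continuous_represent T(2) open_vimage by blast
    moreover have "represent B -` T \<inter> affine hull C \<subseteq> C"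
    proof
      fix g assume g: "g \<in> represent B -` T \<inter> affine hull C"
      then have "represent B g \<in> represent B ` C"
        using affine_hull_linear_subset[OF linear_represent, of B C] T by auto
      then obtain h where "h \<in> C" "represent B g = represent B h" by auto
      then show "g \<in> C" using represent_inj C affC g by blast
    qed
    ultimately show "f \<in> rel_interior C"
      using T unfolding rel_interior by blast
  qed
qed

lemma rel_interior_eq_core:
  assumes "convex (C :: 'v::euclidean_space set)"
  shows "rel_interior C = intrinsic_core C"
proof (cases "C = {}")
  case False
  have "(\<forall>x\<in>C. \<exists>e>1. (1 - e) *\<^sub>R x + e *\<^sub>R z \<in> C) \<longleftrightarrow> (\<forall>x\<in>C. \<exists>e>0. z + e *\<^sub>R (z - x) \<in> C)" for z
  proof (intro ball_cong refl iffI)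
    fix x assume "\<exists>e>1. (1 - e) *\<^sub>R x + e *\<^sub>R z \<in> C"
    then obtain e where "e > 1" "(1 - e) *\<^sub>R x + e *\<^sub>R z \<in> C" by auto
    then show "\<exists>e>0. z + e *\<^sub>R (z - x) \<in> C"
      by (intro exI[of _ "e - 1"]) (auto simp: algebra_simps)
  next
    fix x assume "\<exists>e>0. z + e *\<^sub>R (z - x) \<in> C"
    then obtain e where "e > 0" "z + e *\<^sub>R (z - x) \<in> C" by auto
    then show "\<exists>e>1. (1 - e) *\<^sub>R x + e *\<^sub>R z \<in> C"
      by (intro exI[of _ "e + 1"]) (auto simp: algebra_simps)
  qed
  then show ?thesis
    using convex_rel_interior_iff[OF assms False] rel_interior_subset
    unfolding intrinsic_core_def by blast
qed (simp add: intrinsic_core_def)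

lemma rel_interior_functionals:
  assumes S: "subspace (S :: 'v::euclidean_space set)" and C: "C \<subseteq> dual_space S" "convex C"
  shows "rel_interior C = intrinsic_core C" and "C \<noteq> {} \<Longrightarrow> rel_interior C \<noteq> {}"
proof -
  obtain B where "orthonormal_basis S B" using orthonormal_basis_ex[OF S] .
  then interpret orthonormal_basis S B .
  have cvx: "convex (represent B ` C)"
    using convex_linear_image[OF linear_represent C(2)] .
  have mem: "f + e *\<^sub>R (f - g) \<in> C \<longleftrightarrow>
      represent B f + e *\<^sub>R (represent B f - represent B g) \<in> represent B ` C"
    if fg: "f \<in> C" "g \<in> C" for f g e
  proof -
    have eq: "represent B f + e *\<^sub>R (represent B f - represent B g) = represent B (f + e *\<^sub>R (f - g))"
      by (simp add: linear_add linear_diff linear_scale linear_represent)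
    have "f + e *\<^sub>R (f - g) \<in> dual_space S"
      using fg C(1) subspace_dual_space[of S] by (meson subsetD subspace_add subspace_diff subspace_scale)
    then show ?thesis
      unfolding eq using represent_inj C(1) by (auto simp: image_iff)
  qed
  show eq: "rel_interior C = intrinsic_core C"
  proof (rule set_eqI)
    fix f
    show "f \<in> rel_interior C \<longleftrightarrow> f \<in> intrinsic_core C"
      unfolding rel_interior_represent[OF C(1)] rel_interior_eq_core[OF cvx]
      using mem by (auto simp: intrinsic_core_def)
  qed
  assume "C \<noteq> {}"
  then have "rel_interior (represent B ` C) \<noteq> {}"
    using rel_interior_eq_empty[OF cvx] by simp
  then obtain y where "y \<in> rel_interior (represent B ` C)" by blast
  moreover from this obtain f where "f \<in> C" "y = represent B f"
    using rel_interior_subset by blast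
  ultimately show "rel_interior C \<noteq> {}"
    using rel_interior_represent[OF C(1)] by blast
qed

lemma rel_point_functionals:
  assumes "subspace (S :: 'v::euclidean_space set)" "C \<subseteq> dual_space S" "convex C" "C \<noteq> {}"
  shows "rel_point C \<in> intrinsic_core C"
  using rel_interior_functionals[OF assms(1-3)] assms(4) some_in_eq[of "rel_interior C"]
  unfolding rel_point_def by auto

lemma rel_point_core:
  assumes "convex (C :: 'v::euclidean_space set)" "C \<noteq> {}"
  shows "rel_point C \<in> intrinsic_core C"
  using rel_interior_eq_core[OF assms(1)] rel_interior_eq_empty[OF assms(1)] assms(2)
    some_in_eq[of "rel_interior C"]
  unfolding rel_point_def by auto


section \<open>The pairing of a polytope with its functionals\<close>

definition maximal_at :: "'v::real_vector set \<Rightarrow> 'v set \<Rightarrow> 'v \<Rightarrow> ('v \<Rightarrow> real) \<Rightarrow> bool" where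
  "maximal_at V P x \<phi> \<longleftrightarrow> x \<in> P \<and> \<phi> \<in> dual_space V \<and> (\<forall>y\<in>P. \<phi> (y - x) \<le> 0)"

lemma polytope_Times: "\<lbrakk>polytope S; polytope T\<rbrakk> \<Longrightarrow> polytope (S \<times> T)"
  unfolding polytope_def by (metis convex_hull_Times finite_cartesian_product)

lemma polyhedron_face_containing:
  assumes S: "polyhedron (S :: 'v::euclidean_space set)" and x: "x \<in> S"
  obtains F where "F face_of S" "x \<in> rel_interior F"
proof -
  define F where "F = \<Inter>{F. F face_of S \<and> x \<in> F}"
  have SS: "S \<in> {F. F face_of S \<and> x \<in> F}"
    using x S by (simp add: face_of_refl polyhedron_imp_convex)
  have F: "F face_of S"
    unfolding F_def by (rule face_of_Inter) (use SS in auto)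
  have xF: "x \<in> F" by (simp add: F_def)
  have pF: "polyhedron F" using face_of_polyhedron_polyhedron[OF S F] .
  have "x \<in> rel_interior F"
  proof (rule ccontr)
    assume "x \<notin> rel_interior F"
    then have "x \<in> rel_frontier F"
      using xF closure_subset by (auto simp: rel_frontier_def)
    then obtain G where G: "G face_of F" "G \<noteq> F" "x \<in> G"
      unfolding rel_frontier_of_polyhedron_alt[OF pF] by blast
    then have "F \<subseteq> G" using face_of_trans[OF G(1) F] by (auto simp: F_def)
    then show False using G face_of_imp_subset by blast
  qed
  then show ?thesis using that F by blast
qed

locale polytope_projection =
  fixes p :: "'v::euclidean_space \<Rightarrow> 'w::euclidean_space" and V P :: "'v set"
  assumes V: "subspace V" and linp: "linear p" and P: "polytope P" "P \<subseteq> V" "P \<noteq> {}"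
begin

abbreviation (input) K where "K \<equiv> ker p V"
abbreviation (input) r where "r \<equiv> proj_dual p V"
abbreviation (input) I where "I \<equiv> maximal_at V P"

lemma K: "subspace K" "K \<subseteq> V"
  using V linp by (auto simp: ker_def subspace_def linear_add linear_scale linear_0)

lemma maximal_at_iff: "I x \<phi> \<longleftrightarrow> x \<in> P \<and> \<phi> \<in> dual_space V \<and> (\<forall>y\<in>P. \<phi> y \<le> \<phi> x)"
  unfolding maximal_at_def using dual_space_diff[OF _ V] P(2) by (metis diff_le_0_iff_le subsetD)

lemma functional_segment:
  assumes "\<phi> \<in> dual_space V" "x \<in> V" "y \<in> V"
  shows "\<phi> (a *\<^sub>R x + b *\<^sub>R y) = a * \<phi> x + b * \<phi> y"
  using dual_spaceD[OF assms(1)] assms V by (simp add: subspace_scale)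

lemma r_in: "\<phi> \<in> dual_space V \<Longrightarrow> r \<phi> \<in> dual_space K"
  unfolding proj_dual_def using dual_restrict_dual_space K by blast

lemma linr: "linear r"
  unfolding proj_dual_def by (rule linear_dual_restrict)

lemma r_apply: "z \<in> K \<Longrightarrow> r \<phi> z = \<phi> z"
  by (simp add: proj_dual_def dual_restrict_def)

lemma fiber_diff: "\<lbrakk>x \<in> P; y \<in> P; p x = p y\<rbrakk> \<Longrightarrow> x - y \<in> K"
  using P(2) V linp by (auto simp: ker_def linear_diff intro: subspace_diff)

lemma exposed_face:
  assumes "\<phi> \<in> dual_space V"
  shows "{x. I x \<phi>} face_of P" "{x. I x \<phi>} \<noteq> {}"
proof -
  obtain u where u: "u \<in> V" "\<And>x. x \<in> V \<Longrightarrow> \<phi> x = u \<bullet> x"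
    using dual_space_riesz[OF V assms] by blast
  have "compact P" using P polytope_imp_compact by blast
  then obtain x where x: "x \<in> P" "\<And>y. y \<in> P \<Longrightarrow> u \<bullet> y \<le> u \<bullet> x"
    using continuous_attains_sup[of P "inner u"] P(3) continuous_on_inner[OF continuous_on_const continuous_on_id]
    by blast
  have eq: "{x. I x \<phi>} = P \<inter> {y. u \<bullet> y = u \<bullet> x}"
    using u(2) P(2) x assms unfolding maximal_at_iff by (auto simp: subset_iff intro: antisym)
  show "{x. I x \<phi>} face_of P"
    unfolding eq by (rule face_of_Int_supporting_hyperplane_le)
      (use x P polytope_imp_convex in auto)
  show "{x. I x \<phi>} \<noteq> {}" using eq x by blast
qed

lemma face_exposed:
  assumes F: "F face_of P" "F \<noteq> {}"
  obtains \<phi> where "\<phi> \<in> dual_space V" "F = {x. I x \<phi>}"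
proof -
  have "F exposed_face_of P"
    using exposed_face_of_polyhedron P(1) polytope_imp_polyhedron F(1) by blast
  then obtain a b where ab: "P \<subseteq> {x. a \<bullet> x \<le> b}" "F = P \<inter> {x. a \<bullet> x = b}"
    by (auto simp: exposed_face_of_def)
  define \<phi> where "\<phi> = dual_restrict V (inner a)"
  have \<phi>: "\<phi> \<in> dual_space V" using dual_restrict_inner[OF V] by (simp add: \<phi>_def)
  have val: "\<And>x. x \<in> P \<Longrightarrow> \<phi> x = a \<bullet> x" using P(2) by (auto simp: \<phi>_def dual_restrict_def)
  obtain z where "z \<in> P" "a \<bullet> z = b" using ab F(2) by blast
  then have "F = {x. I x \<phi>}"
    using ab \<phi> unfolding maximal_at_iff by (auto simp: val intro!: antisym)
  then show ?thesis using that \<phi> by blast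
qed

lemma faces_eq: "faces P = (\<lambda>\<phi>. {x. I x \<phi>}) ` dual_space V"
proof (intro equalityI subsetI)
  fix F assume "F \<in> faces P"
  then obtain \<phi> where "\<phi> \<in> dual_space V" "F = {x. I x \<phi>}"
    using face_exposed[of F] unfolding faces_def by blast
  then show "F \<in> (\<lambda>\<phi>. {x. I x \<phi>}) ` dual_space V" by blast
next
  fix F assume "F \<in> (\<lambda>\<phi>. {x. I x \<phi>}) ` dual_space V"
  then obtain \<phi> where "\<phi> \<in> dual_space V" "F = {x. I x \<phi>}" by blast
  then show "F \<in> faces P"
    unfolding faces_def using exposed_face[of \<phi>] by simp
qed

lemma strict_if_rel_interior:
  assumes "\<phi> \<in> dual_space V" "x \<in> rel_interior {z. I z \<phi>}"
  shows "strict_pair I x \<phi>"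
proof -
  have cvx: "convex {z. I z \<phi>}" using exposed_face(1)[OF assms(1)] face_of_imp_convex by blast
  then have core: "x \<in> intrinsic_core {z. I z \<phi>}" using assms rel_interior_eq_core by metis
  have x: "I x \<phi>" using assms rel_interior_subset by blast
  have "I z \<phi>'" if z: "I x \<phi>'" "I z \<phi>" for z \<phi>'
  proof -
    obtain y t where y: "I y \<phi>" "0 < t" "t < 1" "x = (1 - t) *\<^sub>R z + t *\<^sub>R y"
      using intrinsic_core_between[OF core, of z] z by blast
    have "\<phi>' x = (1 - t) * \<phi>' z + t * \<phi>' y"
      using functional_segment[of \<phi>' z y "1 - t" t] y z P(2) unfolding maximal_at_iff by auto
    moreover have "t * \<phi>' y \<le> t * \<phi>' x" using z y by (simp add: maximal_at_iff)
    ultimately have "(1 - t) * \<phi>' x \<le> (1 - t) * \<phi>' z" by (simp add: algebra_simps)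
    then have "\<phi>' x \<le> \<phi>' z" using y by simp
    then show ?thesis using z unfolding maximal_at_iff by (auto intro: order_trans)
  qed
  then show ?thesis using x by (auto simp: strict_pair_def)
qed

lemma rel_interior_partner:
  assumes "x \<in> P"
  obtains \<phi> where "\<phi> \<in> dual_space V" "x \<in> rel_interior {z. I z \<phi>}"
proof -
  obtain F where F: "F face_of P" "x \<in> rel_interior F"
    using polyhedron_face_containing[OF polytope_imp_polyhedron[OF P(1)] assms] .
  then have "F \<noteq> {}" by auto
  obtain \<phi> where "\<phi> \<in> dual_space V" "F = {z. I z \<phi>}"
    using face_exposed[OF F(1) \<open>F \<noteq> {}\<close>] .
  then show ?thesis using F(2) that by simp
qed

lemma strict_iff_rel_interior:
  assumes "\<phi> \<in> dual_space V"
  shows "strict_pair I x \<phi> \<longleftrightarrow> x \<in> rel_interior {z. I z \<phi>}"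
proof
  assume s: "strict_pair I x \<phi>"
  then have x: "I x \<phi>" by (rule strict_pair_incident)
  then obtain \<phi>' where \<phi>': "\<phi>' \<in> dual_space V" "x \<in> rel_interior {z. I z \<phi>'}"
    using rel_interior_partner[of x] unfolding maximal_at_iff by blast
  have s': "strict_pair I x \<phi>'" using strict_if_rel_interior[OF \<phi>'] .
  have "{z. I z \<phi>} = {z. I z \<phi>'}"
    using strict_pair_subset[of I x \<phi> \<phi>', OF s strict_pair_incident[OF s']]
      strict_pair_subset[of I x \<phi>' \<phi>, OF s' x] by simp
  then show "x \<in> rel_interior {z. I z \<phi>}" using \<phi>' by simp
qed (rule strict_if_rel_interior[OF assms])

text \<open>Strict complementarity: maximising \<open>\<psi>\<close> on the fiber over \<open>q\<close> means going as far up as possible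
  over \<open>q\<close> in the polytope \<open>{(p x, \<psi> x) | x \<in> P}\<close>. Adding a vertical segment below it makes every
  functional exposing the smallest face through the highest point nonnegative in the vertical
  direction, and the maximality makes it positive. After scaling it is the required functional on \<open>P\<close>.\<close>

lemma strict_complementarity:
  assumes q: "q \<in> p ` P" and \<psi>: "\<psi> \<in> dual_space K"
  shows "\<exists>x \<phi>. strict_pair I x \<phi> \<and> p x = q \<and> r \<phi> = \<psi>"
proof -
  obtain u where u: "u \<in> K" "\<And>z. z \<in> K \<Longrightarrow> \<psi> z = u \<bullet> z"
    using dual_space_riesz[OF K(1) \<psi>] by blast
  define g where "g x = (p x, u \<bullet> x)" for x
  have ling: "linear g"
    using linp by (intro linearI) (auto simp: g_def linear_add linear_scale inner_add_right)
  define e :: "'w \<times> real" where "e = (0, 1)"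
  define h where "h y = g (fst y) - snd y *\<^sub>R e" for y
  define R where "R = h ` (P \<times> cbox 0 1)"
  have "linear h"
    using ling by (intro linearI) (auto simp: h_def linear_add linear_scale algebra_simps)
  then have R: "polytope R"
    unfolding R_def using polytope_Times[OF P(1) polytope_interval] by (rule polytope_linear_image)
  have gR: "g x - s *\<^sub>R e \<in> R" if "x \<in> P" "0 \<le> s" "s \<le> 1" for x s
    unfolding R_def using that by (intro image_eqI[of _ _ "(x, s)"]) (auto simp: h_def)
  have Rg: "\<exists>x s. x \<in> P \<and> 0 \<le> s \<and> z = g x - s *\<^sub>R e" if "z \<in> R" for z
    using that unfolding R_def h_def by auto blast
  have cfib: "compact (fiber p P q)"
    unfolding fiber_def
    using polytope_imp_compact[OF P(1)] linear_continuous_on linp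
    by (intro compact_Int_closed closed_vimage) (auto simp: linear_conv_bounded_linear)
  obtain x0 where x0: "x0 \<in> P" "p x0 = q" "\<And>y. \<lbrakk>y \<in> P; p y = q\<rbrakk> \<Longrightarrow> u \<bullet> y \<le> u \<bullet> x0"
    using continuous_attains_sup[OF cfib _ continuous_on_inner[OF continuous_on_const continuous_on_id], of u] q
    by (auto simp: fiber_def)
  have y: "g x0 \<in> R" using gR[of x0 0] x0 by simp
  obtain E where E: "E face_of R" "g x0 \<in> rel_interior E"
    using polyhedron_face_containing[OF polytope_imp_polyhedron[OF R] y] .
  have yE: "g x0 \<in> E" using E rel_interior_subset by blast
  have "E exposed_face_of R"
    using exposed_face_of_polyhedron R polytope_imp_polyhedron E(1) by blast
  then obtain a b where ab: "R \<subseteq> {z. a \<bullet> z \<le> b}" "E = R \<inter> {z. a \<bullet> z = b}"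
    by (auto simp: exposed_face_of_def)
  obtain w t where a: "a = (w, t)" by (cases a)
  have aE: "a \<bullet> (g x - s *\<^sub>R e) = a \<bullet> g x - s * t" for x s
    by (simp add: a e_def inner_diff_right)
  have y1: "g x0 - 1 *\<^sub>R e \<in> R" using gR[of x0 1] x0 by simp
  have t0: "t \<ge> 0"
    using ab y1 yE aE[of x0 1] by auto
  moreover have "t \<noteq> 0"
  proof
    assume "t = 0"
    then have yE': "g x0 - 1 *\<^sub>R e \<in> E" using ab y1 yE aE[of x0 1] by auto
    have "g x0 \<in> intrinsic_core E"
      using E rel_interior_eq_core face_of_imp_convex by metis
    then obtain d where d: "d > 0" "g x0 + d *\<^sub>R (g x0 - (g x0 - 1 *\<^sub>R e)) \<in> E"
      using yE' unfolding intrinsic_core_def by blast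
    then have "g x0 + d *\<^sub>R e \<in> R" using ab by auto
    then obtain x s where x: "x \<in> P" "0 \<le> s" "g x0 + d *\<^sub>R e = g x - s *\<^sub>R e" using Rg by blast
    then have "p x = q" "u \<bullet> x0 + d = u \<bullet> x - s" using x0 by (auto simp: g_def e_def)
    then show False using x0(3)[OF x(1)] x d by simp
  qed
  ultimately have t: "t > 0" by simp
  define v where "v x = (w \<bullet> p x) / t + u \<bullet> x" for x
  define \<phi> where "\<phi> = dual_restrict V v"
  have vt: "t * v x = a \<bullet> g x" for x
    using t by (simp add: v_def a g_def field_simps)
  have \<phi>: "\<phi> \<in> dual_space V"
    using linp V unfolding \<phi>_def dual_space_def dual_restrict_def v_def
    by (auto simp: linear_add linear_scale inner_add_right subspace_add subspace_scale
        add_divide_distrib algebra_simps)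
  have val: "\<phi> x = v x" if "x \<in> P" for x using P(2) that by (auto simp: \<phi>_def dual_restrict_def)
  have r\<phi>: "r \<phi> = \<psi>"
  proof
    fix z
    show "r \<phi> z = \<psi> z"
    proof (cases "z \<in> K")
      case True
      then show ?thesis using u(2) K(2)
        by (auto simp: r_apply \<phi>_def dual_restrict_def v_def ker_def)
    next
      case False
      then show ?thesis using dual_spaceD(3)[OF \<psi>] by (simp add: proj_dual_def dual_restrict_def)
    qed
  qed
  have leb: "a \<bullet> g x \<le> b" if "x \<in> P" for x using gR[of x 0] that ab by auto
  have inE: "g x \<in> E \<longleftrightarrow> a \<bullet> g x = b" if "x \<in> P" for x using gR[of x 0] that ab by auto
  have face: "I x \<phi> \<longleftrightarrow> x \<in> P \<and> g x \<in> E" for x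
  proof -
    have le: "\<phi> y \<le> \<phi> x \<longleftrightarrow> a \<bullet> g y \<le> a \<bullet> g x" if "x \<in> P" "y \<in> P" for x y
      using t val[OF that(1)] val[OF that(2)] vt[of x] vt[of y] by (metis mult_le_cancel_left_pos)
    have "a \<bullet> g x0 = b" using inE x0 yE by blast
    then have "(\<forall>y\<in>P. \<phi> y \<le> \<phi> x) \<longleftrightarrow> a \<bullet> g x = b" if "x \<in> P" for x
      using le[OF that] leb x0(1) that by (metis antisym)
    then show ?thesis unfolding maximal_at_iff using \<phi> inE by blast
  qed
  have gE: "g ` {x. I x \<phi>} = E"
  proof
    show "g ` {x. I x \<phi>} \<subseteq> E" using face by auto
    show "E \<subseteq> g ` {x. I x \<phi>}"
    proof
      fix z assume z: "z \<in> E"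
      then obtain x s where x: "x \<in> P" "0 \<le> s" "z = g x - s *\<^sub>R e" using Rg ab by blast
      have "a \<bullet> g x - s * t = b" using z ab aE x by auto
      then have "s * t \<le> 0" using leb[OF x(1)] by linarith
      then have "s = 0" using t x(2) by (metis antisym mult_le_0_iff not_less)
      then have "z = g x" using x by simp
      then show "z \<in> g ` {x. I x \<phi>}" using face x z by blast
    qed
  qed
  have "g x0 \<in> g ` rel_interior {x. I x \<phi>}"
    using rel_interior_convex_linear_image[OF ling, of "{x. I x \<phi>}"] gE E(2)
      face_of_imp_convex[OF exposed_face(1)[OF \<phi>]] by simp
  then obtain x where "x \<in> rel_interior {x. I x \<phi>}" "g x = g x0" by auto
  then have "strict_pair I x \<phi>" "p x = q"
    using strict_if_rel_interior[OF \<phi>] x0 by (auto simp: g_def)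
  then show ?thesis using r\<phi> by blast
qed

end


context polytope_projection
begin

text \<open>On a fiber a functional and its restriction to the kernel differ by a constant only.\<close>

lemma fiber_functionals:
  assumes \<phi>: "I x \<phi>"
  shows "max_face (r \<phi>) (fiber p P (p x)) = {z. I z \<phi> \<and> p z = p x}"
proof -
  have "r \<phi> (y - z) \<le> 0 \<longleftrightarrow> \<phi> y \<le> \<phi> z" if yz: "y \<in> P" "z \<in> P" "p y = p z" for y z
    using r_apply[OF fiber_diff[OF yz]] dual_space_diff[OF _ V, of \<phi> y z] yz \<phi> P(2)
    unfolding maximal_at_iff by (auto simp: subset_iff)
  then have "max_face (r \<phi>) (fiber p P (p x)) =
      {z \<in> P. p z = p x \<and> (\<forall>y\<in>P. p y = p x \<longrightarrow> \<phi> y \<le> \<phi> z)}"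
    unfolding max_face_def fiber_def by auto
  also have "\<dots> = {z. I z \<phi> \<and> p z = p x}"
    using \<phi> unfolding maximal_at_iff by (blast intro: order_trans)
  finally show ?thesis .
qed

text \<open>Linear programming duality: a functional on the kernel that is maximal at \<open>x\<close> on the fiber extends
  to one that is maximal at \<open>x\<close> on the whole polytope.\<close>

lemma functionals_of_point:
  assumes x: "x \<in> P"
  shows "r ` {\<phi>. I x \<phi>} = {\<psi> \<in> dual_space K. \<forall>y\<in>fiber p P (p x). \<psi> (y - x) \<le> 0}"
proof (intro equalityI subsetI)
  fix \<psi> assume "\<psi> \<in> r ` {\<phi>. I x \<phi>}"
  then obtain \<phi> where \<phi>: "I x \<phi>" "\<psi> = r \<phi>" by auto
  have "x \<in> max_face (r \<phi>) (fiber p P (p x))" using fiber_functionals[OF \<phi>(1)] \<phi>(1) by simp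
  then show "\<psi> \<in> {\<psi> \<in> dual_space K. \<forall>y\<in>fiber p P (p x). \<psi> (y - x) \<le> 0}"
    using r_in \<phi> by (auto simp: max_face_def maximal_at_def)
next
  fix \<psi> assume \<psi>: "\<psi> \<in> {\<psi> \<in> dual_space K. \<forall>y\<in>fiber p P (p x). \<psi> (y - x) \<le> 0}"
  then obtain y \<phi> where y: "strict_pair I y \<phi>" "p y = p x" "r \<phi> = \<psi>"
    using strict_complementarity[of "p x" \<psi>] x by auto
  have "x \<in> max_face (r \<phi>) (fiber p P (p y))" using \<psi> x y by (auto simp: max_face_def fiber_def)
  then have "I x \<phi>" using fiber_functionals[OF strict_pair_incident[OF y(1)]] by blast
  then show "\<psi> \<in> r ` {\<phi>. I x \<phi>}" using y by auto
qed

lemma shadow_points: "shadow I p = p ` P"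
proof -
  have "\<exists>\<phi>. I x \<phi>" if "x \<in> P" for x
    using rel_interior_partner[OF that] rel_interior_subset by blast
  then have "{x. \<exists>\<phi>. I x \<phi>} = P" by (auto simp: maximal_at_def)
  then show ?thesis by (simp add: shadow_def)
qed

lemma shadow_functionals: "shadow (\<lambda>\<phi> x. I x \<phi>) r = dual_space K"
proof (intro equalityI subsetI)
  fix \<psi> assume "\<psi> \<in> shadow (\<lambda>\<phi> x. I x \<phi>) r"
  then show "\<psi> \<in> dual_space K" using r_in by (auto simp: shadow_def maximal_at_def)
next
  fix \<psi> assume \<psi>: "\<psi> \<in> dual_space K"
  obtain x0 where "x0 \<in> P" using P(3) by blast
  then obtain x \<phi> where "strict_pair I x \<phi>" "r \<phi> = \<psi>"
    using strict_complementarity[OF imageI \<psi>] by blast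
  then show "\<psi> \<in> shadow (\<lambda>\<phi> x. I x \<phi>) r"
    using strict_pair_incident unfolding shadow_def by fastforce
qed

lemma closed_affine_trace:
  assumes "closed A"
  shows "closed {t \<in> {0..1}. (1 - t) *\<^sub>R a + t *\<^sub>R b \<in> (A :: 'w set)}"
proof -
  have "{t \<in> {0..1}. (1 - t) *\<^sub>R a + t *\<^sub>R b \<in> A} = {0..1} \<inter> (\<lambda>t. (1 - t) *\<^sub>R a + t *\<^sub>R b) -` A"
    by auto
  moreover have "closed ({0..1::real} \<inter> (\<lambda>t. (1 - t) *\<^sub>R a + t *\<^sub>R b) -` A)"
    by (intro closed_Int closed_vimage assms continuous_intros)
  ultimately show ?thesis by simp
qed

lemma pairing_side_points: "pairing_side I p"
proof (intro pairing_side.intro)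
  show "linear p" by (rule linp)
next
  fix x y \<phi> and t :: real
  assume a: "I x \<phi>" "I y \<phi>" "0 \<le> t" "t \<le> 1"
  have "{z. I z \<phi>} face_of P" using exposed_face(1)[of \<phi>] a by (simp add: maximal_at_def)
  then have "convex {z. I z \<phi>}" by (rule face_of_imp_convex)
  then show "I ((1 - t) *\<^sub>R x + t *\<^sub>R y) \<phi>" using a by (auto simp: convex_alt)
next
  fix x y \<phi> \<phi>' and t :: real
  assume a: "I x \<phi>" "I y \<phi>" "0 \<le> t" "t < 1" "I ((1 - t) *\<^sub>R x + t *\<^sub>R y) \<phi>'"
  let ?z = "(1 - t) *\<^sub>R x + t *\<^sub>R y"
  have "\<phi>' ?z = (1 - t) * \<phi>' x + t * \<phi>' y"
    using functional_segment[of \<phi>' x y] a P(2) unfolding maximal_at_iff by auto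
  moreover have "t * \<phi>' y \<le> t * \<phi>' ?z" using a by (simp add: maximal_at_iff mult_left_mono)
  ultimately have "(1 - t) * \<phi>' ?z \<le> (1 - t) * \<phi>' x" by (simp add: left_diff_distrib)
  then have le: "\<phi>' ?z \<le> \<phi>' x" using a(4) by simp
  have "\<phi>' w \<le> \<phi>' x" if "w \<in> P" for w
    using order_trans[OF _ le, of "\<phi>' w"] a(5) that by (simp add: maximal_at_iff)
  then show "I x \<phi>'" using a(1,5) by (simp add: maximal_at_iff)
next
  fix x \<phi> assume "I x \<phi>"
  then have "x \<in> P" by (simp add: maximal_at_def)
  then obtain \<phi>' where "\<phi>' \<in> dual_space V" "x \<in> rel_interior {z. I z \<phi>'}"
    by (rule rel_interior_partner)
  then have "strict_pair I x \<phi>'" by (rule strict_if_rel_interior)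
  then show "\<exists>\<phi>'. strict_pair I x \<phi>'" by blast
next
  fix x y \<phi> assume s: "strict_pair I x \<phi>" and y: "I y \<phi>"
  have \<phi>: "\<phi> \<in> dual_space V" using y by (simp add: maximal_at_def)
  have "x \<in> intrinsic_core {z. I z \<phi>}"
    using s strict_iff_rel_interior[OF \<phi>] rel_interior_eq_core face_of_imp_convex[OF exposed_face(1)[OF \<phi>]]
    by blast
  then show "\<exists>e>0. I (x + e *\<^sub>R (x - y)) \<phi>" using y by (auto simp: intrinsic_core_def)
next
  have "range (\<lambda>\<phi>. {x. I x \<phi>}) \<subseteq> insert {} {F. F face_of P}"
  proof
    fix F assume "F \<in> range (\<lambda>\<phi>. {x. I x \<phi>})"
    then obtain \<phi> where F: "F = {x. I x \<phi>}" by blast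
    show "F \<in> insert {} {F. F face_of P}"
      using exposed_face(1)[of \<phi>] unfolding F by (cases "\<phi> \<in> dual_space V") (auto simp: maximal_at_def)
  qed
  then show "finite (range (\<lambda>\<phi>. {x. I x \<phi>}))"
    using finite_polytope_faces[OF P(1)] finite_subset by blast
next
  fix x \<phi> q q' assume "I x \<phi>"
  then have "{z. I z \<phi>} face_of P" using exposed_face(1)[of \<phi>] by (simp add: maximal_at_def)
  then have "polytope (p ` {z. I z \<phi>})"
    using face_of_polytope_polytope[OF P(1)] polytope_linear_image[OF linp] by blast
  then show "closed {t \<in> {0..1}. (1 - t) *\<^sub>R q + t *\<^sub>R q' \<in> p ` {x. I x \<phi>}}"
    by (intro closed_affine_trace polytope_imp_closed)
next
  fix T :: "'w set" assume "convex T" "T \<noteq> {}"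
  then show "intrinsic_core T \<noteq> {}" using rel_point_core by blast
qed

lemma pairing_side_functionals: "pairing_side (\<lambda>\<phi> x. I x \<phi>) r"
proof (intro pairing_side.intro)
  show "linear r" by (rule linr)
next
  fix \<phi> \<psi> x and t :: real
  assume a: "I x \<phi>" "I x \<psi>" "0 \<le> t" "t \<le> 1"
  have "(1 - t) *\<^sub>R \<phi> + t *\<^sub>R \<psi> \<in> dual_space V"
    using a subspace_dual_space[of V] by (auto simp: maximal_at_def intro!: subspace_add subspace_scale)
  moreover have "(1 - t) * \<phi> y + t * \<psi> y \<le> (1 - t) * \<phi> x + t * \<psi> x" if "y \<in> P" for y
    using a that by (intro add_mono mult_left_mono) (auto simp: maximal_at_iff)
  ultimately show "I x ((1 - t) *\<^sub>R \<phi> + t *\<^sub>R \<psi>)"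
    using a by (auto simp: maximal_at_iff)
next
  fix \<phi> \<psi> x y and t :: real
  assume a: "I x \<phi>" "I x \<psi>" "0 \<le> t" "t < 1" "I y ((1 - t) *\<^sub>R \<phi> + t *\<^sub>R \<psi>)"
  have "(1 - t) * \<phi> x + t * \<psi> x \<le> (1 - t) * \<phi> y + t * \<psi> y" using a by (auto simp: maximal_at_iff)
  moreover have "t * \<psi> y \<le> t * \<psi> x" using a by (simp add: maximal_at_iff mult_left_mono)
  ultimately have "(1 - t) * \<phi> x \<le> (1 - t) * \<phi> y" by linarith
  then have le: "\<phi> x \<le> \<phi> y" using a(4) by simp
  have "\<phi> w \<le> \<phi> y" if "w \<in> P" for w
    using order_trans[OF _ le, of "\<phi> w"] a(1) that by (simp add: maximal_at_iff)
  then show "I y \<phi>" using a(1,5) by (simp add: maximal_at_iff)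
next
  fix \<phi> x assume "I x \<phi>"
  then have \<phi>: "\<phi> \<in> dual_space V" by (simp add: maximal_at_def)
  have "rel_interior {z. I z \<phi>} \<noteq> {}"
    using exposed_face[OF \<phi>] face_of_imp_convex rel_interior_eq_empty by blast
  then obtain x' where "x' \<in> rel_interior {z. I z \<phi>}" by blast
  then have "strict_pair I x' \<phi>" by (rule strict_if_rel_interior[OF \<phi>])
  then show "\<exists>x'. strict_pair (\<lambda>\<phi> x. I x \<phi>) \<phi> x'" using strict_pair_dual[of I] by blast
next
  fix \<phi> \<psi> x assume "strict_pair (\<lambda>\<phi> x. I x \<phi>) \<phi> x" and \<psi>: "I x \<psi>"
  then have s: "strict_pair I x \<phi>" using strict_pair_dual[of I] by blast
  then have x: "I x \<phi>" by (rule strict_pair_incident)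
  obtain S where S: "finite S" "P = convex hull S" using P(1) by (auto simp: polytope_def)
  \<comment> \<open>It suffices to control the finitely many vertices; those outside the face of \<open>\<phi>\<close> leave some room.\<close>
  have "\<forall>\<^sub>F e in at_right 0. \<phi> v + e * (\<phi> v - \<psi> v) \<le> \<phi> x + e * (\<phi> x - \<psi> x)" if v: "v \<in> S" for v
  proof (cases "I v \<phi>")
    case True
    then have "I v \<psi>" using s \<psi> strict_pairD[of I] by blast
    then have "\<phi> v = \<phi> x" "\<psi> v = \<psi> x"
      using True x \<psi> unfolding maximal_at_iff by (meson antisym)+
    then show ?thesis by simp
  next
    case False
    have "v \<in> P" using v S hull_inc by metis
    then have lt: "\<phi> v < \<phi> x"
      using False x unfolding maximal_at_iff by (meson not_le order_trans)
    have "((\<lambda>e. (\<phi> x + e * (\<phi> x - \<psi> x)) - (\<phi> v + e * (\<phi> v - \<psi> v))) \<longlongrightarrow>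
        (\<phi> x + 0 * (\<phi> x - \<psi> x)) - (\<phi> v + 0 * (\<phi> v - \<psi> v))) (at_right 0)"
      by (intro tendsto_intros)
    then have "\<forall>\<^sub>F e in at_right 0. 0 < (\<phi> x + e * (\<phi> x - \<psi> x)) - (\<phi> v + e * (\<phi> v - \<psi> v))"
      by (rule order_tendstoD(1)) (use lt in simp)
    then show ?thesis by eventually_elim simp
  qed
  then have "\<forall>\<^sub>F e in at_right 0. \<forall>v\<in>S. \<phi> v + e * (\<phi> v - \<psi> v) \<le> \<phi> x + e * (\<phi> x - \<psi> x)"
    using S(1) by (simp add: eventually_ball_finite)
  moreover have "\<forall>\<^sub>F e in at_right (0::real). 0 < e" by (simp add: eventually_at_right_less)
  ultimately have "\<forall>\<^sub>F e in at_right (0::real). 0 < e \<and>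
      (\<forall>v\<in>S. \<phi> v + e * (\<phi> v - \<psi> v) \<le> \<phi> x + e * (\<phi> x - \<psi> x))"
    by eventually_elim simp
  then obtain e :: real where e: "0 < e"
      "\<forall>v\<in>S. \<phi> v + e * (\<phi> v - \<psi> v) \<le> \<phi> x + e * (\<phi> x - \<psi> x)"
    using eventually_happens' trivial_limit_at_right_real by blast
  define \<theta> where "\<theta> = \<phi> + e *\<^sub>R (\<phi> - \<psi>)"
  have d: "\<theta> \<in> dual_space V"
    using x \<psi> subspace_dual_space[of V] unfolding \<theta>_def
    by (auto simp: maximal_at_def intro!: subspace_add subspace_scale subspace_diff)
  obtain u where u: "\<And>z. z \<in> V \<Longrightarrow> \<theta> z = u \<bullet> z" using dual_space_riesz[OF V d] by blast
  have SV: "S \<subseteq> V" using S P(2) hull_subset[of S convex] by blast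
  have xV: "x \<in> V" using x P(2) by (auto simp: maximal_at_def)
  have "S \<subseteq> {z. u \<bullet> z \<le> u \<bullet> x}"
  proof
    fix v assume v: "v \<in> S"
    then have "\<theta> v \<le> \<theta> x" using e by (simp add: \<theta>_def)
    then show "v \<in> {z. u \<bullet> z \<le> u \<bullet> x}" using u v SV xV by auto
  qed
  then have "P \<subseteq> {z. u \<bullet> z \<le> u \<bullet> x}"
    unfolding S(2) by (intro hull_minimal convex_halfspace_le)
  then have "\<theta> y \<le> \<theta> x" if "y \<in> P" for y
    using that u xV P(2) by (simp add: subset_iff)
  then have "I x \<theta>" using x d by (simp add: maximal_at_iff)
  then show "\<exists>e>0. I x (\<phi> + e *\<^sub>R (\<phi> - \<psi>))" using e(1) unfolding \<theta>_def by blast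
next
  have "range (\<lambda>x. {\<phi>. I x \<phi>}) \<subseteq>
      insert {} ((\<lambda>F. {\<phi>. \<forall>z\<in>F. I z \<phi>}) ` range (\<lambda>\<phi>. {x. I x \<phi>}))"
  proof
    fix C assume "C \<in> range (\<lambda>x. {\<phi>. I x \<phi>})"
    then obtain x where C: "C = {\<phi>. I x \<phi>}" by blast
    show "C \<in> insert {} ((\<lambda>F. {\<phi>. \<forall>z\<in>F. I z \<phi>}) ` range (\<lambda>\<phi>. {x. I x \<phi>}))"
    proof (cases "\<exists>\<phi>. I x \<phi>")
      case True
      then obtain \<phi> where s: "strict_pair I x \<phi>"
        using pairing_side.partner[OF pairing_side_points] by blast
      have "C = {\<phi>'. \<forall>z\<in>{z. I z \<phi>}. I z \<phi>'}"
        unfolding C using s by (auto simp: strict_pair_def)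
      then show ?thesis by blast
    qed (use C in simp)
  qed
  then show "finite (range (\<lambda>x. {\<phi>. I x \<phi>}))"
    using pairing_side.finite_faces[OF pairing_side_points] finite_subset by blast
next
  fix \<phi> x \<psi> \<psi>'
  assume x: "I x \<phi>" and \<psi>: "\<psi> \<in> shadow (\<lambda>\<phi> x. I x \<phi>) r" "\<psi>' \<in> shadow (\<lambda>\<phi> x. I x \<phi>) r"
  have "(1 - t) *\<^sub>R \<psi> + t *\<^sub>R \<psi>' \<in> dual_space K" for t
    using \<psi> subspace_dual_space[of K] unfolding shadow_functionals
    by (intro subspace_add subspace_scale)
  then have "{t \<in> {0..1}. (1 - t) *\<^sub>R \<psi> + t *\<^sub>R \<psi>' \<in> r ` {\<phi>. I x \<phi>}} =
      {0..1} \<inter> (\<Inter>y\<in>fiber p P (p x). {t. (1 - t) * \<psi> (y - x) + t * \<psi>' (y - x) \<le> 0})"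
    using functionals_of_point[of x] x by (auto simp: maximal_at_def)
  moreover have "closed ({0..1} \<inter> (\<Inter>y\<in>fiber p P (p x). {t. (1 - t) * \<psi> (y - x) + t * \<psi>' (y - x) \<le> 0}))"
    by (intro closed_Int closed_INT ballI closed_Collect_le continuous_intros)
  ultimately show "closed {t \<in> {0..1}. (1 - t) *\<^sub>R \<psi> + t *\<^sub>R \<psi>' \<in> r ` {\<phi>. I x \<phi>}}" by simp
next
  fix T assume T: "T \<subseteq> shadow (\<lambda>\<phi> x. I x \<phi>) r" "convex T" "T \<noteq> {}"
  then show "intrinsic_core T \<noteq> {}"
    using rel_point_functionals[OF K(1)] unfolding shadow_functionals by blast
qed

lemma pairing: "pairing I p r"
proof (intro pairing.intro pairing_axioms.intro pairing_side_points pairing_side_functionals)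
  fix x x' \<phi> \<phi>'
  assume a: "I x \<phi>" "I x' \<phi>'" "p x = p x'" "r \<phi> = r \<phi>'"

  have "x \<in> max_face (r \<phi>) (fiber p P (p x))" using fiber_functionals[OF a(1)] a(1) by simp
  then show "I x \<phi>'" using fiber_functionals[OF a(2)] a(3,4) by auto
next
  fix q \<psi> assume "q \<in> shadow I p" "\<psi> \<in> shadow (\<lambda>\<phi> x. I x \<phi>) r"
  then show "\<exists>x \<phi>. strict_pair I x \<phi> \<and> p x = q \<and> r \<phi> = \<psi>"
    using strict_complementarity unfolding shadow_points shadow_functionals by blast
qed

end


section \<open>Anti-isomorphisms\<close>

lemma anti_isomorphismI:
  assumes "poset_on A le" "bij_betw f A B" "\<And>x y. \<lbrakk>x \<in> A; y \<in> A\<rbrakk> \<Longrightarrow> le x y \<longleftrightarrow> le' (f y) (f x)"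
  shows "anti_isomorphism A le B le' f"
proof -
  have B: "B = f ` A" using assms(2) by (simp add: bij_betw_def)
  have le: "reflp_on A le" "transp_on A le" "antisymp_on A le"
    using assms(1) by (simp_all add: poset_on_def)
  have "reflp_on B le'"
    unfolding B using le(1) assms(3) by (simp add: reflp_on_def)
  moreover have "transp_on B le'"
  proof (rule transp_onI)
    fix u v w assume "u \<in> B" "v \<in> B" "w \<in> B" and uvw: "le' u v" "le' v w"
    then obtain x y z where x: "x \<in> A" "y \<in> A" "z \<in> A" "u = f x" "v = f y" "w = f z"
      unfolding B by blast
    then have "le y x" "le z y" using assms(3) uvw by simp_all
    then have "le z x" using transp_onD[OF le(2)] x by metis
    then show "le' u w" using assms(3) x by simp
  qed
  moreover have "antisymp_on B le'"
  proof (rule antisymp_onI)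
    fix u v assume "u \<in> B" "v \<in> B" and uv: "le' u v" "le' v u"
    then obtain x y where x: "x \<in> A" "y \<in> A" "u = f x" "v = f y"
      unfolding B by blast
    then have "le y x" "le x y" using assms(3) uv by simp_all
    then have "x = y" using antisymp_onD[OF le(3)] x by metis
    then show "u = v" using x by simp
  qed
  ultimately have "poset_on B le'" by (simp add: poset_on_def)
  then show ?thesis
    unfolding anti_isomorphism_def using assms by simp
qed

text \<open>Two posets with a common parametrisation that reverses the order are anti-isomorphic.\<close>

lemma anti_isomorphism_of_parametrization:
  assumes A: "A = a ` Z" "poset_on A le" and B: "B = b ` Z" "antisymp_on B le'"
    and iff: "\<And>z w. \<lbrakk>z \<in> Z; w \<in> Z\<rbrakk> \<Longrightarrow> le (a z) (a w) \<longleftrightarrow> le' (b w) (b z)"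
  shows "\<exists>g. anti_isomorphism A le B le' g \<and> (\<forall>z\<in>Z. g (a z) = b z)"
proof -
  have refl: "le (a z) (a z)" if "z \<in> Z" for z
    using A that by (auto simp: poset_on_def reflp_on_def)
  have eq: "a z = a w \<longleftrightarrow> b z = b w" if z: "z \<in> Z" "w \<in> Z" for z w
  proof
    assume "a z = a w"
    then have "le (a z) (a w)" "le (a w) (a z)" using refl z by auto
    then have "le' (b w) (b z)" "le' (b z) (b w)" using iff z by auto
    then show "b z = b w" using B z by (auto simp: antisymp_on_def)
  next
    assume "b z = b w"
    moreover have "le' (b z) (b z)" using iff[OF z(1) z(1)] refl z by simp
    ultimately have "le' (b w) (b z)" "le' (b z) (b w)" by simp_all
    then have "le (a z) (a w)" "le (a w) (a z)" using iff z by auto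
    then show "a z = a w" using A z by (auto simp: poset_on_def antisymp_on_def)
  qed
  define g where "g x = b (SOME z. z \<in> Z \<and> a z = x)" for x
  have g: "g (a z) = b z" if z: "z \<in> Z" for z
  proof -
    have "(SOME w. w \<in> Z \<and> a w = a z) \<in> Z \<and> a (SOME w. w \<in> Z \<and> a w = a z) = a z"
      by (rule someI[of _ z]) (use z in simp)
    then show ?thesis unfolding g_def using eq z by blast
  qed
  have "bij_betw g A B"
    unfolding bij_betw_def inj_on_def A(1) B(1) using g eq by (auto simp: image_iff)
  then have "anti_isomorphism A le B le' g"
    by (intro anti_isomorphismI A(2)) (use iff g in \<open>auto simp: A(1)\<close>)
  then show ?thesis using g by blast
qed

lemma poset_on_union_le:
  "(\<And>A B. \<lbrakk>A \<in> \<A>; B \<in> \<A>; \<Union>A = \<Union>B\<rbrakk> \<Longrightarrow> A = B) \<Longrightarrow> poset_on \<A> union_le"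
  unfolding poset_on_def reflp_on_def transp_on_def antisymp_on_def union_le_def
  by (meson subset_antisym subset_refl subset_trans)

lemma poset_on_mono: "\<lbrakk>poset_on B le; A \<subseteq> B\<rbrakk> \<Longrightarrow> poset_on A le"
  unfolding poset_on_def reflp_on_def transp_on_def antisymp_on_def by blast


section \<open>Cells, cones and faces through the pairing\<close>

context polytope_projection
begin

abbreviation (input) Q where "Q \<equiv> p ` P"
abbreviation (input) KD where "KD \<equiv> dual_space K"
abbreviation (input) fc where "fc \<equiv> face_over I p r"
abbreviation (input) nc where "nc \<equiv> face_over (\<lambda>\<phi> x. I x \<phi>) r p"
abbreviation (input) below where "below \<equiv> cell_le I p"
abbreviation (input) below' where "below' \<equiv> cell_le (\<lambda>\<phi> x. I x \<phi>) r"

lemma dual_pairing: "pairing (\<lambda>\<phi> x. I x \<phi>) r p"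
  using pairing by (rule pairing_dual)

lemma pair_over:
  assumes "q \<in> Q" "\<psi> \<in> KD"
  obtains x \<phi> where "strict_pair I x \<phi>" "p x = q" "r \<phi> = \<psi>" "I x \<phi>" "x \<in> P" "\<phi> \<in> dual_space V"
    "fc q \<psi> = {z. I z \<phi>}" "nc \<psi> q = {\<phi>. I x \<phi>}"
proof -
  obtain x \<phi> where s: "strict_pair I x \<phi>" "p x = q" "r \<phi> = \<psi>"
    using strict_complementarity assms by blast
  have s': "strict_pair (\<lambda>\<phi> x. I x \<phi>) \<phi> x" using s(1) strict_pair_dual[of I] by blast
  have i: "I x \<phi>" using s(1) by (rule strict_pair_incident)
  show ?thesis
    using that[OF s i] i pairing.face_over_strict[OF pairing s(1)]
      pairing.face_over_strict[OF dual_pairing s'] s by (simp add: maximal_at_def)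
qed

lemma normal_cone_exposed:
  assumes "\<phi> \<in> dual_space V"
  shows "normal_cone V P {z. I z \<phi>} = {\<phi>'. \<forall>z. I z \<phi> \<longrightarrow> I z \<phi>'}"
  using exposed_face(2)[OF assms] by (auto simp: normal_cone_def max_face_def maximal_at_def)

lemma normal_cone_strict:
  assumes "strict_pair I x \<phi>"
  shows "normal_cone V P {z. I z \<phi>} = {\<phi>'. I x \<phi>'}"
proof -
  have "\<phi> \<in> dual_space V" using strict_pair_incident[OF assms] by (simp add: maximal_at_def)
  then show ?thesis
    using assms unfolding normal_cone_exposed[OF \<open>\<phi> \<in> dual_space V\<close>] strict_pair_def by blast
qed

lemma normal_cone_face_over:
  assumes "q \<in> Q" "\<psi> \<in> KD"
  shows "normal_cone V P (fc q \<psi>) = nc \<psi> q"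
proof (rule pair_over[OF assms])
  fix x \<phi> assume "strict_pair I x \<phi>" "fc q \<psi> = {z. I z \<phi>}" "nc \<psi> q = {\<phi>. I x \<phi>}"
  then show ?thesis using normal_cone_strict by simp
qed

lemma normal_fan_eq: "normal_fan V P = (\<lambda>x. {\<phi>. I x \<phi>}) ` P"
proof (intro equalityI subsetI)
  fix C assume "C \<in> normal_fan V P"
  then obtain \<phi> where \<phi>: "\<phi> \<in> dual_space V" "C = normal_cone V P {z. I z \<phi>}"
    unfolding normal_fan_def faces_eq by blast
  obtain x0 where "I x0 \<phi>" using exposed_face(2)[OF \<phi>(1)] by blast
  then obtain x where "strict_pair (\<lambda>\<phi> x. I x \<phi>) \<phi> x"
    using pairing_side.partner[OF pairing_side_functionals] by blast
  then have s: "strict_pair I x \<phi>" using strict_pair_dual[of I] by blast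
  then have "x \<in> P" using strict_pair_incident[OF s] by (simp add: maximal_at_def)
  then show "C \<in> (\<lambda>x. {\<phi>. I x \<phi>}) ` P" using \<phi>(2) normal_cone_strict[OF s] by blast
next
  fix C assume "C \<in> (\<lambda>x. {\<phi>. I x \<phi>}) ` P"
  then obtain x where x: "x \<in> P" "C = {\<phi>. I x \<phi>}" by blast
  obtain \<phi> where \<phi>: "\<phi> \<in> dual_space V" "x \<in> rel_interior {z. I z \<phi>}"
    using rel_interior_partner[OF x(1)] .
  have "C = normal_cone V P {z. I z \<phi>}"
    using x normal_cone_strict[OF strict_if_rel_interior[OF \<phi>]] by simp
  then show "C \<in> normal_fan V P" unfolding normal_fan_def faces_eq using \<phi>(1) by blast
qed

lemma face_over_in_faces: "\<lbrakk>q \<in> Q; \<psi> \<in> KD\<rbrakk> \<Longrightarrow> fc q \<psi> \<in> faces P"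
proof -
  assume "q \<in> Q" "\<psi> \<in> KD"
  then obtain \<phi> where "\<phi> \<in> dual_space V" "fc q \<psi> = {z. I z \<phi>}" by (rule pair_over)
  then show ?thesis unfolding faces_eq by blast
qed

text \<open>Every face is recovered from its normal cone, since it is exposed by a functional.\<close>

lemma normal_cone_subset_iff:
  assumes "F \<in> faces P" "G \<in> faces P"
  shows "normal_cone V P F \<subseteq> normal_cone V P G \<longleftrightarrow> G \<subseteq> F"
proof -
  obtain \<phi> \<phi>' where \<phi>: "\<phi> \<in> dual_space V" "F = {z. I z \<phi>}" "\<phi>' \<in> dual_space V" "G = {z. I z \<phi>'}"
    using assms unfolding faces_eq by blast
  show ?thesis
    unfolding \<phi>(2,4) normal_cone_exposed[OF \<phi>(1)] normal_cone_exposed[OF \<phi>(3)] by blast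
qed

lemma inj_on_normal_cone: "inj_on (normal_cone V P) (faces P)"
  using normal_cone_subset_iff by (intro inj_onI) (metis order_refl subset_antisym)

lemma face_pt_eq:
  assumes "q \<in> Q" "\<psi> \<in> KD"
  shows "face_pt p P q \<psi> = fc q \<psi>"
proof -
  obtain x \<phi> where s: "strict_pair I x \<phi>" "p x = q" "r \<phi> = \<psi>" "I x \<phi>" "x \<in> P" "\<phi> \<in> dual_space V"
    "fc q \<psi> = {z. I z \<phi>}" "nc \<psi> q = {\<phi>. I x \<phi>}"
    by (rule pair_over[OF assms])
  have m: "max_face \<psi> (fiber p P q) = {z. I z \<phi> \<and> p z = q}"
    using fiber_functionals[OF s(4)] s by simp
  show ?thesis
    unfolding face_pt_def m s(7)
  proof (intro equalityI Inter_lower Inter_greatest CollectI conjI)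
    show "{z. I z \<phi>} face_of P" by (rule exposed_face(1)[OF s(6)])
    show "{z. I z \<phi> \<and> p z = q} \<subseteq> {z. I z \<phi>}" by blast
    fix F assume "F \<in> {F. F face_of P \<and> {z. I z \<phi> \<and> p z = q} \<subseteq> F}"
    then have F: "F face_of P" "x \<in> F" using s by auto
    then have "F \<noteq> {}" by blast
    then obtain \<phi>' where \<phi>': "F = {z. I z \<phi>'}" using face_exposed[OF F(1)] by blast
    then have "I x \<phi>'" using F(2) by simp
    then show "{z. I z \<phi>} \<subseteq> F" unfolding \<phi>' by (rule strict_pair_subset[OF s(1)])
  qed
qed

lemma Inter_members_through:
  "\<Inter>{C |C. \<exists>i. C = f i \<and> y \<in> C} = {y'. \<forall>i. y \<in> f i \<longrightarrow> y' \<in> f i}"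
  by auto

lemma cell_eq:
  assumes q: "q \<in> Q"
  shows "cell p P q = {q' \<in> Q. below q' q}"
proof -
  have "cell p P q = {q'. below q' q}"
  proof -
    have "{p ` F |F. F \<in> faces P \<and> q \<in> p ` F} = {C |C. \<exists>\<phi>. C = p ` {x. I x \<phi>} \<and> q \<in> C}" (is "?A = ?B")
    proof
      show "?A \<subseteq> ?B" unfolding faces_eq by blast
      show "?B \<subseteq> ?A"
      proof
        fix C assume "C \<in> ?B"
        then obtain \<phi> where \<phi>: "C = p ` {x. I x \<phi>}" "q \<in> C" by blast
        then have "\<phi> \<in> dual_space V" by (auto simp: maximal_at_def)
        then show "C \<in> ?A" unfolding faces_eq using \<phi> by blast
      qed
    qed
    then show ?thesis unfolding cell_def cell_le_def by (simp only: Inter_members_through)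
  qed
  moreover have "q' \<in> Q" if b: "below q' q" for q'
  proof -
    obtain x where x: "x \<in> P" "p x = q" using q by blast
    obtain \<phi> where "\<phi> \<in> dual_space V" "x \<in> rel_interior {z. I z \<phi>}"
      using rel_interior_partner[OF x(1)] .
    then have "q \<in> p ` {z. I z \<phi>}" using x rel_interior_subset by blast
    then have "q' \<in> p ` {z. I z \<phi>}" using b by (simp add: cell_le_def)
    then show ?thesis by (auto simp: maximal_at_def)
  qed
  ultimately show ?thesis by blast
qed

lemma cone_at_eq:
  assumes \<psi>: "\<psi> \<in> KD"
  shows "cone_at p V P \<psi> = {\<psi>' \<in> KD. below' \<psi>' \<psi>}"
proof -
  have "{r ` normal_cone V P F |F. F \<in> faces P \<and> \<psi> \<in> r ` normal_cone V P F} =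
      {r ` C |C. C \<in> normal_fan V P \<and> \<psi> \<in> r ` C}"
    unfolding normal_fan_def by blast
  also have "\<dots> = {C |C. \<exists>x. C = r ` {\<phi>. I x \<phi>} \<and> \<psi> \<in> C}" (is "?A = ?B")
  proof
    show "?A \<subseteq> ?B" unfolding normal_fan_eq by blast
    show "?B \<subseteq> ?A"
    proof
      fix C assume "C \<in> ?B"
      then obtain x where x: "C = r ` {\<phi>. I x \<phi>}" "\<psi> \<in> C" by blast
      then have "x \<in> P" by (auto simp: maximal_at_def)
      then show "C \<in> ?A" unfolding normal_fan_eq using x by blast
    qed
  qed
  finally have "cone_at p V P \<psi> = {\<psi>'. below' \<psi>' \<psi>}"
    unfolding cone_at_def cell_le_def by (simp only: Inter_members_through)
  moreover have "\<psi>' \<in> KD" if b: "below' \<psi>' \<psi>" for \<psi>'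
  proof -
    obtain \<phi> x where \<phi>: "\<psi> = r \<phi>" "I x \<phi>" using \<psi> shadow_functionals unfolding shadow_def by blast
    then have "\<psi>' \<in> r ` {\<phi>. I x \<phi>}" using b unfolding cell_le_def by blast
    then show ?thesis using r_in by (auto simp: maximal_at_def)
  qed
  ultimately show ?thesis by blast
qed

lemma below_refl: "below q q" and below'_refl: "below' \<psi> \<psi>"
  by (simp_all add: cell_le_def)

lemma cell_subset_iff: "\<lbrakk>q \<in> Q; q' \<in> Q\<rbrakk> \<Longrightarrow> cell p P q' \<subseteq> cell p P q \<longleftrightarrow> below q' q"
  using cell_eq below_refl pairing.cell_le_trans[OF pairing] by blast

lemma cone_at_subset_iff:
  "\<lbrakk>\<psi> \<in> KD; \<psi>' \<in> KD\<rbrakk> \<Longrightarrow> cone_at p V P \<psi>' \<subseteq> cone_at p V P \<psi> \<longleftrightarrow> below' \<psi>' \<psi>"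
  using cone_at_eq below'_refl pairing.cell_le_trans[OF dual_pairing] by blast

lemmas convex_face_projection = pairing_side.convex_projection[OF pairing_side_points]
lemmas convex_cone_projection = pairing_side.convex_projection[OF pairing_side_functionals]

text \<open>The chosen points of cells and cones can replace any point or functional in question: they have
  the same cell or cone, hence the same faces.\<close>

lemma rel_point_cell:
  assumes q: "q \<in> Q"
  shows "rel_point (cell p P q) \<in> Q" "below (rel_point (cell p P q)) q" "below q (rel_point (cell p P q))"
proof -
  let ?q = "rel_point (cell p P q)"
  have "convex (cell p P q)"
    unfolding cell_def faces_eq by (intro convex_Inter) (auto intro: convex_face_projection)
  moreover have "q \<in> cell p P q" using q cell_eq below_refl by blast
  ultimately have c: "?q \<in> intrinsic_core (cell p P q)" using rel_point_core by blast
  then show m: "?q \<in> Q" "below ?q q"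
    using intrinsic_core_subset cell_eq[OF q] by blast+
  have "?q \<in> intrinsic_core {q' \<in> shadow I p. below q' q}"
    using c cell_eq[OF q] unfolding shadow_points by simp
  then show "below q ?q"
    using pairing.core_of_cell[OF pairing] q m(1) unfolding shadow_points by blast
qed

lemma rel_point_cone:
  assumes \<psi>: "\<psi> \<in> KD"
  shows "rel_point (cone_at p V P \<psi>) \<in> KD" "below' (rel_point (cone_at p V P \<psi>)) \<psi>"
    "below' \<psi> (rel_point (cone_at p V P \<psi>))"
proof -
  let ?\<psi> = "rel_point (cone_at p V P \<psi>)"
  have "convex (cone_at p V P \<psi>)"
  proof -
    have "convex (r ` normal_cone V P F)" if "F \<in> faces P" for F
    proof -
      have "normal_cone V P F \<in> normal_fan V P" using that by (simp add: normal_fan_def)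
      then show ?thesis unfolding normal_fan_eq using convex_cone_projection by force
    qed
    then show ?thesis unfolding cone_at_def by (intro convex_Inter) auto
  qed
  moreover have "\<psi> \<in> cone_at p V P \<psi>" "cone_at p V P \<psi> \<subseteq> KD"
    using \<psi> cone_at_eq[OF \<psi>] below'_refl by blast+
  ultimately have c: "?\<psi> \<in> intrinsic_core (cone_at p V P \<psi>)"
    using rel_point_functionals[OF K(1)] by blast
  then show m: "?\<psi> \<in> KD" "below' ?\<psi> \<psi>"
    using intrinsic_core_subset cone_at_eq[OF \<psi>] by blast+
  have "?\<psi> \<in> intrinsic_core {\<psi>' \<in> shadow (\<lambda>\<phi> x. I x \<phi>) r. below' \<psi>' \<psi>}"
    using c cone_at_eq[OF \<psi>] unfolding shadow_functionals by simp
  then show "below' \<psi> ?\<psi>"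
    using pairing.core_of_cell[OF dual_pairing] \<psi> m(1) unfolding shadow_functionals by blast
qed

lemma face_over_rel_point_cell:
  assumes "q \<in> Q" "\<psi> \<in> KD"
  shows "fc (rel_point (cell p P q)) \<psi> = fc q \<psi>"
  using pairing.same_cell_face[OF pairing, of q "rel_point (cell p P q)" \<psi>] rel_point_cell assms
  unfolding shadow_points shadow_functionals by blast

lemma cone_over_rel_point_cone:
  assumes "q \<in> Q" "\<psi> \<in> KD"
  shows "nc (rel_point (cone_at p V P \<psi>)) q = nc \<psi> q"
  using pairing.same_cell_face[OF dual_pairing, of \<psi> "rel_point (cone_at p V P \<psi>)" q] rel_point_cone assms
  unfolding shadow_points shadow_functionals by (metis shadow_points)

lemma cone_over_subset_iff:
  assumes "q \<in> Q" "q' \<in> Q" "\<psi> \<in> KD" "\<psi>' \<in> KD"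
  shows "nc \<psi> q \<subseteq> nc \<psi>' q' \<longleftrightarrow> fc q' \<psi>' \<subseteq> fc q \<psi>"
  using pairing.face_over_dual_subset_iff[OF pairing] assms unfolding shadow_points shadow_functionals by blast

lemma cone_over_eq_iff:
  assumes "q \<in> Q" "q' \<in> Q" "\<psi> \<in> KD" "\<psi>' \<in> KD"
  shows "nc \<psi> q = nc \<psi>' q' \<longleftrightarrow> fc q \<psi> = fc q' \<psi>'"
  using pairing.face_over_dual_eq_iff[OF pairing] assms unfolding shadow_points shadow_functionals by metis

lemma face_over_rel_point_cone:
  assumes "q \<in> Q" "\<psi> \<in> KD"
  shows "fc q (rel_point (cone_at p V P \<psi>)) = fc q \<psi>"
  using cone_over_rel_point_cone[OF assms] cone_over_eq_iff[OF assms(1) assms(1)] rel_point_cone assms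
  by metis

lemma face_cell_eq: "\<lbrakk>q \<in> Q; \<psi> \<in> KD\<rbrakk> \<Longrightarrow> face_cell p P (cell p P q) \<psi> = fc q \<psi>"
  unfolding face_cell_def using face_pt_eq rel_point_cell face_over_rel_point_cell by metis

lemma face_cone_eq: "\<lbrakk>q \<in> Q; \<psi> \<in> KD\<rbrakk> \<Longrightarrow> face_cone p P q (cone_at p V P \<psi>) = fc q \<psi>"
  unfolding face_cone_def using face_pt_eq rel_point_cone face_over_rel_point_cone by metis

text \<open>The smallest cone containing \<open>\<psi>\<close> of the normal fan of a fiber is the normal cone of the face of the
  fiber cut out by \<open>\<psi>\<close>. By duality it consists of the restrictions of the functionals in the normal
  cone of \<open>F\<^bsub>q,\<psi>\<^esub>\<close>.\<close>

lemma fiber_cone_eq: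
  assumes q: "q \<in> Q" and \<psi>: "\<psi> \<in> KD"
  shows "fiber_cone p V P (cell p P q) \<psi> = r ` nc \<psi> (rel_point (cell p P q))"
proof -
  define q0 where "q0 = rel_point (cell p P q)"
  have q0: "q0 \<in> Q" using rel_point_cell q by (simp add: q0_def)
  obtain x \<phi> where s: "strict_pair I x \<phi>" "p x = q0" "r \<phi> = \<psi>" "I x \<phi>" "x \<in> P" "\<phi> \<in> dual_space V"
    "fc q0 \<psi> = {z. I z \<phi>}" "nc \<psi> q0 = {\<phi>. I x \<phi>}"
    by (rule pair_over[OF q0 \<psi>])
  define E where "E = max_face \<psi> (fiber p P q0)"
  have E: "E = {z. I z \<phi>} \<inter> fiber p P q0"
    using fiber_functionals[OF s(4)] s by (auto simp: E_def fiber_def maximal_at_def)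
  have xE: "x \<in> E" using E s by (simp add: fiber_def)
  have "convex (fiber p P q0)"
    unfolding fiber_def using P(1) polytope_imp_convex linp
    by (intro convex_Int convex_linear_vimage) auto
  then have "E face_of (P \<inter> fiber p P q0)"
    unfolding E by (intro face_of_Int_Int exposed_face(1) s face_of_refl)
  moreover have "P \<inter> fiber p P q0 = fiber p P q0" by (auto simp: fiber_def)
  ultimately have Ef: "E \<in> faces (fiber p P q0)" using xE by (auto simp: faces_def)
  have "fiber_cone p V P (cell p P q) \<psi> = normal_cone K (fiber p P q0) E"
  proof
    have "\<psi> \<in> normal_cone K (fiber p P q0) E" using \<psi> by (simp add: normal_cone_def E_def)
    then show "fiber_cone p V P (cell p P q) \<psi> \<subseteq> normal_cone K (fiber p P q0) E"
      unfolding fiber_cone_def normal_fan_def q0_def[symmetric] using Ef by blast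
    show "normal_cone K (fiber p P q0) E \<subseteq> fiber_cone p V P (cell p P q) \<psi>"
      unfolding fiber_cone_def normal_fan_def q0_def[symmetric]
      by (auto simp: normal_cone_def E_def)
  qed
  also have "\<dots> = r ` {\<phi>. I x \<phi>}"
  proof (intro equalityI subsetI)
    fix \<psi>' assume "\<psi>' \<in> normal_cone K (fiber p P q0) E"
    then have "\<psi>' \<in> KD" "x \<in> max_face \<psi>' (fiber p P q0)" using xE by (auto simp: normal_cone_def)
    then show "\<psi>' \<in> r ` {\<phi>. I x \<phi>}"
      unfolding functionals_of_point[OF s(5)] by (auto simp: max_face_def s(2))
  next
    fix \<psi>' assume "\<psi>' \<in> r ` {\<phi>. I x \<phi>}"
    then obtain \<phi>' where \<phi>': "I x \<phi>'" "\<psi>' = r \<phi>'" by blast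
    have "{z. I z \<phi>} \<subseteq> {z. I z \<phi>'}" by (rule strict_pair_subset[of I, OF s(1) \<phi>'(1)])
    then have "E \<subseteq> max_face \<psi>' (fiber p P q0)"
      using E fiber_functionals[OF \<phi>'(1)] s(2) \<phi>'(2) by (auto simp: fiber_def)
    then show "\<psi>' \<in> normal_cone K (fiber p P q0) E"
      using \<phi>' r_in by (auto simp: normal_cone_def maximal_at_def)
  qed
  finally show ?thesis using s(8) by (simp add: q0_def)
qed

lemma rel_interior_fiber_cone:
  assumes q: "q \<in> Q" and \<psi>: "\<psi> \<in> KD"
  shows "rel_interior (fiber_cone p V P (cell p P q) \<psi>) = intrinsic_core (r ` nc \<psi> q)"
proof -
  define q0 where "q0 = rel_point (cell p P q)"
  have q0: "q0 \<in> Q" using rel_point_cell q by (simp add: q0_def)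
  have nc: "nc \<psi> q0 = nc \<psi> q"
    using cone_over_eq_iff[OF q0 q \<psi> \<psi>] face_over_rel_point_cell[OF q \<psi>] by (simp add: q0_def)
  obtain x where x: "nc \<psi> q = {\<phi>. I x \<phi>}" by (rule pair_over[OF q \<psi>])
  have "r ` nc \<psi> q \<subseteq> KD" unfolding x using r_in by (auto simp: maximal_at_def)
  moreover have "convex (r ` nc \<psi> q)" unfolding x by (rule convex_cone_projection)
  ultimately show ?thesis
    unfolding fiber_cone_eq[OF q \<psi>] q0_def[symmetric] nc
    by (rule rel_interior_functionals(1)[OF K(1)])
qed

text \<open>Among the members of a coherent string that project onto a set containing \<open>q\<close>, the one attached to
  \<open>q\<close> is the smallest.\<close>

lemma smallest_face_eq:
  assumes q: "q \<in> Q" and \<psi>: "\<psi> \<in> KD"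
  shows "smallest_face p P q (cone_at p V P \<psi>) = fc q \<psi>"
proof -
  define \<psi>0 where "\<psi>0 = rel_point (cone_at p V P \<psi>)"
  have \<psi>0: "\<psi>0 \<in> KD" using rel_point_cone \<psi> by (simp add: \<psi>0_def)
  have "coherent_string p P \<psi>0 = (\<lambda>q. fc q \<psi>0) ` Q"
    unfolding coherent_string_def cells_def Setcompr_eq_image image_image using face_cell_eq \<psi>0
    by (intro image_cong) auto
  then have "smallest_face p P q (cone_at p V P \<psi>) = \<Inter>{F \<in> (\<lambda>q. fc q \<psi>0) ` Q. q \<in> p ` F}"
    unfolding smallest_face_def \<psi>0_def by simp
  also have "\<dots> = fc q \<psi>0"
  proof (intro equalityI Inter_lower Inter_greatest)
    show "fc q \<psi>0 \<in> {F \<in> (\<lambda>q. fc q \<psi>0) ` Q. q \<in> p ` F}"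
      using pairing.in_face_projection[OF pairing, of q \<psi>0] q \<psi>0
      unfolding shadow_points shadow_functionals by blast
    fix F assume "F \<in> {F \<in> (\<lambda>q. fc q \<psi>0) ` Q. q \<in> p ` F}"
    then obtain q1 where q1: "q1 \<in> Q" "F = fc q1 \<psi>0" "q \<in> p ` F" by blast
    then show "fc q \<psi>0 \<subseteq> F"
      using pairing.below_face_subset[OF pairing, of q1 q \<psi>0] q \<psi>0
      unfolding shadow_points shadow_functionals by blast
  qed
  also have "\<dots> = fc q \<psi>" using face_over_rel_point_cone[OF q \<psi>] by (simp add: \<psi>0_def)
  finally show ?thesis .
qed

lemma rel_interior_face_projection:
  assumes "q \<in> Q" "\<psi> \<in> KD"
  shows "rel_interior (p ` fc q \<psi>) = intrinsic_core (p ` fc q \<psi>)"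
proof -
  obtain \<phi> where "fc q \<psi> = {z. I z \<phi>}" by (rule pair_over[OF assms])
  then show ?thesis by (simp only: rel_interior_eq_core[OF convex_face_projection])
qed

end


section \<open>Strings and virtual cones\<close>

context polytope_projection
begin

lemma coherent_on_cells_iff:
  "coherent_on_cells p V P \<Psi> \<longleftrightarrow> coherent_choice I p r (\<lambda>q. \<Psi> (cell p P q))"
proof (cases "\<forall>q\<in>Q. \<Psi> (cell p P q) \<in> KD")
  case True
  have "coherent_choice I p r (\<lambda>q. \<Psi> (cell p P q)) \<longleftrightarrow>
    (\<forall>q\<in>Q. \<forall>q'\<in>Q. below q' q \<longrightarrow>
      intrinsic_core (r ` nc (\<Psi> (cell p P q)) q) \<subseteq> intrinsic_core (r ` nc (\<Psi> (cell p P q')) q'))"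
    using pairing.coherent_choice_iff_core[OF pairing, of "\<lambda>q. \<Psi> (cell p P q)"] True
    unfolding shadow_points shadow_functionals by blast
  also have "\<dots> \<longleftrightarrow> (\<forall>q\<in>Q. \<forall>q'\<in>Q. cell p P q' \<subseteq> cell p P q \<longrightarrow>
      rel_interior (fiber_cone p V P (cell p P q) (\<Psi> (cell p P q)))
        \<subseteq> rel_interior (fiber_cone p V P (cell p P q') (\<Psi> (cell p P q'))))"
    using bspec[OF True] by (intro ball_cong refl) (simp only: rel_interior_fiber_cone cell_subset_iff)
  also have "\<dots> \<longleftrightarrow> coherent_on_cells p V P \<Psi>"
    using True unfolding coherent_on_cells_def cells_def ker_dual_def by simp
  finally show ?thesis by simp
next
  case False
  then show ?thesis
    unfolding coherent_on_cells_def coherent_choice_def cells_def ker_dual_def shadow_points shadow_functionals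
    by blast
qed

lemma coherent_on_cells_mem: "\<lbrakk>coherent_on_cells p V P \<Psi>; q \<in> Q\<rbrakk> \<Longrightarrow> \<Psi> (cell p P q) \<in> KD"
  unfolding coherent_on_cells_def cells_def ker_dual_def by blast

lemma string_of_eq:
  assumes "coherent_on_cells p V P \<Psi>"
  shows "string_of p P \<Psi> = family_of I p r (\<lambda>q. \<Psi> (cell p P q))"
  unfolding string_of_def family_of_def cells_def shadow_points image_image
  by (intro image_cong refl) (simp only: face_cell_eq coherent_on_cells_mem[OF assms] imageI)

lemma face_cell_in_faces: "\<lbrakk>c \<in> cells p P; \<psi> \<in> KD\<rbrakk> \<Longrightarrow> face_cell p P c \<psi> \<in> faces P"
  using face_cell_eq face_over_in_faces by (auto simp: cells_def)

lemma string_faces: "coherent_on_cells p V P \<Psi> \<Longrightarrow> string_of p P \<Psi> \<subseteq> faces P"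
  unfolding string_of_def using face_cell_in_faces by (auto simp: coherent_on_cells_def ker_dual_def)

lemma union_le_string_iff:
  assumes "coherent_on_cells p V P \<Psi>" "coherent_on_cells p V P \<Psi>'"
  shows "union_le (string_of p P \<Psi>) (string_of p P \<Psi>') \<longleftrightarrow>
    (\<forall>c\<in>cells p P. face_cell p P c (\<Psi> c) \<subseteq> face_cell p P c (\<Psi>' c))"
proof -
  have "union_le (string_of p P \<Psi>) (string_of p P \<Psi>') \<longleftrightarrow>
    (\<forall>q\<in>Q. fc q (\<Psi> (cell p P q)) \<subseteq> fc q (\<Psi>' (cell p P q)))"
    unfolding union_le_def string_of_eq[OF assms(1)] string_of_eq[OF assms(2)]
    using pairing.coherent_union_le_iff[OF pairing] assms
    unfolding coherent_on_cells_iff shadow_points by blast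
  also have "\<dots> \<longleftrightarrow> (\<forall>q\<in>Q. face_cell p P (cell p P q) (\<Psi> (cell p P q)) \<subseteq>
      face_cell p P (cell p P q) (\<Psi>' (cell p P q)))"
    by (intro ball_cong refl) (simp only: face_cell_eq assms[THEN coherent_on_cells_mem])
  finally show ?thesis by (simp add: cells_def)
qed

lemma string_eqI:
  assumes "coherent_on_cells p V P \<Psi>" "coherent_on_cells p V P \<Psi>'"
    "\<Union>(string_of p P \<Psi>) = \<Union>(string_of p P \<Psi>')"
  shows "string_of p P \<Psi> = string_of p P \<Psi>'"
proof -
  have "face_cell p P c (\<Psi> c) = face_cell p P c (\<Psi>' c)" if "c \<in> cells p P" for c
    using union_le_string_iff[OF assms(1,2)] union_le_string_iff[OF assms(2,1)] assms(3) that
    unfolding union_le_def by blast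
  then show ?thesis by (simp add: string_of_def)
qed

lemma to_virtual_cone_eq: "to_virtual_cone V P F = normal_cone V P ` F"
  by (auto simp: to_virtual_cone_def)

lemma virtual_cone_eq: "virtual_cone p V P s = normal_cone V P ` string_of p P s"
  by (simp add: virtual_cone_def string_of_def image_image)

lemma normal_cone_image_eq_iff:
  "\<lbrakk>A \<subseteq> faces P; B \<subseteq> faces P\<rbrakk> \<Longrightarrow> normal_cone V P ` A = normal_cone V P ` B \<longleftrightarrow> A = B"
  by (rule inj_on_image_eq_iff[OF inj_on_normal_cone])

text \<open>A virtual cone, as a set of normal cones, determines its string, and the union of a string
  determines the member at each cell. So the order of virtual cones does not depend on the maps chosen
  to represent them.\<close>

lemma virtual_cone_le_iff:
  assumes "coherent_on_cells p V P \<Psi>" "coherent_on_cells p V P \<Psi>'"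
  shows "virtual_cone_le p V P (virtual_cone p V P \<Psi>') (virtual_cone p V P \<Psi>) \<longleftrightarrow>
    union_le (string_of p P \<Psi>) (string_of p P \<Psi>')"
proof -
  have nc: "normal_cone V P (face_cell p P c (s c)) \<subseteq> normal_cone V P (face_cell p P c (s' c)) \<longleftrightarrow>
      face_cell p P c (s' c) \<subseteq> face_cell p P c (s c)"
    if "coherent_on_cells p V P s" "coherent_on_cells p V P s'" "c \<in> cells p P" for s s' c
    using that by (intro normal_cone_subset_iff face_cell_in_faces) (auto simp: coherent_on_cells_def ker_dual_def)
  show ?thesis
  proof
    assume "union_le (string_of p P \<Psi>) (string_of p P \<Psi>')"
    then have "\<forall>c\<in>cells p P. normal_cone V P (face_cell p P c (\<Psi>' c)) \<subseteq> normal_cone V P (face_cell p P c (\<Psi> c))"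
      using nc[OF assms(2,1)] unfolding union_le_string_iff[OF assms] by simp
    then show "virtual_cone_le p V P (virtual_cone p V P \<Psi>') (virtual_cone p V P \<Psi>)"
      unfolding virtual_cone_le_def using assms by blast
  next
    assume "virtual_cone_le p V P (virtual_cone p V P \<Psi>') (virtual_cone p V P \<Psi>)"
    then obtain s s' where s: "coherent_on_cells p V P s" "coherent_on_cells p V P s'"
      "virtual_cone p V P \<Psi>' = virtual_cone p V P s" "virtual_cone p V P \<Psi> = virtual_cone p V P s'"
      "\<forall>c\<in>cells p P. normal_cone V P (face_cell p P c (s c)) \<subseteq> normal_cone V P (face_cell p P c (s' c))"
      unfolding virtual_cone_le_def by blast
    have "string_of p P \<Psi>' = string_of p P s" "string_of p P \<Psi> = string_of p P s'"
      using s(3,4) unfolding virtual_cone_eq by (simp_all add: normal_cone_image_eq_iff string_faces assms s)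
    then show "union_le (string_of p P \<Psi>) (string_of p P \<Psi>')"
      using union_le_string_iff[OF s(2,1)] s(5) nc[OF s(1,2)] by simp
  qed
qed

lemma poset_on_strings: "poset_on (strings p V P) union_le"
  using string_eqI by (intro poset_on_union_le) (auto simp: strings_def)

theorem strings_anti_isomorphic_virtual_cones:
  "anti_isomorphism (strings p V P) union_le (virtual_cones p V P) (virtual_cone_le p V P) (to_virtual_cone V P)"
proof (rule anti_isomorphismI[OF poset_on_strings])
  have "inj_on (to_virtual_cone V P) (strings p V P)"
  proof (rule inj_onI)
    fix A B assume "A \<in> strings p V P" "B \<in> strings p V P"
      and eq: "to_virtual_cone V P A = to_virtual_cone V P B"
    then have "A \<subseteq> faces P" "B \<subseteq> faces P" using string_faces by (auto simp: strings_def)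
    then show "A = B" using eq unfolding to_virtual_cone_eq by (simp add: normal_cone_image_eq_iff)
  qed
  moreover have "to_virtual_cone V P ` strings p V P = virtual_cones p V P"
    unfolding strings_def virtual_cones_def virtual_cone_eq to_virtual_cone_eq by blast
  ultimately show "bij_betw (to_virtual_cone V P) (strings p V P) (virtual_cones p V P)"
    by (simp add: bij_betw_def)
  fix x y assume "x \<in> strings p V P" "y \<in> strings p V P"
  then obtain s s' where "coherent_on_cells p V P s" "x = string_of p P s"
    "coherent_on_cells p V P s'" "y = string_of p P s'"
    unfolding strings_def by blast
  then show "union_le x y \<longleftrightarrow> virtual_cone_le p V P (to_virtual_cone V P y) (to_virtual_cone V P x)"
    using virtual_cone_le_iff unfolding virtual_cone_eq to_virtual_cone_eq by simp
qed

lemma coherent_on_cells_const: "\<psi> \<in> KD \<Longrightarrow> coherent_on_cells p V P (\<lambda>_. \<psi>)"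
  unfolding coherent_on_cells_iff
  using pairing.coherent_choice_const[OF pairing] unfolding shadow_functionals by blast

lemma coherent_string_eq: "coherent_string p P \<psi> = string_of p P (\<lambda>_. \<psi>)"
  by (auto simp: coherent_string_def string_of_def)

lemma coherent_strings_subset: "coherent_strings p V P \<subseteq> strings p V P"
  unfolding coherent_strings_def strings_def ker_dual_def coherent_string_eq
  using coherent_on_cells_const by blast

lemma union_le_coherent_string_iff:
  assumes "\<psi> \<in> KD" "\<psi>' \<in> KD"
  shows "union_le (coherent_string p P \<psi>) (coherent_string p P \<psi>') \<longleftrightarrow> cone_at p V P \<psi>' \<subseteq> cone_at p V P \<psi>"
proof -
  have "union_le (coherent_string p P \<psi>) (coherent_string p P \<psi>') \<longleftrightarrow> (\<forall>q\<in>Q. fc q \<psi> \<subseteq> fc q \<psi>')"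
    unfolding coherent_string_eq union_le_string_iff[OF assms[THEN coherent_on_cells_const]]
    using assms by (simp add: cells_def face_cell_eq)
  also have "\<dots> \<longleftrightarrow> (\<forall>q\<in>Q. nc \<psi>' q \<subseteq> nc \<psi> q)"
    using assms by (simp add: cone_over_subset_iff)
  also have "\<dots> \<longleftrightarrow> below' \<psi>' \<psi>"
    using pairing.below_iff_faces_subset[OF dual_pairing, of \<psi> \<psi>'] assms
    unfolding shadow_points shadow_functionals by (metis shadow_points)
  finally show ?thesis using cone_at_subset_iff assms by simp
qed

theorem coherent_strings_anti_isomorphic_cones:
  "\<exists>g. anti_isomorphism (coherent_strings p V P) union_le (cones p V P) (\<subseteq>) g \<and>
       (\<forall>\<psi>\<in>ker_dual p V. g (coherent_string p P \<psi>) = cone_at p V P \<psi>) \<and>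
       (\<forall>F\<in>coherent_strings p V P. to_virtual_cone V P F = const_virtual_cone p V P (g F))"
proof -
  obtain g where g: "anti_isomorphism (coherent_strings p V P) union_le (cones p V P) (\<subseteq>) g"
    "\<forall>\<psi>\<in>ker_dual p V. g (coherent_string p P \<psi>) = cone_at p V P \<psi>"
  proof (atomize_elim, rule anti_isomorphism_of_parametrization)
    show "coherent_strings p V P = coherent_string p P ` ker_dual p V"
      "cones p V P = cone_at p V P ` ker_dual p V"
      by (simp_all add: coherent_strings_def cones_def)
    show "poset_on (coherent_strings p V P) union_le"
      using poset_on_mono[OF poset_on_strings coherent_strings_subset] .
    show "antisymp_on (cones p V P) (\<subseteq>)" by (auto simp: antisymp_on_def)
  qed (simp add: union_le_coherent_string_iff ker_dual_def)
  have "to_virtual_cone V P (coherent_string p P \<psi>) = const_virtual_cone p V P (cone_at p V P \<psi>)"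
    if \<psi>: "\<psi> \<in> KD" for \<psi>
  proof -
    have "string_of p P (\<lambda>_. \<psi>) = string_of p P (\<lambda>_. rel_point (cone_at p V P \<psi>))"
      unfolding string_of_def cells_def image_image
      using \<psi> rel_point_cone(1) by (intro image_cong) (simp_all add: face_cell_eq face_over_rel_point_cone)
    then show ?thesis
      by (simp add: to_virtual_cone_eq const_virtual_cone_def virtual_cone_eq coherent_string_eq)
  qed
  then have "\<forall>F\<in>coherent_strings p V P. to_virtual_cone V P F = const_virtual_cone p V P (g F)"
    unfolding coherent_strings_def using g(2) by (simp add: ker_dual_def)
  then show ?thesis using g by blast
qed


section \<open>Costrings and virtual cells\<close>

lemma coherent_on_cones_iff:
  "coherent_on_cones p V P b \<longleftrightarrow> coherent_choice (\<lambda>\<phi> x. I x \<phi>) r p (\<lambda>\<psi>. b (cone_at p V P \<psi>))"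
proof (cases "\<forall>\<psi>\<in>KD. b (cone_at p V P \<psi>) \<in> Q")
  case True
  have "coherent_choice (\<lambda>\<phi> x. I x \<phi>) r p (\<lambda>\<psi>. b (cone_at p V P \<psi>)) \<longleftrightarrow>
    (\<forall>\<psi>\<in>KD. \<forall>\<psi>'\<in>KD. below' \<psi>' \<psi> \<longrightarrow>
      intrinsic_core (p ` fc (b (cone_at p V P \<psi>)) \<psi>) \<subseteq> intrinsic_core (p ` fc (b (cone_at p V P \<psi>')) \<psi>'))"
    using pairing.coherent_choice_iff_core[OF dual_pairing, of "\<lambda>\<psi>. b (cone_at p V P \<psi>)"] True
    unfolding shadow_points shadow_functionals by blast
  also have "\<dots> \<longleftrightarrow> (\<forall>\<psi>\<in>KD. \<forall>\<psi>'\<in>KD. cone_at p V P \<psi>' \<subseteq> cone_at p V P \<psi> \<longrightarrow>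
      rel_interior (p ` smallest_face p P (b (cone_at p V P \<psi>)) (cone_at p V P \<psi>))
        \<subseteq> rel_interior (p ` smallest_face p P (b (cone_at p V P \<psi>')) (cone_at p V P \<psi>')))"
    using bspec[OF True] by (intro ball_cong refl)
      (simp only: rel_interior_face_projection smallest_face_eq cone_at_subset_iff)
  also have "\<dots> \<longleftrightarrow> coherent_on_cones p V P b"
    using True unfolding coherent_on_cones_def cones_def ker_dual_def by simp
  finally show ?thesis by simp
next
  case False
  then show ?thesis
    unfolding coherent_on_cones_def coherent_choice_def cones_def ker_dual_def shadow_points shadow_functionals
    by auto
qed

text \<open>It suffices to compare \<open>x\<close> with the vertices of its fiber.\<close>

lemma polyhedral_cone_of_point:
  assumes x: "x \<in> P"
  shows "polyhedral_cone K (r ` {\<phi>. I x \<phi>})"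
proof -
  have "polytope (fiber p P (p x))"
  proof -
    have "affine (p -` {p x})"
      using linp unfolding affine_def
      by (auto simp: linear_add linear_scale simp flip: scaleR_add_left)
    then have "polyhedron (p -` {p x})" by (rule affine_imp_polyhedron)
    then show ?thesis unfolding fiber_def using P(1) polytope_Int_polyhedron by blast
  qed
  then obtain S where S: "finite S" "fiber p P (p x) = convex hull S" by (auto simp: polytope_def)
  have SP: "y \<in> P" "p y = p x" if "y \<in> S" for y
    using that S hull_subset[of S convex] by (auto simp: fiber_def)
  have "r ` {\<phi>. I x \<phi>} = {\<psi> \<in> KD. \<forall>z\<in>(\<lambda>y. y - x) ` S. \<psi> z \<le> 0}"
    unfolding functionals_of_point[OF x]
  proof (intro Collect_cong conj_cong refl iffI)
    fix \<psi> assume "\<forall>y\<in>fiber p P (p x). \<psi> (y - x) \<le> 0"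
    then show "\<forall>z\<in>(\<lambda>y. y - x) ` S. \<psi> z \<le> 0" using SP by (auto simp: fiber_def)
  next
    fix \<psi> assume \<psi>: "\<psi> \<in> KD" and S0: "\<forall>z\<in>(\<lambda>y. y - x) ` S. \<psi> z \<le> 0"
    obtain u where u: "\<And>z. z \<in> K \<Longrightarrow> \<psi> z = u \<bullet> z" using dual_space_riesz[OF K(1) \<psi>] by blast
    have d: "\<psi> (y - x) = u \<bullet> y - u \<bullet> x" if "y \<in> P" "p y = p x" for y
      using u[OF fiber_diff[OF that(1) x that(2)]] by (simp add: inner_diff_right)
    have "S \<subseteq> {y. u \<bullet> y \<le> u \<bullet> x}" using S0 SP d by auto
    then have "fiber p P (p x) \<subseteq> {y. u \<bullet> y \<le> u \<bullet> x}"
      unfolding S(2) by (intro hull_minimal convex_halfspace_le)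
    then show "\<forall>y\<in>fiber p P (p x). \<psi> (y - x) \<le> 0" using d by (auto simp: fiber_def)
  qed
  moreover have "(\<lambda>y. y - x) ` S \<subseteq> K" using fiber_diff[OF _ x] SP by auto
  ultimately show ?thesis using S(1) unfolding polyhedral_cone_def by blast
qed

text \<open>The members of a tight subdivision are normal cones, so their number is finite and their images
  are polyhedral; together with tightness this is the definition of a costring.\<close>

lemma costrings_tight: "costrings p V P = {C. tight_subdivision (\<lambda>\<phi> x. I x \<phi>) r C}"
proof (intro equalityI subsetI CollectI)
  fix C assume "C \<in> costrings p V P"
  then have C: "C \<subseteq> normal_fan V P" "cone_subdivision K ((`) r ` C)" "inj_on ((`) r) C"
    "\<forall>\<tau>\<in>C. \<forall>\<tau>'\<in>C. r ` \<tau> \<subseteq> r ` \<tau>' \<longleftrightarrow> \<tau> = (r -` (r ` \<tau>)) \<inter> \<tau>'"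
    unfolding costrings_def by auto
  have "\<exists>\<phi> x. I x \<phi> \<and> \<tau> = {\<phi>. I x \<phi>}" if "\<tau> \<in> C" for \<tau>
  proof -
    have "\<tau> \<in> normal_fan V P" using C(1) that by blast
    then obtain x where x: "x \<in> P" "\<tau> = {\<phi>. I x \<phi>}" unfolding normal_fan_eq by (rule imageE)
    obtain \<phi> where "x \<in> rel_interior {z. I z \<phi>}" using rel_interior_partner[OF x(1)] .
    then show ?thesis using x rel_interior_subset by blast
  qed
  then show "tight_subdivision (\<lambda>\<phi> x. I x \<phi>) r C"
    unfolding tight_subdivision_def shadow_functionals
    using C(2-4) unfolding cone_subdivision_def by simp
next
  fix C assume "C \<in> {C. tight_subdivision (\<lambda>\<phi> x. I x \<phi>) r C}"
  then have C: "\<forall>\<tau>\<in>C. \<exists>\<phi> x. I x \<phi> \<and> \<tau> = {\<phi>. I x \<phi>}" "\<forall>\<tau>\<in>C. faces (r ` \<tau>) \<subseteq> (`) r ` C"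
    "\<forall>\<tau>\<in>C. \<forall>\<tau>'\<in>C. (r ` \<tau> \<inter> r ` \<tau>') face_of r ` \<tau>" "(\<Union>\<tau>\<in>C. r ` \<tau>) = KD"
    "inj_on ((`) r) C" "\<forall>\<tau>\<in>C. \<forall>\<tau>'\<in>C. r ` \<tau> \<subseteq> r ` \<tau>' \<longleftrightarrow> \<tau> = (r -` (r ` \<tau>)) \<inter> \<tau>'"
    unfolding tight_subdivision_def shadow_functionals by auto
  have pt: "\<exists>x\<in>P. \<tau> = {\<phi>. I x \<phi>}" if "\<tau> \<in> C" for \<tau>
    using C(1) that unfolding maximal_at_def by blast
  have fan: "C \<subseteq> normal_fan V P" unfolding normal_fan_eq using pt by blast
  have "C \<subseteq> range (\<lambda>x. {\<phi>. I x \<phi>})" using pt by blast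
  then have "finite C"
    using pairing_side.finite_faces[OF pairing_side_functionals] finite_subset by blast
  moreover have "polyhedral_cone K (r ` \<tau>)" if "\<tau> \<in> C" for \<tau>
    using pt[OF that] polyhedral_cone_of_point by blast
  moreover have "(r ` \<tau> \<inter> r ` \<tau>') face_of r ` \<tau>'" if "\<tau> \<in> C" "\<tau>' \<in> C" for \<tau> \<tau>'
    using C(3) that by (metis Int_commute)
  ultimately have "cone_subdivision K ((`) r ` C)"
    unfolding cone_subdivision_def using C(2-4) by simp
  then show "C \<in> costrings p V P"
    unfolding costrings_def using fan C(5,6) by simp
qed

lemma virtual_cell_eq:
  assumes "coherent_on_cones p V P b"
  shows "virtual_cell p V P b = (\<lambda>\<psi>. fc (b (cone_at p V P \<psi>)) \<psi>) ` KD"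
  unfolding virtual_cell_def cones_def ker_dual_def image_image
  using assms face_cone_eq by (intro image_cong) (auto simp: coherent_on_cones_def cones_def ker_dual_def)

lemma virtual_cell_faces: "coherent_on_cones p V P b \<Longrightarrow> virtual_cell p V P b \<subseteq> faces P"
  using face_over_in_faces by (auto simp: virtual_cell_eq coherent_on_cones_def cones_def ker_dual_def)

lemma normal_cones_of_virtual_cell:
  assumes "coherent_on_cones p V P b"
  shows "normal_cone V P ` virtual_cell p V P b =
    family_of (\<lambda>\<phi> x. I x \<phi>) r p (\<lambda>\<psi>. b (cone_at p V P \<psi>))"
  unfolding virtual_cell_eq[OF assms] family_of_def shadow_functionals image_image
  using assms by (intro image_cong refl)
    (auto simp: normal_cone_face_over coherent_on_cones_def cones_def ker_dual_def)

text \<open>A coherent choice of base points for functionals may be read off at the chosen points of the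
  cones, so it comes from a map on cones.\<close>

lemma costrings_eq:
  "costrings p V P = {normal_cone V P ` virtual_cell p V P b |b. coherent_on_cones p V P b}"
proof (intro equalityI subsetI)
  fix C assume "C \<in> costrings p V P"
  then obtain s where s: "coherent_choice (\<lambda>\<phi> x. I x \<phi>) r p s" "C = family_of (\<lambda>\<phi> x. I x \<phi>) r p s"
    using pairing.tight_subdivision_iff[OF dual_pairing] unfolding costrings_tight by blast
  have \<rho>: "rel_point (cone_at p V P \<psi>) \<in> KD \<and> below' \<psi> (rel_point (cone_at p V P \<psi>)) \<and>
      below' (rel_point (cone_at p V P \<psi>)) \<psi>" if "\<psi> \<in> KD" for \<psi>
    using rel_point_cone[OF that] by simp
  note re = pairing.coherent_choice_reindex[OF dual_pairing s(1),
      of "\<lambda>\<psi>. rel_point (cone_at p V P \<psi>)", unfolded shadow_functionals, OF \<rho>]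
  define b where "b \<sigma> = s (rel_point \<sigma>)" for \<sigma>
  have b: "coherent_on_cones p V P b"
    unfolding coherent_on_cones_iff b_def using re(1) by blast
  have "family_of (\<lambda>\<phi> x. I x \<phi>) r p (\<lambda>\<psi>. b (cone_at p V P \<psi>)) = C"
    unfolding s(2) family_of_def b_def shadow_functionals
    using re(2) by (intro image_cong refl) blast
  then show "C \<in> {normal_cone V P ` virtual_cell p V P b |b. coherent_on_cones p V P b}"
    using normal_cones_of_virtual_cell[OF b] b by blast
next
  fix C assume "C \<in> {normal_cone V P ` virtual_cell p V P b |b. coherent_on_cones p V P b}"
  then obtain b where b: "coherent_on_cones p V P b" "C = normal_cone V P ` virtual_cell p V P b" by blast
  then show "C \<in> costrings p V P"
    unfolding costrings_tight mem_Collect_eq pairing.tight_subdivision_iff[OF dual_pairing]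
    using normal_cones_of_virtual_cell[OF b(1)] coherent_on_cones_iff by blast
qed

lemma to_virtual_cell_normal_cones:
  assumes "A \<subseteq> faces P"
  shows "to_virtual_cell V P (normal_cone V P ` A) = A"
proof -
  have "to_virtual_cell V P (normal_cone V P ` A) = {F \<in> faces P. F \<in> A}"
    unfolding to_virtual_cell_def
    by (intro Collect_cong conj_cong refl inj_on_image_mem_iff[OF inj_on_normal_cone _ assms])
  then show ?thesis using assms by blast
qed

lemma union_le_costring_iff:
  assumes "coherent_on_cones p V P b" "coherent_on_cones p V P b'"
  shows "union_le (normal_cone V P ` virtual_cell p V P b) (normal_cone V P ` virtual_cell p V P b') \<longleftrightarrow>
    (\<forall>\<sigma>\<in>cones p V P. face_cone p P (b' \<sigma>) \<sigma> \<subseteq> face_cone p P (b \<sigma>) \<sigma>)"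
proof -
  have Q: "b (cone_at p V P \<psi>) \<in> Q" "b' (cone_at p V P \<psi>) \<in> Q" if "\<psi> \<in> KD" for \<psi>
    using assms that by (auto simp: coherent_on_cones_def cones_def ker_dual_def)
  have "union_le (normal_cone V P ` virtual_cell p V P b) (normal_cone V P ` virtual_cell p V P b') \<longleftrightarrow>
    (\<forall>\<psi>\<in>KD. nc \<psi> (b (cone_at p V P \<psi>)) \<subseteq> nc \<psi> (b' (cone_at p V P \<psi>)))"
    unfolding union_le_def normal_cones_of_virtual_cell[OF assms(1)] normal_cones_of_virtual_cell[OF assms(2)]
    using pairing.coherent_union_le_iff[OF dual_pairing] assms
    unfolding coherent_on_cones_iff shadow_functionals by blast
  also have "\<dots> \<longleftrightarrow> (\<forall>\<psi>\<in>KD. face_cone p P (b' (cone_at p V P \<psi>)) (cone_at p V P \<psi>) \<subseteq>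
      face_cone p P (b (cone_at p V P \<psi>)) (cone_at p V P \<psi>))"
    by (intro ball_cong refl) (simp add: cone_over_subset_iff face_cone_eq Q)
  finally show ?thesis by (simp add: cones_def ker_dual_def)
qed

lemma virtual_cell_eqI:
  assumes "\<And>\<sigma>. \<sigma> \<in> cones p V P \<Longrightarrow> face_cone p P (b \<sigma>) \<sigma> = face_cone p P (b' \<sigma>) \<sigma>"
  shows "virtual_cell p V P b = virtual_cell p V P b'"
  unfolding virtual_cell_def using assms by (rule image_cong[OF refl])

lemma poset_on_costrings: "poset_on (costrings p V P) union_le"
proof (rule poset_on_union_le)
  fix C C' assume "C \<in> costrings p V P" "C' \<in> costrings p V P" and eq: "\<Union>C = \<Union>C'"
  then obtain b b' where b: "coherent_on_cones p V P b" "C = normal_cone V P ` virtual_cell p V P b"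
    "coherent_on_cones p V P b'" "C' = normal_cone V P ` virtual_cell p V P b'"
    unfolding costrings_eq by blast
  have "face_cone p P (b \<sigma>) \<sigma> = face_cone p P (b' \<sigma>) \<sigma>" if "\<sigma> \<in> cones p V P" for \<sigma>
    using union_le_costring_iff[OF b(1,3)] union_le_costring_iff[OF b(3,1)] eq b(2,4) that
    by (intro subset_antisym) (simp_all add: union_le_def)
  then have "virtual_cell p V P b = virtual_cell p V P b'" by (rule virtual_cell_eqI)
  then show "C = C'" using b by simp
qed

theorem costrings_anti_isomorphic_virtual_cells:
  "anti_isomorphism (costrings p V P) union_le (virtual_cells p V P) (virtual_cell_le p V P) (to_virtual_cell V P)"
proof (rule anti_isomorphismI[OF poset_on_costrings])
  have inv: "to_virtual_cell V P (normal_cone V P ` virtual_cell p V P b) = virtual_cell p V P b"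
    if "coherent_on_cones p V P b" for b
    using to_virtual_cell_normal_cones virtual_cell_faces that by blast
  then have "inj_on (to_virtual_cell V P) (costrings p V P)"
    unfolding inj_on_def costrings_eq by fastforce
  moreover have "to_virtual_cell V P ` costrings p V P = virtual_cells p V P"
    unfolding costrings_eq virtual_cells_def using inv by (auto simp: image_iff)
  ultimately show "bij_betw (to_virtual_cell V P) (costrings p V P) (virtual_cells p V P)"
    by (simp add: bij_betw_def)
  fix C C' assume "C \<in> costrings p V P" "C' \<in> costrings p V P"
  then obtain b b' where b: "coherent_on_cones p V P b" "C = normal_cone V P ` virtual_cell p V P b"
    "coherent_on_cones p V P b'" "C' = normal_cone V P ` virtual_cell p V P b'"
    unfolding costrings_eq by blast
  have "virtual_cell_le p V P (virtual_cell p V P b') (virtual_cell p V P b) \<longleftrightarrow> union_le C C'"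
  proof
    assume "union_le C C'"
    then show "virtual_cell_le p V P (virtual_cell p V P b') (virtual_cell p V P b)"
      using union_le_costring_iff[OF b(1,3)] b unfolding virtual_cell_le_def by blast
  next
    assume "virtual_cell_le p V P (virtual_cell p V P b') (virtual_cell p V P b)"
    then obtain a a' where a: "coherent_on_cones p V P a" "coherent_on_cones p V P a'"
      "virtual_cell p V P b' = virtual_cell p V P a" "virtual_cell p V P b = virtual_cell p V P a'"
      "\<forall>\<sigma>\<in>cones p V P. face_cone p P (a \<sigma>) \<sigma> \<subseteq> face_cone p P (a' \<sigma>) \<sigma>"
      unfolding virtual_cell_le_def by blast
    then show "union_le C C'" using union_le_costring_iff[OF a(2,1)] b by simp
  qed
  then show "union_le C C' \<longleftrightarrow> virtual_cell_le p V P (to_virtual_cell V P C') (to_virtual_cell V P C)"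
    using inv b by simp
qed

lemma coherent_on_cones_const: "q \<in> Q \<Longrightarrow> coherent_on_cones p V P (\<lambda>_. q)"
  unfolding coherent_on_cones_iff
  using pairing.coherent_choice_const[OF dual_pairing] shadow_points by blast

lemma rel_point_cells: "c \<in> cells p P \<Longrightarrow> rel_point c \<in> Q"
  using rel_point_cell by (auto simp: cells_def)

lemma coherent_costring_eq:
  assumes "c \<in> cells p P"
  shows "coherent_costring p V P c = normal_cone V P ` const_virtual_cell p V P c"
proof -
  have q: "rel_point c \<in> Q" using rel_point_cells assms .
  have "coherent_costring p V P c = (\<lambda>\<psi>. normal_cone V P (fc (rel_point c) \<psi>)) ` KD"
    unfolding coherent_costring_def Setcompr_eq_image ker_dual_def face_cell_def
    using q by (intro image_cong refl) (simp add: face_pt_eq)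
  then show ?thesis
    unfolding const_virtual_cell_def virtual_cell_eq[OF coherent_on_cones_const[OF q]]
    by (simp add: image_image)
qed

lemma coherent_costrings_subset: "coherent_costrings p V P \<subseteq> costrings p V P"
proof
  fix C assume "C \<in> coherent_costrings p V P"
  then obtain c where "c \<in> cells p P" "C = coherent_costring p V P c"
    by (auto simp: coherent_costrings_def)
  then show "C \<in> costrings p V P"
    unfolding costrings_eq
    using coherent_costring_eq coherent_on_cones_const[OF rel_point_cells] unfolding const_virtual_cell_def
    by blast
qed

lemma union_le_coherent_costring_iff:
  assumes "c \<in> cells p P" "c' \<in> cells p P"
  shows "union_le (coherent_costring p V P c) (coherent_costring p V P c') \<longleftrightarrow> c' \<subseteq> c"
proof -
  let ?q = "rel_point c" and ?q' = "rel_point c'"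
  have q: "?q \<in> Q" "?q' \<in> Q" using rel_point_cells assms by auto
  have "union_le (coherent_costring p V P c) (coherent_costring p V P c') \<longleftrightarrow>
      (\<forall>\<psi>\<in>KD. fc ?q' \<psi> \<subseteq> fc ?q \<psi>)"
    unfolding coherent_costring_eq[OF assms(1)] coherent_costring_eq[OF assms(2)] const_virtual_cell_def
      union_le_costring_iff[OF q[THEN coherent_on_cones_const]]
    using q by (simp add: cones_def ker_dual_def face_cone_eq)
  also have "\<dots> \<longleftrightarrow> below ?q' ?q"
    using pairing.below_iff_faces_subset[OF pairing] q unfolding shadow_points shadow_functionals by blast
  also have "\<dots> \<longleftrightarrow> c' \<subseteq> c"
  proof -
    obtain q0 q0' where q0: "q0 \<in> Q" "c = cell p P q0" "q0' \<in> Q" "c' = cell p P q0'"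
      using assms by (auto simp: cells_def)
    have "below ?q' ?q \<longleftrightarrow> below q0' q0"
      using rel_point_cell[OF q0(1)] rel_point_cell[OF q0(3)] pairing.cell_le_trans[OF pairing]
      unfolding q0(2,4) by blast
    then show ?thesis using cell_subset_iff q0 by simp
  qed
  finally show ?thesis .
qed

theorem coherent_costrings_anti_isomorphic_cells:
  "\<exists>g. anti_isomorphism (coherent_costrings p V P) union_le (cells p P) (\<subseteq>) g \<and>
       (\<forall>c\<in>cells p P. g (coherent_costring p V P c) = c) \<and>
       (\<forall>C\<in>coherent_costrings p V P. to_virtual_cell V P C = const_virtual_cell p V P (g C))"
proof -
  obtain g where g: "anti_isomorphism (coherent_costrings p V P) union_le (cells p P) (\<subseteq>) g"
    "\<forall>c\<in>cells p P. g (coherent_costring p V P c) = c"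
  proof (atomize_elim, rule anti_isomorphism_of_parametrization)
    show "coherent_costrings p V P = coherent_costring p V P ` cells p P"
      by (simp add: coherent_costrings_def)
    show "cells p P = (\<lambda>c. c) ` cells p P" by simp
    show "poset_on (coherent_costrings p V P) union_le"
      using poset_on_mono[OF poset_on_costrings coherent_costrings_subset] .
    show "antisymp_on (cells p P) (\<subseteq>)" by (auto simp: antisymp_on_def)
  qed (simp add: union_le_coherent_costring_iff)
  have "to_virtual_cell V P (coherent_costring p V P c) = const_virtual_cell p V P c"
    if c: "c \<in> cells p P" for c
  proof -
    have "const_virtual_cell p V P c \<subseteq> faces P"
      unfolding const_virtual_cell_def
      by (intro virtual_cell_faces coherent_on_cones_const rel_point_cells c)
    then show ?thesis using to_virtual_cell_normal_cones coherent_costring_eq[OF c] by simp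
  qed
  then have "\<forall>C\<in>coherent_costrings p V P. to_virtual_cell V P C = const_virtual_cell p V P (g C)"
    unfolding coherent_costrings_def using g(2) by simp
  then show ?thesis using g by blast
qed

end


section \<open>The correspondences\<close>

theorem theoremA:
  fixes p :: "'v::euclidean_space \<Rightarrow> 'w::euclidean_space"
    and V P :: "'v set" and W :: "'w set"
  assumes "subspace V" and "subspace W"
    and "linear p" and "p ` V = W"
    and "polytope P" and "P \<subseteq> V" and "aff_dim P = int (dim V)"
  shows
    "(anti_isomorphism (strings p V P) union_le
        (virtual_cones p V P) (virtual_cone_le p V P) (to_virtual_cone V P) \<and>
      coherent_strings p V P \<subseteq> strings p V P \<and>
      (\<exists>g. anti_isomorphism (coherent_strings p V P) union_le (cones p V P) (\<subseteq>) g \<and>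
           (\<forall>\<psi>\<in>ker_dual p V. g (coherent_string p P \<psi>) = cone_at p V P \<psi>) \<and>
           (\<forall>F\<in>coherent_strings p V P.
              to_virtual_cone V P F = const_virtual_cone p V P (g F)))) \<and>
     (anti_isomorphism (costrings p V P) union_le
        (virtual_cells p V P) (virtual_cell_le p V P) (to_virtual_cell V P) \<and>
      coherent_costrings p V P \<subseteq> costrings p V P \<and>
      (\<exists>g. anti_isomorphism (coherent_costrings p V P) union_le (cells p P) (\<subseteq>) g \<and>
           (\<forall>c\<in>cells p P. g (coherent_costring p V P c) = c) \<and>
           (\<forall>C\<in>coherent_costrings p V P.
              to_virtual_cell V P C = const_virtual_cell p V P (g C))))"
proof -
  have "P \<noteq> {}" using \<open>aff_dim P = int (dim V)\<close> by auto
  then interpret polytope_projection p V P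
    using assms by (intro polytope_projection.intro)
  show ?thesis
    using strings_anti_isomorphic_virtual_cones coherent_strings_subset
      coherent_strings_anti_isomorphic_cones costrings_anti_isomorphic_virtual_cells
      coherent_costrings_subset coherent_costrings_anti_isomorphic_cells by blast
qed

end
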